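(* Let $V_5^*$ be the space of binary quintic forms over $\mathbf{F}_q$ with $\mathrm{char}\,\mathbf{F}_q = p > 2$, and let $w \in V_5 = (V_5^* )^*$. Then \[ \widehat{\Phi}(w) = \begin{cases} q^{-1} + q^{-2} - q^{-3} & \text{if } w=0, \\ q^{-2} - q^{-3} & \text{if } w \text{ has Waring type } \langle 1 \rangle \text{ or } \langle 1^2 \rangle, \\ C(w)\, q^{-4} & \text{in all other cases}, \end{cases} \] where, in the last case, \[ C(w) = -\sum_{\substack{[f_2] \in \mathbf{P}(V^*_2) \\ f_2^2 \in w^\bot}} \varepsilon([f_2]) \] and \[ C(w) \in \begin{cases} \{-1\} & \text{if the Waring type of } w \text{ is } \langle 1, 1 \rangle, \\ \{1\} & \text{if the Waring type of } w \text{ is } \langle 2 \rangle, \\ \{0, \pm 1\} & \text{if the Waring type of } w \text{ is } \langle 1^3 \rangle, \\ \{0, \pm 1, -2, -3\} & \text{if the Waring type of } w \text{ is } \langle 1^2, 1 \rangle, \\ \{0, \pm 1, \pm 2, \pm 3, \pm 4\} & \text{for the other Waring types (namely } \langle 1,1,1\rangle, \langle 2,1\rangle, \langle 3\rangle). \end{cases} \]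
   Context: $\mathbf{F}_q$ is the field with $q$ elements, $q$ a power of the prime $p$. $V_n^*$ ($n\ge 0$) is the $\mathbf{F}_q$-vector space of binary forms of degree $n$ in $x,y$ (homogeneous polynomials of degree $n$ in $\mathbf{F}_q[x,y]$), $V_n=(V_n^* )^*$ is its dual space, and $(\cdot,\cdot)\colon V_n\times V_n^*\to\mathbf{F}_q$ is the natural perfect pairing. Fix a nontrivial additive character $\psi\colon\mathbf{F}_q\to\mathbf{C}^\times$. A binary form is singular if it has a repeated factor, equivalently if its discriminant $\mathrm{Disc}$ vanishes (the zero form is counted as singular). Define \[ \widehat{\Phi}(w) = \frac{1}{\# V^*_5} \sum_{\substack{f \in V_5^* \\ \mathrm{Disc}(f) = 0}} \psi((w, f)) \qquad (w \in V_5). \] Polar pairing and apolar ideal: for $0\le m\le n$, $w\in V_n$ and $f_1\in V_m^*$, the element $(w,f_1)\in V_{n-m}$ is defined by $(w,f_1)(f_2)=(w,f_1f_2)$ for $f_2\in V_{n-m}^*$; for $m>n$ one sets $(w,f_1)=0$. For $w\in V_n$, $w^\bot\subseteq\mathbf{F}_q[x,y]$ is the homogeneous ideal of all $f$ with $(w,f)=0$. Splitting type: if a nonzero binary form $f$ factors as $c f_1^{e_1}\cdots f_r^{e_r}$ with $c$ a nonzero constant and pairwise non-proportional irreducible forms $f_i$ over $\mathbf{F}_q$ of degree $d_i$, its splitting type is the symbol $\langle d_1^{e_1},\dots,d_r^{e_r}\rangle$ (exponents equal to $1$ are omitted). Waring type: for $0\ne w\in V_5$, written $w=\sum_{i=0}^5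 a_i (x^{5-i}y^i)^*$ in the basis dual to the monomials, let $s\in\{1,2,3\}$ be the rank of the $3\times 4$ matrix $(a_{i+j})_{0\le i\le 2,\,0\le j\le 3}$. The ideal $w^\bot$ is generated by two forms, of degrees $s$ and $7-s$; the generator $\varphi_s$ of degree $s$ is the nonzero form of smallest degree in $w^\bot$ and is unique up to scalar. The Waring type of $w$ is the splitting type of $\varphi_s$. (The Waring type of $w=0$ is $\emptyset$.) $\mathbf{P}(V_2^* )$ is the set of nonzero elements of $V_2^*$ modulo $\mathbf{F}_q^\times$. The function $\varepsilon\colon\mathbf{P}(V_2^* )\to\mathbf{C}$ is: $\varepsilon([f_2])=1$ if $f_2$ is split (a product of two non-proportional linear forms over $\mathbf{F}_q$), $0$ if $f_2$ is ramified (a nonzero constant times the square of a linear form over $\mathbf{F}_q$), and $-1$ if $f_2$ is inert (irreducible over $\mathbf{F}_q$). *)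

theory Defs
  imports
    Complex_Main
    "HOL-Computational_Algebra.Computational_Algebra"
    "HOL-Library.Multiset"
    "HOL-Library.Cardinality"
    "Jordan_Normal_Form.DL_Rank"
begin

hide_const (open) module.smult

text \<open>
  The ring \<open>F[x,y]\<close> is rendered as \<open>F[x][y]\<close>: the outer polynomial variable is \<open>y\<close>, so the
  coefficient of \<open>x^i y^j\<close> in \<open>f\<close> is \<open>coeff (coeff f j) i\<close>, and a scalar \<open>c\<close> is \<open>[:[:c:]:]\<close>.
\<close>

type_synonym 'a binpoly = "'a poly poly"

definition X :: "'a::field binpoly" where "X = [:[:0, 1:]:]"

definition Y :: "'a::field binpoly" where "Y = [:0, 1:]"

definition scale :: "'a::field \<Rightarrow> 'a binpoly \<Rightarrow> 'a binpoly" where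
  "scale c f = smult [:c:] f"

definition forms :: "nat \<Rightarrow> 'a::field binpoly set" where
  "forms n = {f. \<forall>i j. coeff (coeff f j) i \<noteq> 0 \<longrightarrow> i + j = n}"

definition hom_comp :: "nat \<Rightarrow> 'a::field binpoly \<Rightarrow> 'a binpoly" where
  "hom_comp m f = (\<Sum>j\<le>m. scale (coeff (coeff f j) (m - j)) (X ^ (m - j) * Y ^ j))"

text \<open>
  The dual space of \<open>forms n\<close>. Its elements are functions on all of \<open>F[x,y]\<close>; they are made
  unique by requiring the value \<open>0\<close> outside \<open>forms n\<close>, so that equality of functionals is
  equality of functions. The pairing of \<open>w\<close> and \<open>f\<close> is the application \<open>w f\<close>.
\<close>

definition dual_forms :: "nat \<Rightarrow> ('a::field binpoly \<Rightarrow> 'a) set" where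
  "dual_forms n = {w.
     (\<forall>f\<in>forms n. \<forall>g\<in>forms n. w (f + g) = w f + w g) \<and>
     (\<forall>c. \<forall>f\<in>forms n. w (scale c f) = c * w f) \<and>
     (\<forall>f. f \<notin> forms n \<longrightarrow> w f = 0)}"

abbreviation zero_dual :: "'a::field binpoly \<Rightarrow> 'a" where
  "zero_dual \<equiv> (\<lambda>_. 0)"

text \<open>
  \<open>polar n w m f1\<close> is the element \<open>(w, f1)\<close> of \<open>dual_forms (n - m)\<close>, for \<open>w\<close> in \<open>dual_forms n\<close>
  and \<open>f1\<close> in \<open>forms m\<close>.
\<close>

definition polar :: "nat \<Rightarrow> ('a::field binpoly \<Rightarrow> 'a) \<Rightarrow> nat \<Rightarrow> 'a binpoly \<Rightarrow> ('a binpoly \<Rightarrow> 'a)" where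
  "polar n w m f1 =
     (if m \<le> n then (\<lambda>f2. if f2 \<in> forms (n - m) then w (f1 * f2) else 0) else zero_dual)"

definition apolar_ideal :: "nat \<Rightarrow> ('a::field binpoly \<Rightarrow> 'a) \<Rightarrow> 'a binpoly set" where
  "apolar_ideal n w = {f. \<forall>m. polar n w m (hom_comp m f) = zero_dual}"

text \<open>
  The discriminant of \<open>f = a_0 x^n + a_1 x^(n-1) y + ... + a_n y^n\<close> for \<open>n \<ge> 2\<close>, in the universal form
  valid in every characteristic and also for \<open>a_0 = 0\<close>: it is
  \<open>(-1)^(n(n-1)/2) Res(f, df/dx) / a_0\<close>, where the resultant is the determinant of the Sylvester
  matrix of formal degrees \<open>n\<close> and \<open>n - 1\<close>. Every entry of the first column of that matrix is an
  integer multiple of \<open>a_0\<close>, and the division is carried out on this column (so \<open>a_0\<close> is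
  replaced by \<open>1\<close> there).
\<close>

definition disc :: "nat \<Rightarrow> 'a::field binpoly \<Rightarrow> 'a" where
  "disc n f =
     (let a = (\<lambda>i. coeff (coeff f i) (n - i));
          b = (\<lambda>col i. if col = 0 then 1 else a i)
      in (-1) ^ (n * (n - 1) div 2) *
         det (mat (2 * n - 1) (2 * n - 1) (\<lambda>(row, col).
           if row < n - 1
           then (if row \<le> col \<and> col - row \<le> n then b col (col - row) else 0)
           else (let k = row - (n - 1) in
                 if k \<le> col \<and> col - k \<le> n - 1
                 then of_nat (n - (col - k)) * b col (col - k) else 0))))"

definition nontrivial_additive_character :: "('a::field \<Rightarrow> complex) \<Rightarrow> bool" where
  "nontrivial_additive_character \<psi> \<longleftrightarrow>
     (\<forall>a. \<psi> a \<noteq> 0) \<and> (\<forall>a b. \<psi> (a + b) = \<psi> a * \<psi> b) \<and> (\<exists>a. \<psi> a \<noteq> 1)"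

definition Phi_hat :: "('a::{field,finite} \<Rightarrow> complex) \<Rightarrow> ('a binpoly \<Rightarrow> 'a) \<Rightarrow> complex" where
  "Phi_hat \<psi> w =
     1 / of_nat (card (forms 5 :: 'a binpoly set)) * (\<Sum>f \<in> {f \<in> forms 5. disc 5 f = 0}. \<psi> (w f))"

definition proportional :: "'a::field binpoly \<Rightarrow> 'a binpoly \<Rightarrow> bool" where
  "proportional f g \<longleftrightarrow> (\<exists>c. c \<noteq> 0 \<and> g = scale c f)"

text \<open>
  The symbol \<open>\<langle>d_1^e_1, ..., d_r^e_r\<rangle>\<close> is the multiset of the pairs \<open>(d_i, e_i)\<close>.
  In the definition, \<open>S\<close> is the set of the irreducible factors \<open>f_i\<close>, \<open>d\<close> gives their degrees and
  \<open>e\<close> their exponents.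
\<close>

definition has_splitting_type :: "'a::field binpoly \<Rightarrow> (nat \<times> nat) multiset \<Rightarrow> bool" where
  "has_splitting_type f T \<longleftrightarrow>
     (\<exists>c S d e. c \<noteq> 0 \<and> finite S \<and>
        (\<forall>g\<in>S. irreducible g \<and> g \<in> forms (d g) \<and> e g \<ge> 1) \<and>
        (\<forall>g\<in>S. \<forall>h\<in>S. g \<noteq> h \<longrightarrow> \<not> proportional g h) \<and>
        f = scale c (\<Prod>g\<in>S. g ^ e g) \<and>
        T = image_mset (\<lambda>g. (d g, e g)) (mset_set S))"

definition hankel_rank :: "('a::field binpoly \<Rightarrow> 'a) \<Rightarrow> nat" where
  "hankel_rank w = vec_space.rank 3 (mat 3 4 (\<lambda>(i, j). w (X ^ (5 - (i + j)) * Y ^ (i + j))))"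

text \<open>
  The least-degree generator \<open>\<phi>_s\<close> of the apolar ideal of a nonzero \<open>w\<close> in \<open>dual_forms 5\<close>: a nonzero
  form of smallest degree in that ideal, this degree being \<open>s = hankel_rank w\<close>.
\<close>

definition is_least_generator :: "('a::field binpoly \<Rightarrow> 'a) \<Rightarrow> 'a binpoly \<Rightarrow> bool" where
  "is_least_generator w \<phi> \<longleftrightarrow>
     \<phi> \<in> forms (hankel_rank w) \<and> \<phi> \<noteq> 0 \<and> \<phi> \<in> apolar_ideal 5 w \<and>
     (\<forall>m. \<forall>g\<in>forms m. g \<noteq> 0 \<and> g \<in> apolar_ideal 5 w \<longrightarrow> hankel_rank w \<le> m)"

definition has_waring_type :: "('a::field binpoly \<Rightarrow> 'a) \<Rightarrow> (nat \<times> nat) multiset \<Rightarrow> bool" where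
  "has_waring_type w T \<longleftrightarrow>
     (if w = zero_dual then T = {#} else \<exists>\<phi>. is_least_generator w \<phi> \<and> has_splitting_type \<phi> T)"

definition proj_forms :: "nat \<Rightarrow> 'a::field binpoly set set" where
  "proj_forms n =
     (forms n - {0}) // {(f, g). f \<in> forms n - {0} \<and> g \<in> forms n - {0} \<and> proportional f g}"

definition split_form :: "'a::field binpoly \<Rightarrow> bool" where
  "split_form f \<longleftrightarrow>
     (\<exists>l1\<in>forms 1 - {0}. \<exists>l2\<in>forms 1 - {0}. \<not> proportional l1 l2 \<and> f = l1 * l2)"

definition ramified_form :: "'a::field binpoly \<Rightarrow> bool" where
  "ramified_form f \<longleftrightarrow> (\<exists>c. \<exists>l\<in>forms 1 - {0}. c \<noteq> 0 \<and> f = scale c (l ^ 2))"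

text \<open>
  The value of \<open>\<epsilon>\<close> on a class of nonzero quadratic forms; the three conditions are invariant under
  scaling, mutually exclusive and exhaustive, so the final branch does not occur.
\<close>

definition eps :: "'a::field binpoly set \<Rightarrow> complex" where
  "eps P =
     (if \<exists>f\<in>P. split_form f then 1
      else if \<exists>f\<in>P. ramified_form f then 0
      else if \<exists>f\<in>P. irreducible f then -1
      else undefined)"

definition C :: "('a::{field,finite} binpoly \<Rightarrow> 'a) \<Rightarrow> complex" where
  "C w = - (\<Sum>P \<in> {P \<in> proj_forms 2. \<exists>f2\<in>P. f2 ^ 2 \<in> apolar_ideal 5 w}. eps P)"

end

theory Submission
  imports Defs
begin

text \<open>
  The theorem reduces to counting linear and quadratic forms whose squares are apolar to \<open>w\<close>.

  \<^emph>\<open>The formula for the transform.\<close> A nonzero quintic form has room for at most two linear factors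
  \<open>l\<close> with \<open>l\<^sup>2\<close> dividing it, or for one irreducible quadratic factor \<open>r\<close> with \<open>r\<^sup>2\<close> dividing it, but not
  for both kinds. Going through the possibilities shows that, with \<open>l\<close> and \<open>r\<close> running over linear and
  quadratic forms up to scalars,
  \<open>#{l. l\<^sup>2 | f} - (\<Sum>r with r\<^sup>2 | f. \<epsilon>(r))\<close>
  is \<open>1\<close> if \<open>f\<close> has a repeated factor and \<open>0\<close> otherwise; for \<open>f = 0\<close> it is \<open>(q + 1) - q\<close>
  (lemma \<open>square_sieve\<close>). Over a finite field, which is perfect, a quintic has a repeated factor if
  and only if its discriminant vanishes (lemma \<open>disc_eq_0_iff_singular\<close>): the determinant vanishes
  if and only if \<open>U p + V p' = 0\<close> has a nontrivial solution in suitable degrees that satisfies a further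
  condition at infinity, where \<open>p = f(x, 1)\<close>.
  Multiplying the sieve by \<open>\<psi>(w f)\<close>, interchanging the sums and using the orthogonality of characters
  on the multiples of \<open>l\<^sup>2\<close> and of \<open>r\<^sup>2\<close> gives, for every \<open>w\<close>,
  \<open>Phi_hat \<psi> w = #{l. l\<^sup>2 \<in> w\<^sup>\<bottom>} / q\<^sup>2 + C w / q\<^sup>4\<close>
  (lemma \<open>Phi_hat_formula\<close>).

  \<^emph>\<open>The least generator.\<close> The kernel of the Hankel matrix of rank \<open>s\<close> is the space of cubic forms in
  \<open>w\<^sup>\<bottom>\<close>, so \<open>w\<^sup>\<bottom>\<close> contains \<open>q ^ (4 - s)\<close> cubic forms, and by duality \<open>q ^ (3 - s)\<close> quadratic forms.
  It follows from these numbers that a nonzero \<open>w\<close> has \<open>1 \<le> s \<le> 3\<close>, that \<open>w\<^sup>\<bottom>\<close> contains a nonzero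
  form of degree \<open>s\<close>, and that it contains none of smaller degree (lemmas \<open>least_generator_exists\<close>
  and \<open>rank_le_degree\<close>).

  \<^emph>\<open>Degenerate generators.\<close> If the generator involves a linear form \<open>l\<close> in one of the patterns
  \<open>l\<close>, \<open>l\<^sup>2\<close>, \<open>l m\<close>, \<open>l ^ 3\<close>, \<open>l\<^sup>2 m\<close>, then it forces some of the values \<open>A\<^sub>i = w(l ^ (5 - i) m ^ i)\<close>
  to vanish, where \<open>m\<close> is a linear form independent of \<open>l\<close>. For \<open>r = a l\<^sup>2 + b l m + c m\<^sup>2\<close> the condition
  \<open>r\<^sup>2 \<in> w\<^sup>\<bottom>\<close> becomes two quadratic equations in \<open>a, b, c\<close> with coefficients \<open>A\<^sub>i\<close>, and these are solved
  directly, dividing by \<open>2\<close>, which is possible in odd characteristic. For an irreducible quadratic generator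
  \<open>g\<close>, a dimension count shows that \<open>r\<^sup>2 \<in> w\<^sup>\<bottom>\<close> only for \<open>r\<close> proportional to \<open>g\<close>.

  \<^emph>\<open>Cubic generators.\<close> If \<open>s = 3\<close>, the conditions \<open>w(r\<^sup>2 l) = 0\<close>, \<open>l\<close> linear, define a pencil of conics
  in the projective plane of quadratic forms, and \<open>C w\<close> is minus a sum of values of \<open>\<epsilon>\<close> over its base
  points. The cubic forms in \<open>w\<^sup>\<bottom>\<close> are the multiples of a single one. No three base points are collinear
  (lemma \<open>square_zeros_not_collinear\<close>): otherwise every conic of the pencil contains the same line and
  is singular at one of its points, so that every linear form divides the apolar cubic.
  Five base points no three of which are collinear lie on only one conic, so some conic
  of the pencil vanishes identically; if it belongs to \<open>l\<close>, then all products \<open>l g\<close> with \<open>g\<close> quadratic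
  lie in \<open>w\<^sup>\<bottom>\<close>, a contradiction. Hence there are at most four base points
  (lemma \<open>card_square_zeros_le_4\<close>).
\<close>

section \<open>Binary forms and dehomogenization\<close>

text \<open>
  Setting \<open>y = 1\<close> is a ring homomorphism that is injective on the forms of a fixed degree; its inverse on
  the polynomials of degree at most \<open>n\<close> is \<open>homog n\<close>.
\<close>

definition dehom :: "'a::field binpoly \<Rightarrow> 'a poly" where
  "dehom f = poly f 1"

definition homog :: "nat \<Rightarrow> 'a::field poly \<Rightarrow> 'a binpoly" where
  "homog n p = (\<Sum>j\<le>n. monom (monom (coeff p (n - j)) (n - j)) j)"

lemma dehom_add [simp]: "dehom (f + g) = dehom f + dehom g"
  and dehom_diff [simp]: "dehom (f - g) = dehom f - dehom g"
  and dehom_mult [simp]: "dehom (f * g) = dehom f * dehom g"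
  and dehom_power [simp]: "dehom (f ^ k) = dehom f ^ k"
  and dehom_0 [simp]: "dehom 0 = 0"
  and dehom_1 [simp]: "dehom 1 = 1"
  by (simp_all add: dehom_def)

lemma dehom_scale [simp]: "dehom (scale c f) = smult c (dehom f)"
  by (simp add: dehom_def scale_def)

lemma dehom_dvd: "f dvd g \<Longrightarrow> dehom f dvd dehom g"
  by (auto elim!: dvdE)

lemma scale_conv_mult: "scale c f = [:[:c:]:] * f"
  by (simp add: scale_def)

lemma scale_simps [simp]:
  "scale 1 f = f" "scale 0 f = 0" "scale c 0 = 0" "scale c (scale d f) = scale (c * d) f"
  by (simp_all add: scale_def mult.commute flip: one_pCons)

lemma scale_mult_left: "scale c f * g = scale c (f * g)"
  and scale_mult_right: "f * scale c g = scale c (f * g)"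
  and scale_add: "scale c (f + g) = scale c f + scale c g"
  and scale_power: "scale c f ^ k = scale (c ^ k) (f ^ k)"
  by (simp_all add: scale_def smult_add_right smult_power poly_const_pow)

lemma scale_eq_0_iff [simp]: "scale c f = 0 \<longleftrightarrow> c = 0 \<or> f = 0"
  by (simp add: scale_def)

lemma scale_dvd: "f dvd g \<Longrightarrow> f dvd scale c g"
  unfolding scale_conv_mult by (rule dvd_mult)

lemma scale_dvd_iff [simp]: "c \<noteq> 0 \<Longrightarrow> scale c f dvd g \<longleftrightarrow> f dvd g"
proof
  assume c: "c \<noteq> 0" and "f dvd g"
  then obtain h where "g = f * h" by (auto elim: dvdE)
  then have "g = scale c f * scale (1 / c) h" using c by (simp add: scale_mult_left scale_mult_right)
  then show "scale c f dvd g" by simp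
next
  assume "scale c f dvd g"
  then show "f dvd g" unfolding scale_conv_mult by (rule dvd_mult_right)
qed

lemma dvd_scale_iff [simp]: "c \<noteq> 0 \<Longrightarrow> f dvd scale c g \<longleftrightarrow> f dvd g"
  using scale_dvd[of f g c] scale_dvd[of f "scale c g" "1 / c"] by auto

lemma coeff_scale: "coeff (coeff (scale c f) j) i = c * coeff (coeff f j) i"
  by (simp add: scale_def)

lemma formsD: "f \<in> forms n \<Longrightarrow> i + j \<noteq> n \<Longrightarrow> coeff (coeff f j) i = 0"
  by (auto simp: forms_def)

lemma forms_0 [simp]: "0 \<in> forms n"
  and forms_add [intro]: "f \<in> forms n \<Longrightarrow> g \<in> forms n \<Longrightarrow> f + g \<in> forms n"
  and forms_diff [intro]: "f \<in> forms n \<Longrightarrow> g \<in> forms n \<Longrightarrow> f - g \<in> forms n"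
  and forms_scale [intro]: "f \<in> forms n \<Longrightarrow> scale c f \<in> forms n"
  by (force simp: forms_def coeff_scale)+

lemma forms_scale_iff [simp]: "c \<noteq> 0 \<Longrightarrow> scale c f \<in> forms n \<longleftrightarrow> f \<in> forms n"
  by (auto simp: forms_def coeff_scale)

lemma forms_mult [intro]:
  assumes "f \<in> forms m" "g \<in> forms n"
  shows "f * g \<in> forms (m + n)"
  unfolding forms_def
proof (intro CollectI allI impI)
  fix i j
  assume nz: "coeff (coeff (f * g) j) i \<noteq> 0"
  have "coeff (coeff (f * g) j) i =
      (\<Sum>a\<le>j. \<Sum>b\<le>i. coeff (coeff f a) b * coeff (coeff g (j - a)) (i - b))"
    by (simp add: coeff_mult coeff_sum)
  with nz obtain a b where ab: "a \<le> j" "b \<le> i" "coeff (coeff f a) b * coeff (coeff g (j - a)) (i - b) \<noteq> 0"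
    by (metis (no_types, lifting) atMost_iff sum.neutral)
  then have "b + a = m" "(i - b) + (j - a) = n"
    using formsD[OF assms(1)] formsD[OF assms(2)] by (metis mult_zero_left, metis mult_zero_right)
  with ab show "i + j = m + n" by linarith
qed

lemma forms_mult': "f \<in> forms m \<Longrightarrow> g \<in> forms n \<Longrightarrow> k = m + n \<Longrightarrow> f * g \<in> forms k"
  by blast

lemma forms_1 [simp]: "1 \<in> forms 0"
  by (auto simp: forms_def one_pCons coeff_pCons split: nat.splits)

lemma forms_power: "f \<in> forms m \<Longrightarrow> k = n * m \<Longrightarrow> f ^ n \<in> forms k"
  by (induction n arbitrary: k) (auto intro: forms_mult')

lemma X_forms [simp]: "X \<in> forms 1" and Y_forms [simp]: "Y \<in> forms 1"
  by (auto simp: forms_def X_def Y_def one_pCons coeff_pCons split: nat.splits if_splits)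

lemma dehom_X [simp]: "dehom X = [:0, 1:]" and dehom_Y [simp]: "dehom Y = 1"
  by (simp_all add: dehom_def X_def Y_def)

lemma coeff_dehom:
  assumes "f \<in> forms n"
  shows "coeff (dehom f) i = (if i \<le> n then coeff (coeff f (n - i)) i else 0)"
proof -
  have "coeff (dehom f) i = (\<Sum>j\<le>degree f. coeff (coeff f j) i)"
    by (simp add: dehom_def poly_altdef coeff_sum)
  also have "\<dots> = (\<Sum>j\<le>degree f. if j = n - i \<and> i \<le> n then coeff (coeff f j) i else 0)"
    by (intro sum.cong) (use formsD[OF assms] in auto)
  also have "\<dots> = (if i \<le> n then coeff (coeff f (n - i)) i else 0)"
    by (auto simp: coeff_eq_0 not_le)
  finally show ?thesis .
qed

lemma degree_dehom_le: "f \<in> forms n \<Longrightarrow> degree (dehom f) \<le> n"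
  by (rule degree_le) (auto simp: coeff_dehom)

lemma coeff_homog: "coeff (coeff (homog n p) j) i = (if i + j = n then coeff p i else 0)"
proof -
  have "coeff (coeff (homog n p) j) i = (\<Sum>k\<le>n. if k = j then coeff (monom (coeff p (n - j)) (n - j)) i else 0)"
    unfolding homog_def coeff_sum by (intro sum.cong) auto
  also have "\<dots> = (if i + j = n then coeff p i else 0)"
    by (auto simp: coeff_monom)
  finally show ?thesis .
qed

lemma homog_forms [simp, intro]: "homog n p \<in> forms n"
  by (auto simp: forms_def coeff_homog split: if_splits)

lemma dehom_homog [simp]: "degree p \<le> n \<Longrightarrow> dehom (homog n p) = p"
  by (rule poly_eqI) (auto simp: coeff_dehom[OF homog_forms] coeff_homog coeff_eq_0)

lemma homog_dehom: "f \<in> forms n \<Longrightarrow> homog n (dehom f) = f"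
  by (rule poly_eqI, rule poly_eqI) (auto simp: coeff_homog coeff_dehom formsD)

lemma dehom_inj: "f \<in> forms n \<Longrightarrow> g \<in> forms n \<Longrightarrow> dehom f = dehom g \<Longrightarrow> f = g"
  by (metis homog_dehom)

lemma dehom_eq_0_iff: "f \<in> forms n \<Longrightarrow> dehom f = 0 \<longleftrightarrow> f = 0"
  using dehom_inj[of f n 0] by auto

lemma bij_betw_dehom: "bij_betw dehom (forms n) {p. degree p \<le> n}"
  by (rule bij_betw_byWitness[where f' = "homog n"]) (auto simp: homog_dehom degree_dehom_le)

lemma forms_degree_unique: "f \<in> forms m \<Longrightarrow> f \<in> forms n \<Longrightarrow> f \<noteq> 0 \<Longrightarrow> m = n"
  by (auto simp: forms_def) (metis poly_eqI coeff_0)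

lemma forms_0_cases: "f \<in> forms 0 \<longleftrightarrow> (\<exists>c. f = [:[:c:]:])"
proof
  assume f: "f \<in> forms 0"
  have "dehom f = dehom [:[:coeff (dehom f) 0:]:]"
    using degree_dehom_le[OF f] by (auto simp: dehom_def elim: degree_eq_zeroE)
  moreover have "[:[:coeff (dehom f) 0:]:] \<in> forms 0"
    by (auto simp: forms_def coeff_pCons split: nat.splits)
  ultimately show "\<exists>c. f = [:[:c:]:]" using f dehom_inj by blast
qed (auto simp: forms_def coeff_pCons split: nat.splits)

section \<open>Factors of forms\<close>

text \<open>
  The ring homomorphism \<open>gradey\<close> maps \<open>f(x, y)\<close> to \<open>f(x y, y)\<close>, and \<open>liftx\<close> is its restriction to
  polynomials in \<open>x\<close>. A polynomial is a form of degree \<open>n\<close> exactly when its image is a monomial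
  \<open>p(x) y ^ n\<close> in \<open>y\<close>. Since the factors of a monomial over a domain are monomials, the factors of
  a nonzero form are forms.
\<close>

definition liftx :: "'a::field poly \<Rightarrow> 'a binpoly" where
  "liftx p = pcompose (map_poly (\<lambda>c. [:c:]) p) [:0, [:0, 1:]:]"

definition gradey :: "'a::field binpoly \<Rightarrow> 'a binpoly" where
  "gradey f = fold_coeffs (\<lambda>a r. liftx a + pCons 0 r) f 0"

lemma liftx_0 [simp]: "liftx 0 = 0" by (simp add: liftx_def)

lemma liftx_add: "liftx (p + q) = liftx p + liftx q"
proof -
  have "map_poly (\<lambda>c. [:c:]) (p + q) = map_poly (\<lambda>c. [:c:]) p + map_poly (\<lambda>c. [:c::'a:]) q"
    by (rule poly_eqI) (simp add: coeff_map_poly)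
  then show ?thesis by (simp add: liftx_def pcompose_add)
qed

lemma liftx_pCons: "liftx (pCons a p) = [:[:a:]:] + [:0, [:0, 1:]:] * liftx p"
  by (simp add: liftx_def map_poly_pCons pcompose_pCons)

lemma liftx_smult: "liftx (smult c p) = [:[:c:]:] * liftx p"
  by (induction p) (simp_all add: liftx_pCons algebra_simps smult_add_right)

lemma liftx_mult: "liftx (p * q) = liftx p * liftx q"
proof (induction p)
  case (pCons a p)
  have "liftx (pCons a p * q) = [:[:a:]:] * liftx q + [:0, [:0, 1:]:] * liftx (p * q)"
    using liftx_pCons[of 0 "p * q"] by (simp add: liftx_add liftx_smult)
  then show ?case by (simp only: pCons.IH liftx_pCons distrib_right mult.assoc)
qed simp

lemma gradey_0 [simp]: "gradey 0 = 0" by (simp add: gradey_def)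

lemma gradey_pCons: "gradey (pCons a f) = liftx a + pCons 0 (gradey f)"
  by (cases "a = 0 \<and> f = 0") (auto simp: gradey_def)

lemma gradey_add: "gradey (f + g) = gradey f + gradey g"
proof (induction f arbitrary: g)
  case (pCons a f)
  show ?case by (cases g) (simp add: gradey_pCons pCons.IH liftx_add)
qed simp

lemma gradey_smult: "gradey (smult a f) = liftx a * gradey f"
  by (induction f) (simp_all add: gradey_pCons liftx_mult distrib_left)

lemma gradey_mult: "gradey (f * g) = gradey f * gradey g"
  by (induction f) (simp_all add: gradey_pCons gradey_add gradey_smult distrib_right)

lemma coeff_liftx: "coeff (liftx p) k = monom (coeff p k) k"
proof (induction p arbitrary: k)
  case (pCons a p)
  show ?case by (cases k) (simp_all add: liftx_pCons pCons.IH monom_0 monom_Suc)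
qed simp

lemma coeff_gradey: "coeff (coeff (gradey f) k) i = (if i \<le> k then coeff (coeff f (k - i)) i else 0)"
proof (induction f arbitrary: k)
  case (pCons a f)
  show ?case
    by (cases k) (auto simp: gradey_pCons pCons.IH coeff_liftx coeff_pCons Suc_diff_le le_Suc_eq
        split: nat.splits)
qed simp

lemma gradey_form: "f \<in> forms n \<Longrightarrow> gradey f = monom (dehom f) n"
  by (rule poly_eqI, rule poly_eqI) (auto simp: coeff_gradey coeff_dehom formsD)

lemma form_if_gradey_monom: "gradey f = monom p n \<Longrightarrow> f \<in> forms n"
proof -
  assume g: "gradey f = monom p n"
  have "i + j = n" if "coeff (coeff f j) i \<noteq> 0" for i j
  proof -
    have "coeff (coeff (gradey f) (i + j)) i \<noteq> 0" using that by (simp add: coeff_gradey)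
    then show ?thesis unfolding g by (auto simp: coeff_monom split: if_splits)
  qed
  then show ?thesis by (auto simp: forms_def)
qed

lemma monom_factor:
  fixes u v :: "'b::idom poly"
  assumes "u * v = monom c n" "c \<noteq> 0"
  shows "\<exists>a i. u = monom a i"
  using assms
proof (induction n arbitrary: u v)
  case 0
  then have "degree (u * v) = 0" "u \<noteq> 0" "v \<noteq> 0" by (auto simp: monom_0)
  then have "degree u = 0" by (simp add: degree_mult_eq)
  then show ?case by (metis degree_eq_zeroE monom_0)
next
  case (Suc n)
  obtain a u' b v' where u: "u = pCons a u'" and v: "v = pCons b v'" by (metis pCons_cases)
  have "coeff (u * v) 0 = 0" using Suc.prems by (simp add: coeff_monom)
  then have "a = 0 \<or> b = 0" by (auto simp: u v coeff_mult)
  then show ?case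
  proof
    assume "a = 0"
    then have "u' * v = monom c n" using Suc.prems(1) by (simp add: u monom_Suc)
    then obtain d i where "u' = monom d i" using Suc by blast
    then show ?thesis using \<open>a = 0\<close> u by (metis monom_Suc)
  next
    assume "b = 0"
    then have "u * v' = monom c n" using Suc.prems(1) by (simp add: v monom_Suc)
    then show ?thesis using Suc by blast
  qed
qed

lemma form_factor:
  assumes "u * v \<in> forms n" "u * v \<noteq> 0"
  obtains i j where "u \<in> forms i" "v \<in> forms j" "i + j = n"
proof -
  have eq: "gradey u * gradey v = monom (dehom (u * v)) n"
    using gradey_form[OF assms(1)] by (simp only: gradey_mult)
  have nz: "dehom (u * v) \<noteq> 0" using assms dehom_eq_0_iff by blast
  obtain a i where "gradey u = monom a i" using monom_factor[OF eq nz] by blast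
  moreover obtain b j where "gradey v = monom b j"
    using monom_factor[OF eq[unfolded mult.commute[of "gradey u"]] nz] by blast
  ultimately have *: "u \<in> forms i" "v \<in> forms j" by (auto intro: form_if_gradey_monom)
  then have "u * v \<in> forms (i + j)" by blast
  then have "i + j = n" using assms forms_degree_unique by blast
  with * show ?thesis using that by blast
qed

lemma form_cofactor:
  assumes "u * v \<in> forms n" "u \<in> forms m" "u \<noteq> 0" "m \<le> n"
  shows "v \<in> forms (n - m)"
proof (cases "v = 0")
  case False
  then have "u * v \<noteq> 0" using assms by auto
  then obtain i j where "u \<in> forms i" "v \<in> forms j" "i + j = n" using form_factor assms by metis
  then show ?thesis using forms_degree_unique[of u i m] assms by auto
qed simp

lemma form_dvdE:
  assumes "u dvd f" "f \<in> forms n" "u \<in> forms m" "u \<noteq> 0" "m \<le> n"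
  obtains v where "f = u * v" "v \<in> forms (n - m)"
  using assms form_cofactor by (metis dvdE)

lemma unit_form_iff: "f dvd 1 \<longleftrightarrow> f \<in> forms 0 \<and> f \<noteq> (0 :: 'a::field binpoly)"
proof
  assume f: "f dvd 1"
  then obtain g where g: "f * g = 1" by (metis dvdE)
  then obtain i j where "f \<in> forms i" "i + j = 0"
    using form_factor[of f g 0] by (metis forms_1 one_neq_zero)
  then show "f \<in> forms 0 \<and> f \<noteq> 0" using g by auto
next
  assume "f \<in> forms 0 \<and> f \<noteq> 0"
  then obtain c where "f = [:[:c:]:]" "c \<noteq> 0" using forms_0_cases by fastforce
  then have "f * [:[:1 / c:]:] = 1" by (simp add: one_pCons)
  then show "f dvd 1" by (metis dvd_triv_left)
qed

section \<open>Linear and quadratic forms\<close>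

lemma XY_forms_Suc_0 [simp]: "X \<in> forms (Suc 0)" "Y \<in> forms (Suc 0)"
  using X_forms Y_forms by simp_all

lemma forms_1_cases:
  assumes "l \<in> forms 1"
  obtains a b where "l = scale a X + scale b Y"
proof -
  have "dehom l = dehom (scale (coeff (dehom l) 1) X + scale (coeff (dehom l) 0) Y)"
    by (rule poly_eqI) (auto simp: coeff_pCons coeff_dehom[OF assms] split: nat.splits)
  then have "l = scale (coeff (dehom l) 1) X + scale (coeff (dehom l) 0) Y"
    by (intro dehom_inj[OF assms] forms_add forms_scale X_forms Y_forms)
  with that show ?thesis by blast
qed

lemma forms_Suc_cases:
  assumes "f \<in> forms (Suc n)"
  obtains g h where "g \<in> forms n" "h \<in> forms n" "f = X * g + Y * h"
proof -
  obtain c p where p: "dehom f = pCons c p" by (metis pCons_cases)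
  have dp: "degree p \<le> n" using degree_dehom_le[OF assms] unfolding p by (auto split: if_splits)
  have "dehom f = dehom (X * homog n p + Y * homog n [:c:])" using dp by (simp add: p)
  moreover have "X * homog n p + Y * homog n [:c:] \<in> forms (Suc n)"
    by (intro forms_add forms_mult'[of _ 1 _ n]) auto
  ultimately have "f = X * homog n p + Y * homog n [:c:]" using assms dehom_inj by blast
  with that show ?thesis by blast
qed

lemma linear_span:
  assumes l: "l \<in> forms 1" "l \<noteq> 0" and m: "m \<in> forms 1" "\<not> l dvd m" and k: "k \<in> forms 1"
  obtains a b where "k = scale a l + scale b m"
proof -
  obtain \<alpha> \<beta> where l': "l = scale \<alpha> X + scale \<beta> Y" using forms_1_cases l(1) by blast
  obtain \<gamma> \<delta> where m': "m = scale \<gamma> X + scale \<delta> Y" using forms_1_cases m(1) by blast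
  obtain x y where k': "k = scale x X + scale y Y" using forms_1_cases k by blast
  have det: "\<alpha> * \<delta> - \<beta> * \<gamma> \<noteq> 0"
  proof
    assume 0: "\<alpha> * \<delta> - \<beta> * \<gamma> = 0"
    have "\<exists>c. m = scale c l"
    proof (cases "\<alpha> = 0")
      case False
      have "\<alpha> * \<delta> = \<gamma> * \<beta>" using 0 by (simp add: mult.commute)
      then have "\<delta> = \<gamma> / \<alpha> * \<beta>" using False by (metis nonzero_mult_div_cancel_left times_divide_eq_left)
      then have "m = scale (\<gamma> / \<alpha>) l" using False by (simp add: l' m' scale_add)
      then show ?thesis ..
    next
      case True
      then have "\<beta> \<noteq> 0" using l l' by auto
      then have "m = scale (\<delta> / \<beta>) l" using 0 True by (simp add: l' m' scale_add)
      then show ?thesis ..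
    qed
    then show False using m(2) by (auto simp: scale_dvd)
  qed
  define d where "d = \<alpha> * \<delta> - \<beta> * \<gamma>"
  have sa: "scale u f + scale v f = scale (u + v) f" for u v and f :: "'a binpoly"
    using smult_add_left[of "[:u:]" "[:v:]" f] by (simp add: scale_def)
  have d: "d \<noteq> 0" using det by (simp add: d_def)
  \<comment> \<open>The coefficients below come from Cramer's rule.\<close>
  define a b where "a = (x * \<delta> - y * \<gamma>) / d" "b = (\<alpha> * y - \<beta> * x) / d"
  then have ab: "a * d = x * \<delta> - y * \<gamma>" "b * d = \<alpha> * y - \<beta> * x" using d by simp_all
  have "(a * \<alpha> + b * \<gamma>) * d = (a * d) * \<alpha> + (b * d) * \<gamma>"
    and "(a * \<beta> + b * \<delta>) * d = (a * d) * \<beta> + (b * d) * \<delta>"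
    by (simp_all add: algebra_simps)
  then have "(a * \<alpha> + b * \<gamma>) * d = x * d" "(a * \<beta> + b * \<delta>) * d = y * d"
    unfolding ab by (simp_all add: d_def algebra_simps)
  then have 1: "a * \<alpha> + b * \<gamma> = x" and 2: "a * \<beta> + b * \<delta> = y" using d by simp_all
  have "scale a l + scale b m = (scale (a * \<alpha>) X + scale (a * \<beta>) Y) + (scale (b * \<gamma>) X + scale (b * \<delta>) Y)"
    by (simp add: l' m' scale_add)
  also have "\<dots> = (scale (a * \<alpha>) X + scale (b * \<gamma>) X) + (scale (a * \<beta>) Y + scale (b * \<delta>) Y)"
    by (simp only: add.assoc add.left_commute add.commute)
  also have "\<dots> = scale (a * \<alpha> + b * \<gamma>) X + scale (a * \<beta> + b * \<delta>) Y"
    by (simp only: sa)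
  finally have "scale a l + scale b m = scale (a * \<alpha> + b * \<gamma>) X + scale (a * \<beta> + b * \<delta>) Y" .
  then have "k = scale a l + scale b m" by (simp add: 1 2 k')
  with that show ?thesis by blast
qed

text \<open>
  Modulo \<open>l\<close>, every form of positive degree is a scalar multiple of a power of \<open>m\<close>.
\<close>

lemma forms_decomp:
  assumes l: "l \<in> forms 1" "l \<noteq> 0" and m: "m \<in> forms 1" "\<not> l dvd m"
  shows "f \<in> forms (Suc n) \<Longrightarrow> \<exists>g c. g \<in> forms n \<and> f = l * g + scale c (m ^ Suc n)"
proof (induction n arbitrary: f)
  case 0
  then obtain a b where "f = scale a l + scale b m" using linear_span[OF l m] by auto
  then have "f = l * scale a 1 + scale b (m ^ Suc 0)" by (simp add: scale_mult_right)
  moreover have "scale a 1 \<in> forms 0" by auto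
  ultimately show ?case by blast
next
  case (Suc n)
  obtain g h where gh: "g \<in> forms (Suc n)" "h \<in> forms (Suc n)" "f = X * g + Y * h"
    using forms_Suc_cases Suc.prems by blast
  obtain a b where x: "X = scale a l + scale b m" using linear_span[OF l m X_forms] by blast
  obtain a' b' where y: "Y = scale a' l + scale b' m" using linear_span[OF l m Y_forms] by blast
  have "scale b g + scale b' h \<in> forms (Suc n)" using gh by blast
  then obtain k c where k: "k \<in> forms n" "scale b g + scale b' h = l * k + scale c (m ^ Suc n)"
    using Suc.IH by blast
  have "f = l * (scale a g + scale a' h) + m * (scale b g + scale b' h)"
    by (simp add: gh x y distrib_left distrib_right scale_mult_left scale_mult_right)
  also have "\<dots> = l * (scale a g + scale a' h + m * k) + scale c (m ^ Suc (Suc n))"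
    unfolding k by (simp add: distrib_left distrib_right scale_mult_left scale_mult_right)
  finally have "f = l * (scale a g + scale a' h + m * k) + scale c (m ^ Suc (Suc n))" .
  moreover have "scale a g + scale a' h + m * k \<in> forms (Suc n)"
    using gh k m by (intro forms_add forms_scale forms_mult'[of m 1 k n]) auto
  ultimately show ?case by blast
qed

text \<open>
  Divisibility by a linear form is vanishing at its zero \<open>(u, v)\<close> on the projective line. As evaluation is
  multiplicative, linear forms are prime.
\<close>

lemma linear_dvd_iff_zero:
  assumes l: "l \<in> forms 1" "l \<noteq> 0"
  obtains u v where "\<And>n f. f \<in> forms n \<Longrightarrow> l dvd f \<longleftrightarrow> poly (poly f [:v:]) u = 0"
proof -
  obtain \<alpha> \<beta> where l': "l = scale \<alpha> X + scale \<beta> Y" using forms_1_cases l(1) by blast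
  define ev where "ev f = poly (poly f [:-\<alpha>:]) \<beta>" for f
  have ev_simps: "ev (f + g) = ev f + ev g" "ev (f * g) = ev f * ev g" "ev (scale c f) = c * ev f"
    "ev (f ^ k) = ev f ^ k" "ev X = \<beta>" "ev Y = - \<alpha>" for f g c k
    by (simp_all add: ev_def scale_def X_def Y_def)
  have evl: "ev l = 0" by (simp add: l' ev_simps)
  then have dvd0: "ev f = 0" if "l dvd f" for f using that by (auto simp: ev_simps elim!: dvdE)
  define m where "m = (if \<alpha> = 0 then X else Y :: 'a binpoly)"
  have "ev m \<noteq> 0" using l by (auto simp: m_def ev_simps l')
  then have m: "m \<in> forms 1" "\<not> l dvd m" using dvd0 by (auto simp: m_def)
  have "l dvd f" if f: "f \<in> forms n" and 0: "ev f = 0" for f n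
  proof (cases n)
    case 0
    then obtain c where "f = [:[:c:]:]" using f forms_0_cases by blast
    then show ?thesis using \<open>ev f = 0\<close> by (simp add: ev_def)
  next
    case (Suc k)
    then have "f \<in> forms (Suc k)" using f by simp
    then obtain g c where "f = l * g + scale c (m ^ Suc k)" using forms_decomp[OF l m] by blast
    moreover have "c = 0" using 0 \<open>ev m \<noteq> 0\<close> by (simp add: calculation ev_simps evl)
    ultimately show ?thesis by simp
  qed
  then have "\<And>n f. f \<in> forms n \<Longrightarrow> l dvd f \<longleftrightarrow> poly (poly f [:-\<alpha>:]) \<beta> = 0"
    using dvd0 unfolding ev_def by auto
  then show ?thesis by (rule that)
qed

lemma linear_prime:
  assumes "l \<in> forms 1" "l \<noteq> 0" "f \<in> forms a" "g \<in> forms b" "l dvd f * g"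
  shows "l dvd f \<or> l dvd g"
proof -
  obtain u v where *: "\<And>n f. f \<in> forms n \<Longrightarrow> l dvd f \<longleftrightarrow> poly (poly f [:v:]) u = 0"
    using linear_dvd_iff_zero[OF assms(1,2)] by metis
  show ?thesis using assms(5) *[OF assms(3)] *[OF assms(4)] *[OF forms_mult[OF assms(3,4)]] by simp
qed

lemma linear_prime_power:
  assumes "l \<in> forms 1" "l \<noteq> 0" "f \<in> forms a" "l dvd f ^ n"
  shows "l dvd f"
  using assms(4)
proof (induction n)
  case 0
  then have "l \<in> forms 0" by (simp add: unit_form_iff)
  then show ?case using forms_degree_unique[OF assms(1) _ assms(2), of 0] by simp
next
  case (Suc n)
  have "f ^ n \<in> forms (n * a)" using assms(3) by (simp add: forms_power)
  then show ?case using linear_prime[OF assms(1,2,3), of "f ^ n" "n * a"] Suc by auto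
qed

lemma linear_dvd_linear:
  assumes "l \<in> forms 1" "m \<in> forms 1" "l \<noteq> 0" "l dvd m"
  obtains c where "m = scale c l"
proof -
  obtain v where v: "m = l * v" "v \<in> forms 0" using form_dvdE[OF assms(4,2,1,3)] by auto
  then obtain c where "v = [:[:c:]:]" using forms_0_cases by blast
  with v that show ?thesis by (metis mult.commute scale_conv_mult)
qed

lemma proportional_iff_dvd:
  assumes "l \<in> forms 1" "m \<in> forms 1" "l \<noteq> 0" "m \<noteq> 0"
  shows "proportional l m \<longleftrightarrow> l dvd m"
proof
  show "proportional l m \<Longrightarrow> l dvd m" by (auto simp: proportional_def scale_dvd)
  assume "l dvd m"
  then obtain c where c: "m = scale c l" using linear_dvd_linear[OF assms(1-3)] by blast
  then have "c \<noteq> 0" using assms(4) by auto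
  with c show "proportional l m" unfolding proportional_def by blast
qed

lemma dvd_same_degree_scale:
  assumes "r \<in> forms n" "s \<in> forms n" "r \<noteq> 0" "r dvd s"
  obtains c where "s = scale c r"
proof -
  obtain v where v: "s = r * v" "v \<in> forms 0" using form_dvdE[OF assms(4,2,1,3)] by auto
  then obtain c where "v = [:[:c:]:]" using forms_0_cases by blast
  with v that show ?thesis by (metis mult.commute scale_conv_mult)
qed

lemma irreducible_formI:
  assumes f: "f \<in> forms n" "f \<noteq> 0" "n > 0"
    and *: "\<And>u v i j. u \<in> forms i \<Longrightarrow> v \<in> forms j \<Longrightarrow> f = u * v \<Longrightarrow> i + j = n \<Longrightarrow> i = 0 \<or> j = 0"
  shows "irreducible f"
proof (rule irreducibleI)
  show "f \<noteq> 0" by fact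
  show "\<not> f dvd 1" using forms_degree_unique[OF f(1) _ f(2), of 0] f(3) by (auto simp: unit_form_iff)
  fix u v assume uv: "f = u * v"
  then obtain i j where ij: "u \<in> forms i" "v \<in> forms j" "i + j = n"
    using form_factor[of u v n] f by auto
  have "u \<noteq> 0" "v \<noteq> 0" using f(2) uv by auto
  with *[OF ij(1,2) uv ij(3)] ij show "u dvd 1 \<or> v dvd 1" by (auto simp: unit_form_iff)
qed

lemma linear_irreducible: "l \<in> forms 1 \<Longrightarrow> l \<noteq> 0 \<Longrightarrow> irreducible l"
  by (rule irreducible_formI[of _ 1]) auto

lemma irreducible_no_factor:
  assumes "irreducible f" "f \<in> forms n" "l \<in> forms i" "l dvd f" "0 < i" "i < n"
  shows False
proof -
  have nz: "f \<noteq> 0" using assms(1) by (auto simp: irreducible_def)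
  then have "l \<noteq> 0" using assms(4) by auto
  then obtain v where v: "f = l * v" "v \<in> forms (n - i)"
    using form_dvdE[OF assms(4,2,3)] assms(6) by auto
  then have "v \<noteq> 0" using nz by auto
  from v(1) have "l dvd 1 \<or> v dvd 1" using assms(1) irreducibleD by blast
  then have "l \<in> forms 0 \<or> v \<in> forms 0" by (auto simp: unit_form_iff)
  then have "i = 0 \<or> n - i = 0"
    using forms_degree_unique[OF assms(3), of 0] forms_degree_unique[OF v(2), of 0] \<open>l \<noteq> 0\<close> \<open>v \<noteq> 0\<close> by auto
  then show False using assms(5,6) by auto
qed

lemma quadratic_cases:
  assumes "r \<in> forms 2" "r \<noteq> 0"
  shows "split_form r \<or> ramified_form r \<or> irreducible r"
proof (cases "irreducible r")
  case False
  then obtain u v i j where uv: "u \<in> forms i" "v \<in> forms j" "r = u * v" "i + j = 2" "i \<noteq> 0" "j \<noteq> 0"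
    using irreducible_formI[OF assms] by (metis pos2)
  then have "i = 1" "j = 1" by auto
  with uv have uv: "u \<in> forms 1 - {0}" "v \<in> forms 1 - {0}" "r = u * v" using assms by auto
  show ?thesis
  proof (cases "proportional u v")
    case True
    then obtain c where "c \<noteq> 0" "v = scale c u" unfolding proportional_def by auto
    then have "r = scale c (u ^ 2)" using uv by (simp add: scale_mult_right power2_eq_square)
    then have "ramified_form r" using \<open>c \<noteq> 0\<close> uv unfolding ramified_form_def by blast
    then show ?thesis by blast
  next
    case False
    then show ?thesis unfolding split_form_def using uv by blast
  qed
qed blast

lemma proportional_sym: "proportional f g \<Longrightarrow> proportional g f"
  unfolding proportional_def by (metis divide_self_if divide_eq_0_iff one_neq_zero scale_simps(1,4)
      times_divide_eq_left mult_1)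

lemma split_not_irreducible:
  assumes "split_form r"
  shows "\<not> irreducible r"
proof
  assume irr: "irreducible r"
  obtain l1 l2 where l: "l1 \<in> forms 1 - {0}" "l2 \<in> forms 1 - {0}" "r = l1 * l2"
    using assms unfolding split_form_def by blast
  moreover from l have "r \<in> forms 2" by (auto intro: forms_mult' simp: numeral_2_eq_2)
  ultimately show False using irreducible_no_factor[OF irr, of 2 l1 1] by auto
qed

lemma ramified_not_irreducible:
  assumes "ramified_form r"
  shows "\<not> irreducible r"
proof
  assume irr: "irreducible r"
  obtain l c where l: "l \<in> forms 1 - {0}" "r = scale c (l ^ 2)"
    using assms unfolding ramified_form_def by blast
  moreover from l have "r \<in> forms 2" using forms_power[of l 1 2 2] by auto
  moreover have "l dvd r" by (simp add: l scale_dvd)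
  ultimately show False using irreducible_no_factor[OF irr, of 2 l 1] by auto
qed

lemma ramified_not_split:
  assumes "ramified_form r"
  shows "\<not> split_form r"
proof
  assume "split_form r"
  then obtain l1 l2 where l: "l1 \<in> forms 1 - {0}" "l2 \<in> forms 1 - {0}" "r = l1 * l2" "\<not> proportional l1 l2"
    unfolding split_form_def by blast
  obtain m c where m: "m \<in> forms 1 - {0}" "r = scale c (m ^ 2)" "c \<noteq> 0"
    using assms unfolding ramified_form_def by blast
  have "l1 dvd m ^ 2" "l2 dvd m ^ 2"
    using m l by (metis dvd_scale_iff dvd_triv_left, metis dvd_scale_iff dvd_triv_right)
  then have "l1 dvd m" "l2 dvd m" using linear_prime_power[of _ m 1 2] l m by auto
  then have "proportional l1 m" "proportional l2 m" using proportional_iff_dvd l m by auto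
  then have "proportional l1 l2"
    using proportional_sym[of l2 m] unfolding proportional_def by (metis mult_eq_0_iff scale_simps(4))
  with l show False by simp
qed

lemma split_form_scale: "c \<noteq> 0 \<Longrightarrow> split_form r \<Longrightarrow> split_form (scale c r)"
proof -
  assume c: "c \<noteq> 0" and "split_form r"
  then obtain l1 l2 where l: "l1 \<in> forms 1 - {0}" "l2 \<in> forms 1 - {0}" "r = l1 * l2" "\<not> proportional l1 l2"
    unfolding split_form_def by blast
  have "\<not> proportional l1 (scale c l2)"
  proof
    assume "proportional l1 (scale c l2)"
    then obtain d where "d \<noteq> 0" "scale c l2 = scale d l1" unfolding proportional_def by blast
    then have "l2 = scale (d / c) l1" using c
      by (metis divide_self_if scale_simps(1,4) times_divide_eq_left mult_1)
    moreover have "d / c \<noteq> 0" using c \<open>d \<noteq> 0\<close> by simp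
    ultimately show False using l(4) unfolding proportional_def by blast
  qed
  then show ?thesis unfolding split_form_def using l c
    by (intro bexI[of _ l1] bexI[of _ "scale c l2"]) (auto simp: scale_mult_right)
qed

lemma ramified_form_scale: "c \<noteq> 0 \<Longrightarrow> ramified_form r \<Longrightarrow> ramified_form (scale c r)"
  unfolding ramified_form_def by (metis no_zero_divisors scale_simps(4))

lemma irreducible_scale: "c \<noteq> 0 \<Longrightarrow> irreducible r \<Longrightarrow> irreducible (scale c r)"
proof -
  assume "c \<noteq> 0" "irreducible r"
  moreover have "[:[:c:]:] dvd (1 :: 'a binpoly)"
    using \<open>c \<noteq> 0\<close> forms_0_cases[of "[:[:c:]:]"] by (auto simp: unit_form_iff)
  ultimately show ?thesis unfolding scale_conv_mult using irreducible_mult_unit_left by blast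
qed

section \<open>Classes of proportional forms\<close>

text \<open>
  The class of a nonzero form of degree \<open>n\<close> up to nonzero scalars, as an element of \<open>proj_forms n\<close>.
\<close>

definition cls :: "nat \<Rightarrow> 'a::field binpoly \<Rightarrow> 'a binpoly set" where
  "cls n f = {(f, g). f \<in> forms n - {0} \<and> g \<in> forms n - {0} \<and> proportional f g} `` {f}"

lemma mem_cls: "g \<in> cls n f \<longleftrightarrow> f \<in> forms n \<and> f \<noteq> 0 \<and> (\<exists>c. c \<noteq> 0 \<and> g = scale c f)"
  by (auto simp: cls_def proportional_def)

lemma eps_split: "r \<in> forms 2 \<Longrightarrow> split_form r \<Longrightarrow> eps (cls 2 r) = 1"
proof -
  assume r: "r \<in> forms 2" "split_form r"
  then have "r \<noteq> 0" unfolding split_form_def by auto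
  then have "r \<in> cls 2 r" using r by (auto simp: mem_cls intro!: exI[of _ 1])
  then show ?thesis using r unfolding eps_def by auto
qed

lemma eps_ramified: "r \<in> forms 2 \<Longrightarrow> ramified_form r \<Longrightarrow> eps (cls 2 r) = 0"
proof -
  assume r: "r \<in> forms 2" "ramified_form r"
  then have "r \<noteq> 0" unfolding ramified_form_def by auto
  then have "r \<in> cls 2 r" using r by (auto simp: mem_cls intro!: exI[of _ 1])
  moreover have "\<not> split_form f" if "f \<in> cls 2 r" for f
    using that r ramified_not_split ramified_form_scale by (auto simp: mem_cls)
  ultimately show ?thesis using r unfolding eps_def by auto
qed

lemma eps_irreducible: "r \<in> forms 2 \<Longrightarrow> irreducible r \<Longrightarrow> eps (cls 2 r) = -1"
proof -
  assume r: "r \<in> forms 2" "irreducible r"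
  then have "r \<noteq> 0" by auto
  then have "r \<in> cls 2 r" using r by (auto simp: mem_cls intro!: exI[of _ 1])
  moreover have "\<not> split_form f" "\<not> ramified_form f" if "f \<in> cls 2 r" for f
    using that r split_not_irreducible ramified_not_irreducible irreducible_scale by (auto simp: mem_cls)
  ultimately show ?thesis using r unfolding eps_def by auto
qed

text \<open>
  The normalized forms of degree \<open>n\<close>: those whose dehomogenization is monic, i.e. whose coefficient
  at the highest occurring power of \<open>x\<close> is \<open>1\<close>. They contain exactly one form from every class
  (lemma \<open>bij_betw_cls\<close>) and are closed under products, so sums over \<open>proj_forms n\<close> are
  computed as sums over \<open>nforms n\<close>.
\<close>

definition nforms :: "nat \<Rightarrow> 'a::field binpoly set" where
  "nforms n = {f \<in> forms n. lead_coeff (dehom f) = 1}"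

lemma nforms_nonzero: "f \<in> nforms n \<Longrightarrow> f \<noteq> 0"
  by (auto simp: nforms_def)

lemma nforms_forms: "f \<in> nforms n \<Longrightarrow> f \<in> forms n"
  by (auto simp: nforms_def)

lemma nforms_mult: "f \<in> nforms m \<Longrightarrow> g \<in> nforms n \<Longrightarrow> f * g \<in> nforms (m + n)"
  by (auto simp: nforms_def lead_coeff_mult)

lemma nforms_exists:
  assumes "f \<in> forms n" "f \<noteq> 0"
  obtains c r where "c \<noteq> 0" "r \<in> nforms n" "f = scale c r"
proof -
  define c where "c = lead_coeff (dehom f)"
  have c: "c \<noteq> 0" using assms dehom_eq_0_iff[of f n] by (simp add: c_def)
  have "scale (1 / c) f \<in> nforms n" using assms c by (auto simp: nforms_def) (simp add: c_def)
  moreover have "f = scale c (scale (1 / c) f)" using c by simp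
  ultimately show ?thesis using that c by blast
qed

lemma nforms_scale_eq:
  assumes "r \<in> nforms n" "s \<in> nforms n" "s = scale c r"
  shows "s = r"
proof -
  have "c = 1" using assms by (auto simp: nforms_def split: if_splits)
  then show ?thesis using assms by simp
qed

lemma nforms_dvd_eq:
  assumes "r \<in> nforms n" "s \<in> nforms n" "r dvd s"
  shows "s = r"
proof -
  obtain c where "s = scale c r"
    using dvd_same_degree_scale[of r n s] assms nforms_forms nforms_nonzero by blast
  then show ?thesis using assms nforms_scale_eq by blast
qed

lemma bij_betw_cls: "bij_betw (cls n) (nforms n) (proj_forms n)"
proof (rule bij_betw_imageI)
  show "inj_on (cls n) (nforms n)"
  proof (rule inj_onI)
    fix r s assume rs: "r \<in> nforms n" "s \<in> nforms n" "cls n r = cls n s"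
    have "s \<in> cls n s" using rs nforms_nonzero nforms_forms by (auto simp: mem_cls intro!: exI[of _ 1])
    then have "s \<in> cls n r" using rs by simp
    then obtain c where "s = scale c r" by (auto simp: mem_cls)
    then show "r = s" using nforms_scale_eq[of r n s c] rs by simp
  qed
  show "cls n ` nforms n = proj_forms n"
  proof
    show "cls n ` nforms n \<subseteq> proj_forms n"
      unfolding proj_forms_def cls_def using nforms_nonzero nforms_forms by (blast intro: quotientI)
    show "proj_forms n \<subseteq> cls n ` nforms n"
    proof
      fix P assume "P \<in> proj_forms n"
      then obtain f where f: "f \<in> forms n" "f \<noteq> 0" "P = cls n f"
        unfolding proj_forms_def cls_def by (auto elim!: quotientE)
      then obtain c r where r: "c \<noteq> 0" "r \<in> nforms n" "f = scale c r" using nforms_exists by blast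
      have "cls n f = cls n r"
      proof (intro Set.set_eqI iffI)
        fix g assume "g \<in> cls n f" then obtain d where "d \<noteq> 0" "g = scale d f" by (auto simp: mem_cls)
        then have "g = scale (d * c) r" "d * c \<noteq> 0" using r by auto
        then show "g \<in> cls n r" using r nforms_forms nforms_nonzero unfolding mem_cls by blast
      next
        fix g assume "g \<in> cls n r"
        then obtain d where "d \<noteq> 0" "g = scale d r" by (auto simp: mem_cls)
        then have "g = scale (d / c) f" "d / c \<noteq> 0" using r by auto
        then show "g \<in> cls n f" using f unfolding mem_cls by blast
      qed
      then show "P \<in> cls n ` nforms n" using f r by blast
    qed
  qed
qed

section \<open>Counting forms\<close>

lemma card_degree_le:
  "finite {p :: 'a::{field,finite} poly. degree p \<le> n} \<and>
   card {p :: 'a::{field,finite} poly. degree p \<le> n} = CARD('a) ^ Suc n"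
proof (induction n)
  case 0
  have "{p :: 'a poly. degree p \<le> 0} = (\<lambda>c. [:c:]) ` UNIV" by (auto elim: degree_eq_zeroE)
  moreover have "inj (\<lambda>c::'a. [:c:])" by (auto intro: injI)
  ultimately show ?case by (simp add: card_image)
next
  case (Suc n)
  have "{p :: 'a poly. degree p \<le> Suc n} = (\<lambda>(c, p). pCons c p) ` (UNIV \<times> {p. degree p \<le> n})"
  proof (intro Set.set_eqI iffI)
    fix p :: "'a poly" assume "p \<in> {p. degree p \<le> Suc n}"
    moreover obtain c r where "p = pCons c r" by (metis pCons_cases)
    ultimately show "p \<in> (\<lambda>(c, p). pCons c p) ` (UNIV \<times> {p. degree p \<le> n})"
      by (auto split: if_splits)
  qed (auto intro: order_trans[OF degree_pCons_le])
  moreover have "inj_on (\<lambda>(c, p). pCons c p) (UNIV \<times> {p :: 'a poly. degree p \<le> n})"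
    by (auto intro: inj_onI)
  ultimately show ?case using Suc by (simp add: card_image card_cartesian_product)
qed

lemma finite_forms [simp]: "finite (forms n :: 'a::{field,finite} binpoly set)"
  using bij_betw_finite[OF bij_betw_dehom] card_degree_le by blast

lemma card_forms: "card (forms n :: 'a::{field,finite} binpoly set) = CARD('a) ^ Suc n"
  using bij_betw_same_card[OF bij_betw_dehom] card_degree_le by metis

lemma finite_nforms [simp]: "finite (nforms n :: 'a::{field,finite} binpoly set)"
  by (rule finite_subset[OF _ finite_forms[of n]]) (auto simp: nforms_def)

lemma card_nforms:
  "(CARD('a) - 1) * card (nforms n :: 'a::{field,finite} binpoly set) = CARD('a) ^ Suc n - 1"
proof -
  let ?S = "(UNIV - {0 :: 'a}) \<times> (nforms n :: 'a binpoly set)"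
  have "bij_betw (\<lambda>(c, r). scale c r) ?S (forms n - {0 :: 'a binpoly})"
  proof (rule bij_betw_imageI)
    show "inj_on (\<lambda>(c, r). scale c r) ?S"
    proof (rule inj_onI)
      fix x y :: "'a \<times> 'a binpoly"
      assume "x \<in> ?S" "y \<in> ?S" "(\<lambda>(c, r). scale c r) x = (\<lambda>(c, r). scale c r) y"
      moreover obtain c r where x: "x = (c, r)" by (cases x)
      moreover obtain d s where y: "y = (d, s)" by (cases y)
      ultimately have *: "c \<noteq> 0" "d \<noteq> 0" "r \<in> nforms n" "s \<in> nforms n" "scale c r = scale d s" by auto
      have "s = scale (1 / d) (scale d s)" using * by simp
      also have "\<dots> = scale (c / d) r" unfolding *(5)[symmetric] by simp
      finally have s: "s = r" using nforms_scale_eq * by blast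
      have "c * lead_coeff (dehom r) = d * lead_coeff (dehom s)"
        using arg_cong[OF *(5), of "\<lambda>f. lead_coeff (dehom f)"] *(1,2) by simp
      then have "c = d" using * by (simp add: nforms_def)
      with s show "x = y" by (simp add: x y)
    qed
    show "(\<lambda>(c, r). scale c r) ` ?S = forms n - {0 :: 'a binpoly}"
    proof (intro Set.set_eqI iffI)
      fix f :: "'a binpoly" assume f: "f \<in> forms n - {0}"
      then obtain c r where "c \<noteq> 0" "r \<in> nforms n" "f = scale c r" using nforms_exists by blast
      then show "f \<in> (\<lambda>(c, r). scale c r) ` ?S" by auto
    qed (auto dest: nforms_forms nforms_nonzero)
  qed
  from bij_betw_same_card[OF this] show ?thesis
    by (simp add: card_cartesian_product card_Diff_singleton card_forms)
qed

lemma card_nforms_1: "card (nforms 1 :: 'a::{field,finite} binpoly set) = CARD('a) + 1"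
  and card_nforms_2: "card (nforms 2 :: 'a::{field,finite} binpoly set) = CARD('a)\<^sup>2 + CARD('a) + 1"
proof -
  have "CARD('a) > 1" using card_mono[of UNIV "{0, 1 :: 'a}"] by auto
  then obtain k where k: "CARD('a) = Suc k" "k > 0" by (cases "CARD('a)") auto
  have "k * card (nforms 1 :: 'a binpoly set) = k * (k + 2)"
    using card_nforms[where 'a = 'a, of 1] by (simp add: k algebra_simps)
  then have "card (nforms 1 :: 'a binpoly set) = k + 2" using k by (metis mult_left_cancel not_gr_zero)
  then show "card (nforms 1 :: 'a binpoly set) = CARD('a) + 1" using k by simp
  have "k * card (nforms 2 :: 'a binpoly set) = k * (k\<^sup>2 + 3 * k + 3)"
    using card_nforms[where 'a = 'a, of 2] by (simp add: k algebra_simps power2_eq_square numeral_3_eq_3)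
  then show "card (nforms 2 :: 'a binpoly set) = CARD('a)\<^sup>2 + CARD('a) + 1"
    using k by (simp add: power2_eq_square)
qed

section \<open>Linear functionals on forms\<close>

text \<open>
  Linearity on the forms of degree \<open>n\<close>; in contrast to \<open>dual_forms n\<close>, nothing is required of the values
  at other polynomials, so that \<open>g \<mapsto> u (f * g)\<close> is again such a functional.
\<close>

definition linear_on :: "nat \<Rightarrow> ('a::field binpoly \<Rightarrow> 'a) \<Rightarrow> bool" where
  "linear_on n u \<longleftrightarrow> (\<forall>f\<in>forms n. \<forall>g\<in>forms n. u (f + g) = u f + u g) \<and>
     (\<forall>c. \<forall>f\<in>forms n. u (scale c f) = c * u f)"

lemma linear_on_add: "linear_on n u \<Longrightarrow> f \<in> forms n \<Longrightarrow> g \<in> forms n \<Longrightarrow> u (f + g) = u f + u g"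
  and linear_on_scale: "linear_on n u \<Longrightarrow> f \<in> forms n \<Longrightarrow> u (scale c f) = c * u f"
  by (auto simp: linear_on_def)

lemma linear_on_0: "linear_on n u \<Longrightarrow> u 0 = 0"
  using linear_on_scale[of n u 0 0] by simp

lemma dual_forms_linear: "w \<in> dual_forms n \<Longrightarrow> linear_on n w"
  by (auto simp: dual_forms_def linear_on_def)

lemma linear_on_polar:
  assumes "linear_on n u" "f \<in> forms m" "m \<le> n"
  shows "linear_on (n - m) (\<lambda>g. u (f * g))"
proof -
  have *: "f * g \<in> forms n" if "g \<in> forms (n - m)" for g
    using forms_mult'[OF assms(2) that] assms(3) by simp
  show ?thesis
    unfolding linear_on_def
    using linear_on_add[OF assms(1)] linear_on_scale[OF assms(1)] *
    by (auto simp: distrib_left scale_mult_right)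
qed

lemma linear_on_polar':
  "linear_on (m + n) u \<Longrightarrow> f \<in> forms m \<Longrightarrow> linear_on n (\<lambda>g. u (f * g))"
  using linear_on_polar[of "m + n" u f m] by simp

lemma dual_forms_eq_zero_iff:
  assumes "w \<in> dual_forms n"
  shows "w = zero_dual \<longleftrightarrow> (\<forall>f\<in>forms n. w f = 0)"
proof
  assume *: "\<forall>f\<in>forms n. w f = 0"
  have "w f = 0" for f using assms * by (cases "f \<in> forms n") (auto simp: dual_forms_def)
  then show "w = zero_dual" by (simp add: fun_eq_iff)
qed simp

text \<open>
  Orthogonality of characters: a nontrivial character composed with a nonzero functional sums to \<open>0\<close>.
\<close>

lemma character_sum:
  fixes \<psi> :: "'a::{field,finite} \<Rightarrow> complex"
  assumes \<psi>: "nontrivial_additive_character \<psi>" and u: "linear_on n u"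
  shows "(\<Sum>f\<in>forms n. \<psi> (u f)) = (if \<forall>f\<in>forms n. u f = 0 then of_nat (CARD('a) ^ Suc n) else 0)"
proof (cases "\<forall>f\<in>forms n. u f = 0")
  case True
  have "\<psi> (0 + 0) = \<psi> 0 * \<psi> 0" "\<psi> 0 \<noteq> 0" using \<psi> unfolding nontrivial_additive_character_def by blast+
  then have "\<psi> 0 = 1" by simp
  moreover have "(\<Sum>f\<in>forms n. \<psi> (u f)) = (\<Sum>f\<in>(forms n :: 'a binpoly set). \<psi> 0)"
    using True by (intro sum.cong) auto
  ultimately show ?thesis using True by (simp add: card_forms)
next
  case False
  then obtain g where g: "g \<in> forms n" "u g \<noteq> 0" by blast
  obtain a where a: "\<psi> a \<noteq> 1" using \<psi> unfolding nontrivial_additive_character_def by blast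
  define h where "h = scale (a / u g) g"
  have h: "h \<in> forms n" "u h = a" using g linear_on_scale[OF u] by (auto simp: h_def)
  have "(\<Sum>f\<in>forms n. \<psi> (u f)) = (\<Sum>f\<in>forms n. \<psi> (u (f + h)))"
    by (rule sum.reindex_bij_witness[of _ "\<lambda>f. f + h" "\<lambda>f. f - h"]) (use h in auto)
  also have "\<dots> = (\<Sum>f\<in>forms n. \<psi> (u f) * \<psi> a)"
    using \<psi> h linear_on_add[OF u] unfolding nontrivial_additive_character_def by (intro sum.cong) auto
  also have "\<dots> = (\<Sum>f\<in>forms n. \<psi> (u f)) * \<psi> a" by (simp add: sum_distrib_right)
  finally have "(\<Sum>f\<in>forms n. \<psi> (u f)) * (1 - \<psi> a) = 0" by (simp add: right_diff_distrib)
  then have "(\<Sum>f\<in>forms n. \<psi> (u f)) = 0" using a by simp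
  then show ?thesis unfolding if_not_P[OF False] .
qed

section \<open>The apolar ideal of a functional on quintics\<close>

lemma X_power_Y_power: "X ^ a * Y ^ b = (monom (monom 1 a) b :: 'a::field binpoly)"
proof -
  have "X ^ a = [:monom 1 a :: 'a poly:]" by (simp add: X_def poly_const_pow monom_altdef)
  moreover have "Y ^ b = (monom 1 b :: 'a binpoly)" by (simp add: Y_def monom_altdef)
  ultimately show ?thesis by (simp add: smult_monom)
qed

lemma coeff_hom_comp:
  "coeff (coeff (hom_comp m f) j) i = (if i + j = m then coeff (coeff f j) i else 0)"
proof -
  have "coeff (coeff (hom_comp m f) j) i =
      (\<Sum>k\<le>m. if k = j then (if m - j = i then coeff (coeff f j) (m - j) else 0) else 0)"
    unfolding hom_comp_def coeff_sum coeff_scale X_power_Y_power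
    by (intro sum.cong) (auto simp: coeff_monom)
  then show ?thesis by auto
qed

lemma hom_comp_form: "f \<in> forms n \<Longrightarrow> hom_comp m f = (if m = n then f else 0)"
  by (rule poly_eqI, rule poly_eqI) (auto simp: coeff_hom_comp formsD)

lemma apolar_iff:
  assumes "w \<in> dual_forms 5" "f \<in> forms m" "m + n = 5"
  shows "f \<in> apolar_ideal 5 w \<longleftrightarrow> (\<forall>g\<in>forms n. w (f * g) = 0)"
proof -
  have n: "n = 5 - m" "m \<le> 5" using assms(3) by auto
  have 0: "w 0 = 0" using linear_on_0 dual_forms_linear assms(1) by blast
  have "f \<in> apolar_ideal 5 w \<longleftrightarrow> polar 5 w m f = zero_dual"
    unfolding apolar_ideal_def using assms(2) 0 by (auto simp: hom_comp_form polar_def fun_eq_iff)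
  then show ?thesis using n by (auto simp: polar_def fun_eq_iff)
qed

lemma apolar_scale_iff:
  assumes "w \<in> dual_forms 5" "f \<in> forms m" "m \<le> 5" "c \<noteq> 0"
  shows "scale c f \<in> apolar_ideal 5 w \<longleftrightarrow> f \<in> apolar_ideal 5 w"
proof -
  have *: "m + (5 - m) = 5" using assms by auto
  have "w (scale c f * g) = c * w (f * g)" if "g \<in> forms (5 - m)" for g
    using linear_on_scale[OF dual_forms_linear[OF assms(1)] forms_mult'[OF assms(2) that *[symmetric]]]
    by (simp add: scale_mult_left)
  then show ?thesis
    using apolar_iff[OF assms(1,2) *] apolar_iff[OF assms(1) forms_scale[OF assms(2)] *] assms(4) by auto
qed

lemma C_eq_sum_nforms:
  fixes w :: "'a::{field,finite} binpoly \<Rightarrow> 'a"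
  assumes "w \<in> dual_forms 5"
  shows "C w = - (\<Sum>r | r \<in> nforms 2 \<and> r\<^sup>2 \<in> apolar_ideal 5 w. eps (cls 2 r))"
proof -
  have *: "(\<exists>f\<in>cls 2 r. f ^ 2 \<in> apolar_ideal 5 w) \<longleftrightarrow> r\<^sup>2 \<in> apolar_ideal 5 w" if r: "r \<in> nforms 2" for r
  proof -
    have r2: "r\<^sup>2 \<in> forms 4" using r forms_power[of r 2 4 2] nforms_forms by auto
    have "r \<in> cls 2 r" using r nforms_forms nforms_nonzero by (auto simp: mem_cls intro!: exI[of _ 1])
    moreover have "f ^ 2 \<in> apolar_ideal 5 w \<longleftrightarrow> r\<^sup>2 \<in> apolar_ideal 5 w" if "f \<in> cls 2 r" for f
    proof -
      obtain c where "c \<noteq> 0" "f = scale c r" using \<open>f \<in> cls 2 r\<close> by (auto simp: mem_cls)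
      then show ?thesis using apolar_scale_iff[OF assms r2, of "c ^ 2"] by (simp add: scale_power)
    qed
    ultimately show ?thesis by blast
  qed
  have "{P \<in> proj_forms 2. \<exists>f2\<in>P. f2 ^ 2 \<in> apolar_ideal 5 w} =
      cls 2 ` {r \<in> nforms 2. r\<^sup>2 \<in> apolar_ideal 5 w}"
    using * bij_betw_imp_surj_on[OF bij_betw_cls[of 2]] by (auto simp: set_eq_iff image_iff) metis+
  moreover have "inj_on (cls 2) {r \<in> nforms 2. r\<^sup>2 \<in> apolar_ideal 5 w}"
    using bij_betw_imp_inj_on[OF bij_betw_cls] by (rule inj_on_subset) auto
  ultimately show ?thesis unfolding C_def by (simp add: sum.reindex)
qed

section \<open>Multiples of a fixed form\<close>

lemma multiples_eq_image:
  assumes "d \<in> forms m" "d \<noteq> 0" "m + n = k"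
  shows "{f \<in> forms k. d dvd f} = (*) d ` forms n"
proof (intro subset_antisym subsetI)
  fix f assume "f \<in> {f \<in> forms k. d dvd f}"
  then have f: "f \<in> forms k" "d dvd f" by auto
  obtain v where "f = d * v" "v \<in> forms (k - m)" using form_dvdE[OF f(2,1) assms(1,2)] assms(3) by auto
  then show "f \<in> (*) d ` forms n" using assms(3) by auto
qed (use assms forms_mult' in auto)

lemma sum_multiples:
  fixes \<psi> :: "'a::{field,finite} \<Rightarrow> complex"
  assumes \<psi>: "nontrivial_additive_character \<psi>" and w: "w \<in> dual_forms 5"
    and d: "d \<in> forms m" "d \<noteq> 0" "m + n = 5"
  shows "(\<Sum>f | f \<in> forms 5 \<and> d dvd f. \<psi> (w f)) =
    (if d \<in> apolar_ideal 5 w then of_nat (CARD('a) ^ Suc n) else 0)"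
proof -
  have "inj_on ((*) d) (forms n)" using d(2) by (auto intro: inj_onI)
  then have "(\<Sum>f | f \<in> forms 5 \<and> d dvd f. \<psi> (w f)) = (\<Sum>g\<in>forms n. \<psi> (w (d * g)))"
    unfolding multiples_eq_image[OF d] by (simp add: sum.reindex)
  also have "linear_on n (\<lambda>g. w (d * g))"
    using linear_on_polar'[of m n w d] dual_forms_linear[OF w] d by simp
  note character_sum[OF \<psi> this]
  finally show ?thesis using apolar_iff[OF w d(1,3)] by simp
qed

text \<open>
  The left and right kernels of the pairing \<open>(f, g) \<mapsto> w (f * g)\<close> between quadratic and cubic forms have the
  same codimension, \<open>3\<close> and \<open>4\<close> being the dimensions of the two spaces. The proof evaluates the double
  sum of \<open>\<psi> (w (f * g))\<close> in both orders.
\<close>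

lemma card_apolar_duality:
  fixes w :: "'a::{field,finite} binpoly \<Rightarrow> 'a"
  assumes "nontrivial_additive_character (\<psi> :: 'a \<Rightarrow> complex)" and w: "w \<in> dual_forms 5"
  shows "card {f \<in> forms 3. f \<in> apolar_ideal 5 w} = CARD('a) * card {f \<in> forms 2. f \<in> apolar_ideal 5 w}"
proof -
  have w5: "linear_on 5 w" using dual_forms_linear[OF w] .
  have inner: "(\<Sum>g\<in>forms n. \<psi> (w (f * g))) =
      (if f \<in> apolar_ideal 5 w then of_nat (CARD('a) ^ Suc n) else 0)"
    if "f \<in> forms m" "m + n = 5" for f m n
    using character_sum[OF assms(1) linear_on_polar'[of m n w f]] apolar_iff[OF w that] that w5 by simp
  have total: "(\<Sum>f\<in>forms m. \<Sum>g\<in>forms n. \<psi> (w (f * g))) =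
      of_nat (CARD('a) ^ Suc n * card {f \<in> forms m. f \<in> apolar_ideal 5 w})" if "m + n = 5" for m n
  proof -
    have "(\<Sum>f\<in>forms m. \<Sum>g\<in>forms n. \<psi> (w (f * g))) =
        (\<Sum>f\<in>forms m. if f \<in> apolar_ideal 5 w then of_nat (CARD('a) ^ Suc n) else 0)"
      using inner[OF _ that] by (intro sum.cong) auto
    also have "\<dots> = (\<Sum>f | f \<in> forms m \<and> f \<in> apolar_ideal 5 w. of_nat (CARD('a) ^ Suc n))"
      by (intro sum.inter_filter[symmetric]) simp
    finally show ?thesis by (simp add: mult.commute)
  qed
  have "(\<Sum>f\<in>forms 2. \<Sum>g\<in>forms 3. \<psi> (w (f * g))) = (\<Sum>g\<in>forms 3. \<Sum>f\<in>forms 2. \<psi> (w (g * f)))"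
    by (subst sum.swap) (simp add: mult.commute)
  then have "CARD('a) ^ 4 * card {f \<in> forms 2. f \<in> apolar_ideal 5 w} =
      CARD('a) ^ 3 * card {f \<in> forms 3. f \<in> apolar_ideal 5 w}"
    using total[of 2 3] total[of 3 2] by (simp add: eval_nat_numeral del: of_nat_mult of_nat_power)
  then have "CARD('a) ^ 3 * (CARD('a) * card {f \<in> forms 2. f \<in> apolar_ideal 5 w}) =
      CARD('a) ^ 3 * card {f \<in> forms 3. f \<in> apolar_ideal 5 w}"
    by (simp add: eval_nat_numeral mult.assoc)
  then show ?thesis by simp
qed

section \<open>Sums of \<open>\<epsilon>\<close> over quadratic forms\<close>

lemma forms_mult_1_1: "f \<in> forms 1 \<Longrightarrow> g \<in> forms 1 \<Longrightarrow> f * g \<in> forms 2"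
  using forms_mult'[of f 1 g 1 2] by simp

lemma nforms_mult_1_1: "f \<in> nforms 1 \<Longrightarrow> g \<in> nforms 1 \<Longrightarrow> f * g \<in> nforms 2"
  using nforms_mult[of f 1 g 1] by (simp add: numeral_2_eq_2)

lemma dvd_form_degree_le:
  assumes "u dvd f" "u \<in> forms m" "f \<in> forms n" "f \<noteq> 0"
  shows "m \<le> n"
proof -
  obtain v where v: "f = u * v" using assms(1) by (auto elim: dvdE)
  then obtain i j where ij: "u \<in> forms i" "v \<in> forms j" "i + j = n"
    using form_factor[of u v n] assms by auto
  have "u \<noteq> 0" using v assms(4) by auto
  then have "i = m" using forms_degree_unique[OF ij(1) assms(2)] by simp
  then show ?thesis using ij by simp
qed

lemma linear_square_dvd_cancel:
  assumes m: "m \<in> forms 1" "m \<noteq> 0" and s: "s \<in> forms a" "\<not> m dvd s" and g: "g \<in> forms b"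
    and dvd: "m\<^sup>2 dvd s * g"
  shows "m\<^sup>2 dvd g"
proof (cases "g = 0")
  case False
  have "m dvd s * g" using dvd by (metis dvd_mult_left power2_eq_square)
  then have "m dvd g" using linear_prime[OF m s(1) g] s(2) by blast
  then obtain h where h: "g = m * h" by (auto elim: dvdE)
  then obtain j where j: "h \<in> forms j" using form_factor[of m h b] g False by metis
  have "m * m dvd m * (s * h)" using dvd h by (simp add: power2_eq_square mult_ac)
  then have "m dvd s * h" using m(2) by simp
  then have "m dvd h" using linear_prime[OF m s(1) j] s(2) by blast
  then show ?thesis using h by (simp add: power2_eq_square)
qed simp

lemma nforms_1_dvd_iff: "l \<in> nforms 1 \<Longrightarrow> m \<in> nforms 1 \<Longrightarrow> l dvd m \<longleftrightarrow> l = m"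
  using nforms_dvd_eq[of l 1 m] by auto

lemma nforms_1_not_dvd_power:
  assumes "l \<in> nforms 1" "m \<in> nforms 1" "l \<noteq> m"
  shows "\<not> m dvd l ^ k"
  using linear_prime_power[of m l 1 k] assms nforms_1_dvd_iff[of m l] nforms_forms[of _ 1]
    nforms_nonzero[of _ 1] by blast

lemma nforms_1_dvd_mult_iff:
  assumes "k \<in> nforms 1" "l \<in> nforms 1" "m \<in> nforms 1"
  shows "k dvd l * m \<longleftrightarrow> k = l \<or> k = m"
  using linear_prime[of k l 1 m 1] assms nforms_1_dvd_iff nforms_forms[of _ 1] nforms_nonzero[of _ 1]
  by auto

lemma eps_mult:
  assumes "l \<in> nforms 1" "m \<in> nforms 1"
  shows "eps (cls 2 (l * m)) = (if l = m then 0 else 1)"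
proof -
  have lm: "l * m \<in> forms 2" using assms nforms_forms forms_mult_1_1 by blast
  have l: "l \<in> forms 1 - {0}" and m: "m \<in> forms 1 - {0}"
    using assms nforms_forms nforms_nonzero by auto
  show ?thesis
  proof (cases "l = m")
    case True
    have "l * m = scale 1 (l ^ 2)" using True by (simp add: power2_eq_square)
    then have "ramified_form (l * m)" using l unfolding ramified_form_def by (metis zero_neq_one)
    then show ?thesis using True eps_ramified[OF lm] by simp
  next
    case False
    then have "\<not> proportional l m" using l m assms by (simp add: proportional_iff_dvd nforms_1_dvd_iff)
    then have "split_form (l * m)" using l m unfolding split_form_def by blast
    then show ?thesis using False eps_split[OF lm] by simp
  qed
qed

lemma nforms_2_cases:
  assumes "r \<in> nforms 2"
  obtains (reducible) l m where "l \<in> nforms 1" "m \<in> nforms 1" "r = l * m" | (irr) "irreducible r"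
proof -
  have "\<exists>l m. l \<in> nforms 1 \<and> m \<in> nforms 1 \<and> r = l * m" if "\<not> irreducible r"
  proof -
    have r: "r \<in> forms 2" "r \<noteq> 0" using assms nforms_forms nforms_nonzero by auto
    have "\<exists>u\<in>forms 1 - {0}. \<exists>v\<in>forms 1 - {0}. \<exists>c. r = scale c (u * v)"
    proof (cases "split_form r")
      case True
      then show ?thesis unfolding split_form_def by (metis scale_simps(1))
    next
      case False
      then have "ramified_form r" using quadratic_cases[OF r] that by blast
      then show ?thesis unfolding ramified_form_def by (metis power2_eq_square)
    qed
    then obtain u v c where uv: "u \<in> forms 1" "u \<noteq> 0" "v \<in> forms 1" "v \<noteq> 0" "r = scale c (u * v)" by blast
    obtain a l where l: "l \<in> nforms 1" "u = scale a l" using nforms_exists[OF uv(1,2)] by blast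
    obtain b m where m: "m \<in> nforms 1" "v = scale b m" using nforms_exists[OF uv(3,4)] by blast
    have "r = scale (c * (a * b)) (l * m)"
      by (simp add: uv l m scale_mult_left scale_mult_right mult.commute)
    moreover have "l * m \<in> nforms 2" using nforms_mult_1_1[OF l(1) m(1)] .
    ultimately have "r = l * m" using nforms_scale_eq[OF _ assms] by blast
    then show ?thesis using l m by blast
  qed
  then show ?thesis using that by blast
qed

lemma nforms_2_multiples:
  assumes "l \<in> nforms 1"
  shows "{r \<in> nforms 2. l dvd r} = (*) l ` nforms 1"
proof (intro subset_antisym subsetI)
  fix r assume "r \<in> {r \<in> nforms 2. l dvd r}"
  then have r: "r \<in> nforms 2" "l dvd r" by auto
  obtain v where v: "r = l * v" "v \<in> forms (2 - 1)"
    using form_dvdE[OF r(2) nforms_forms[OF r(1)] nforms_forms[OF assms] nforms_nonzero[OF assms]] by auto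
  have "v \<in> nforms 1" using r(1) assms v by (simp add: nforms_def lead_coeff_mult)
  then show "r \<in> (*) l ` nforms 1" using v by auto
next
  fix r assume "r \<in> (*) l ` nforms 1"
  then show "r \<in> {r \<in> nforms 2. l dvd r}" using nforms_mult_1_1[OF assms] by auto
qed

lemma inj_on_mult_nforms: "l \<in> nforms 1 \<Longrightarrow> inj_on ((*) l) A"
  by (auto intro!: inj_onI dest: nforms_nonzero)

lemma sum_eps_multiples:
  fixes l :: "'a::{field,finite} binpoly"
  assumes "l \<in> nforms 1"
  shows "(\<Sum>r | r \<in> nforms 2 \<and> l dvd r. eps (cls 2 r)) = of_nat CARD('a)"
proof -
  have "(\<Sum>r | r \<in> nforms 2 \<and> l dvd r. eps (cls 2 r)) = (\<Sum>m\<in>nforms 1. eps (cls 2 (l * m)))"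
    unfolding nforms_2_multiples[OF assms] by (simp add: sum.reindex inj_on_mult_nforms[OF assms])
  also have "\<dots> = (\<Sum>m\<in>nforms 1. if m = l then 0 else 1)"
    using eps_mult[OF assms] by (intro sum.cong) auto
  also have "\<dots> = (\<Sum>m\<in>nforms 1 - {l}. 1)"
    using assms by (intro sum.mono_neutral_cong_right) auto
  also have "\<dots> = of_nat CARD('a)" using assms by (simp add: card_nforms_1[simplified])
  finally show ?thesis .
qed

lemma irreducible_quadratic_no_root:
  assumes "r \<in> forms 2" "irreducible r" "l \<in> forms 1"
  shows "\<not> l dvd r"
  using irreducible_no_factor[OF assms(2,1,3)] by auto

lemma card_linear_divisors:
  fixes r :: "'a::{field,finite} binpoly"
  assumes r: "r \<in> nforms 2"
  shows "of_nat (card {l \<in> nforms 1. l dvd r}) = 1 + eps (cls 2 r)"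
  using r
proof (cases rule: nforms_2_cases)
  case (reducible l m)
  then have "{k \<in> nforms 1. k dvd r} = {l, m}" using nforms_1_dvd_mult_iff by auto
  then show ?thesis using reducible by (cases "l = m") (simp_all add: eps_mult)
next
  case irr
  then have "{k \<in> nforms 1. k dvd r} = {}"
    using irreducible_quadratic_no_root[of r] r nforms_forms by blast
  then show ?thesis using eps_irreducible[OF nforms_forms[OF r] irr] by (simp only: card.empty) simp
qed

text \<open>
  The pairs \<open>(l, r)\<close> with \<open>l\<close> dividing \<open>r\<close> are counted in two ways: a quadratic form \<open>r\<close> has \<open>1 + \<epsilon>(r)\<close>
  linear divisors (lemma \<open>card_linear_divisors\<close>), and each of the \<open>q + 1\<close> linear forms has \<open>q + 1\<close> multiples.
\<close>

lemma sum_eps: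
  "(\<Sum>r\<in>nforms 2. eps (cls 2 (r :: 'a::{field,finite} binpoly))) = of_nat CARD('a)"
proof -
  let ?L = "nforms 1 :: 'a binpoly set" and ?R = "nforms 2 :: 'a binpoly set"
  have "(\<Sum>r\<in>?R. card {l \<in> ?L. l dvd r}) = (\<Sum>l\<in>?L. card {r \<in> ?R. l dvd r})"
    using sum.swap_restrict[of ?R ?L "\<lambda>_ _. 1 :: nat" "\<lambda>r l. l dvd r"] by simp
  also have "\<dots> = (\<Sum>l\<in>?L. CARD('a) + 1)"
    by (intro sum.cong) (simp_all add: nforms_2_multiples[simplified] card_image inj_on_mult_nforms[simplified] card_nforms_1[simplified])
  also have "\<dots> = (CARD('a) + 1) * (CARD('a) + 1)" by (simp add: card_nforms_1[simplified])
  finally have "of_nat (\<Sum>r\<in>?R. card {l \<in> ?L. l dvd r}) = (of_nat ((CARD('a) + 1) * (CARD('a) + 1)) :: complex)"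
    by simp
  moreover have "of_nat (\<Sum>r\<in>?R. card {l \<in> ?L. l dvd r}) = (\<Sum>r\<in>?R. 1 + eps (cls 2 r))"
    unfolding of_nat_sum by (intro sum.cong card_linear_divisors) auto
  ultimately have "(\<Sum>r\<in>?R. 1 + eps (cls 2 r)) = of_nat ((CARD('a) + 1) * (CARD('a) + 1))"
    by simp
  then have "(\<Sum>r\<in>?R. eps (cls 2 r)) + of_nat (CARD('a)\<^sup>2 + CARD('a) + 1) =
      of_nat ((CARD('a) + 1) * (CARD('a) + 1))"
    by (simp add: sum.distrib card_nforms_2 add.commute)
  then show ?thesis by (simp add: algebra_simps power2_eq_square)
qed

section \<open>The square sieve\<close>

lemma irreducible_dehom:
  assumes r: "r \<in> forms 2" "irreducible r"
  shows "degree (dehom r) = 2" "irreducible (dehom r)"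
proof -
  have nz: "dehom r \<noteq> 0" using r dehom_eq_0_iff[of r 2] by (auto simp: irreducible_def)
  show deg: "degree (dehom r) = 2"
  proof (rule ccontr)
    assume "degree (dehom r) \<noteq> 2"
    then have le: "degree (dehom r) \<le> 1" using degree_dehom_le[OF r(1)] by simp
    have "r = Y * homog 1 (dehom r)"
      by (rule dehom_inj[OF r(1) forms_mult'[OF Y_forms homog_forms]]) (use le in auto)
    then show False using irreducible_quadratic_no_root[OF r Y_forms] by (metis dvd_triv_left)
  qed
  show "irreducible (dehom r)"
  proof (rule irreducibleI)
    show "dehom r \<noteq> 0" by fact
    show "\<not> is_unit (dehom r)" using deg nz by (simp add: is_unit_iff_degree)
    fix u v assume uv: "dehom r = u * v"
    with nz have "u \<noteq> 0" "v \<noteq> 0" by auto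
    then have sum: "degree u + degree v = 2" using deg uv by (simp add: degree_mult_eq)
    show "is_unit u \<or> is_unit v"
    proof (rule ccontr)
      assume "\<not> (is_unit u \<or> is_unit v)"
      then have "degree u \<noteq> 0" "degree v \<noteq> 0" using \<open>u \<noteq> 0\<close> \<open>v \<noteq> 0\<close> by (auto simp: is_unit_iff_degree)
      then have d: "degree u = 1" "degree v = 1" using sum by auto
      have "r = homog 1 u * homog 1 v"
        by (rule dehom_inj[OF r(1) forms_mult'[OF homog_forms homog_forms]]) (use d uv in auto)
      then show False using irreducible_quadratic_no_root[OF r, of "homog 1 u"] homog_forms
        by (metis dvd_triv_left)
    qed
  qed
qed

lemma irreducible_quadratic_prime:
  assumes r: "r \<in> nforms 2" "irreducible r" and s: "s \<in> nforms 2" and g: "g \<in> forms 1" "g \<noteq> 0"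
    and dvd: "r dvd s\<^sup>2 * g"
  shows "s = r"
proof -
  have r2: "r \<in> forms 2" using r nforms_forms by blast
  have "prime_elem (dehom r)" using irreducible_dehom[OF r2 r(2)] field_poly_irreducible_imp_prime by blast
  moreover have "dehom r dvd (dehom s)\<^sup>2 * dehom g" using dehom_dvd[OF dvd] by simp
  ultimately have "dehom r dvd dehom s \<or> dehom r dvd dehom g"
    by (metis prime_elem_dvd_mult_iff prime_elem_dvd_power)
  moreover have "\<not> dehom r dvd dehom g"
  proof
    assume "dehom r dvd dehom g"
    moreover have "dehom g \<noteq> 0" using g dehom_eq_0_iff by blast
    ultimately have "degree (dehom r) \<le> degree (dehom g)" by (rule dvd_imp_degree_le)
    then show False using degree_dehom_le[OF g(1)] irreducible_dehom(1)[OF r2 r(2)] by simp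
  qed
  ultimately obtain v where v: "dehom s = dehom r * v" by (auto elim: dvdE)
  have nz: "dehom s \<noteq> 0" using s by (auto simp: nforms_def)
  then have nz': "dehom r \<noteq> 0" "v \<noteq> 0" using v by auto
  then have "degree (dehom s) = 2 + degree v"
    using v irreducible_dehom(1)[OF r2 r(2)] by (simp add: degree_mult_eq)
  then have "degree v = 0" using degree_dehom_le[OF nforms_forms[OF s]] by simp
  then obtain c where c: "v = [:c:]" by (auto elim: degree_eq_zeroE)
  have "s = scale c r"
    by (rule dehom_inj[OF nforms_forms[OF s] forms_scale[OF r2]]) (simp add: v c)
  then show ?thesis using nforms_scale_eq[OF r(1) s] by simp
qed

text \<open>
  Having a repeated factor of degree one or two. For nonzero quintic forms this covers every repeated factor,
  because a form whose square has degree at most \<open>5\<close> has degree at most \<open>2\<close>.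
\<close>

definition singular_form :: "'a::field binpoly \<Rightarrow> bool" where
  "singular_form f \<longleftrightarrow> (\<exists>l\<in>nforms 1. l\<^sup>2 dvd f) \<or> (\<exists>r\<in>nforms 2. irreducible r \<and> r\<^sup>2 dvd f)"

text \<open>
  For nonzero \<open>f\<close>, let \<open>L\<close> and \<open>R\<close> be the sets of \<open>l\<close> and \<open>r\<close> with \<open>l\<^sup>2\<close> and \<open>r\<^sup>2\<close> dividing \<open>f\<close>. By degree reasons
  \<open>L\<close> has at most two elements, and an irreducible \<open>r \<in> R\<close> forces \<open>L = {}\<close> and \<open>R = {r}\<close>. All other
  \<open>r \<in> R\<close> are products of elements of \<open>L\<close>; the squares among them do not contribute since \<open>\<epsilon>\<close>
  vanishes there. Thus \<open>L = {l, m}\<close> gives \<open>2 - \<epsilon>(l m) = 1\<close>, a single \<open>l\<close> gives \<open>1 - 0\<close>, and an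
  irreducible \<open>r\<close> gives \<open>0 + 1\<close>.
\<close>

lemma square_sieve:
  fixes f :: "'a::{field,finite} binpoly"
  assumes f: "f \<in> forms 5"
  shows "of_nat (card {l \<in> nforms 1. l\<^sup>2 dvd f}) - (\<Sum>r | r \<in> nforms 2 \<and> r\<^sup>2 dvd f. eps (cls 2 r))
    = (if singular_form f then 1 else 0)"
proof (cases "f = 0")
  case True
  have "card (nforms 1 :: 'a binpoly set) \<noteq> 0" by (simp add: card_nforms_1[simplified])
  then have "(nforms 1 :: 'a binpoly set) \<noteq> {}" by (metis card.empty)
  then have "singular_form f" using True unfolding singular_form_def by auto
  then show ?thesis using True by (simp add: sum_eps card_nforms_1[simplified])
next
  case False
  define L where "L = {l \<in> nforms 1. l\<^sup>2 dvd f}"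
  define R where "R = {r \<in> nforms 2. r\<^sup>2 dvd f}"
  have fin: "finite L" "finite R" by (simp_all add: L_def R_def)
  have L: "l \<in> forms 1" "l \<noteq> 0" "l \<in> nforms 1" "l\<^sup>2 dvd f" "l\<^sup>2 \<in> forms 2" "l\<^sup>2 \<noteq> 0" if "l \<in> L" for l
    using that nforms_forms nforms_nonzero forms_power[of l 1 2 2] by (auto simp: L_def)
  have R: "r \<in> forms 2" "r \<noteq> 0" "r \<in> nforms 2" "r\<^sup>2 dvd f" "r\<^sup>2 \<in> forms 4" "r\<^sup>2 \<noteq> 0" if "r \<in> R" for r
    using that nforms_forms nforms_nonzero forms_power[of r 2 4 2] by (auto simp: R_def)
  have two: "\<exists>g\<in>forms 1. g \<noteq> 0 \<and> f = (l * m)\<^sup>2 * g" if lm: "l \<in> L" "m \<in> L" "l \<noteq> m" for l m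
  proof -
    obtain g where g: "f = l\<^sup>2 * g" "g \<in> forms (5 - 2)"
      using form_dvdE[OF L(4)[OF lm(1)] f L(5,6)[OF lm(1)]] by auto
    have "m\<^sup>2 dvd g"
      using linear_square_dvd_cancel[OF L(1,2)[OF lm(2)] L(5)[OF lm(1)] _ g(2)]
        nforms_1_not_dvd_power[of l m] L(4)[OF lm(2)] L(3) lm g(1) by simp
    then obtain h where h: "g = m\<^sup>2 * h" "h \<in> forms (3 - 2)"
      using form_dvdE[OF _ g(2) L(5,6)[OF lm(2)]] by auto
    then have "f = (l * m)\<^sup>2 * h" using g by (simp add: power_mult_distrib mult.assoc)
    then show ?thesis using h False by auto
  qed
  have three: False if lmk: "l \<in> L" "m \<in> L" "k \<in> L" "l \<noteq> m" "l \<noteq> k" "m \<noteq> k" for l m k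
  proof -
    obtain g where g: "g \<in> forms 1" "g \<noteq> 0" "f = (l * m)\<^sup>2 * g" using two lmk by blast
    have "\<not> k dvd l * m" using nforms_1_dvd_mult_iff L(3) lmk by blast
    moreover have lm: "l * m \<in> forms 2" using L(1) lmk forms_mult_1_1 by blast
    ultimately have "\<not> k dvd (l * m)\<^sup>2" using linear_prime_power[OF L(1,2)[OF lmk(3)] lm] by blast
    moreover have "(l * m)\<^sup>2 \<in> forms 4" using forms_power[OF lm, of 4 2] by simp
    ultimately have "k\<^sup>2 dvd g"
      using linear_square_dvd_cancel[OF L(1,2)[OF lmk(3)] _ _ g(1)] L(4)[OF lmk(3)] g(3) by blast
    then show False using dvd_form_degree_le[OF _ L(5)[OF lmk(3)] g(1,2)] by simp
  qed
  have mixed: False if r: "r \<in> R" "irreducible r" and l: "l \<in> L" for r l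
  proof -
    obtain g where g: "f = r\<^sup>2 * g" "g \<in> forms (5 - 4)"
      using form_dvdE[OF R(4)[OF r(1)] f R(5,6)[OF r(1)]] by auto
    have "\<not> l dvd r\<^sup>2"
      using linear_prime_power[OF L(1,2)[OF l] R(1)[OF r(1)]]
        irreducible_quadratic_no_root[OF R(1)[OF r(1)] r(2) L(1)[OF l]] by blast
    then have "l\<^sup>2 dvd g"
      using linear_square_dvd_cancel[OF L(1,2)[OF l] R(5)[OF r(1)] _ g(2)] L(4)[OF l] g(1) by simp
    then show False using dvd_form_degree_le[OF _ L(5)[OF l] g(2)] g(1) False by auto
  qed
  have unique: "s = r" if r: "r \<in> R" "irreducible r" and s: "s \<in> R" for r s
  proof -
    obtain g where g: "f = s\<^sup>2 * g" "g \<in> forms (5 - 4)"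
      using form_dvdE[OF R(4)[OF s] f R(5,6)[OF s]] by auto
    have "r dvd s\<^sup>2 * g" using R(4)[OF r(1)] g(1) by (metis dvd_mult_left power2_eq_square)
    then show ?thesis
      using irreducible_quadratic_prime[OF R(3)[OF r(1)] r(2) R(3)[OF s], of g] g False by auto
  qed
  have reducible: "l \<in> L \<and> m \<in> L" if "l * m \<in> R" "l \<in> nforms 1" "m \<in> nforms 1" for l m
  proof -
    have "l\<^sup>2 * m\<^sup>2 dvd f" using R(4)[OF that(1)] by (simp add: power_mult_distrib)
    then show ?thesis using that(2,3) by (auto simp: L_def elim: dvd_mult_left dvd_mult_right)
  qed
  have sing: "singular_form f \<longleftrightarrow> L \<noteq> {} \<or> (\<exists>r\<in>R. irreducible r)"
    by (auto simp: singular_form_def L_def R_def)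
  have main: "of_nat (card L) - (\<Sum>r\<in>R. eps (cls 2 r)) = (if singular_form f then 1 else (0 :: complex))"
  proof (cases "L = {}")
    case True
    have irr: "irreducible r" if "r \<in> R" for r
      using R(3)[OF that]
    proof (cases rule: nforms_2_cases)
      case (reducible l m)
      then show ?thesis using \<open>\<And>m l. l * m \<in> R \<Longrightarrow> _ \<Longrightarrow> _ \<Longrightarrow> _\<close>[of l m] that True by auto
    qed
    show ?thesis
    proof (cases "R = {}")
      case True
      then show ?thesis using \<open>L = {}\<close> sing by simp
    next
      case False
      then obtain r where r: "r \<in> R" by blast
      then have "R = {r}" using unique irr by blast
      moreover have "singular_form f" using sing r irr by blast
      ultimately show ?thesis using \<open>L = {}\<close> eps_irreducible[OF R(1)[OF r] irr[OF r]] by simp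
    qed
  next
    case False
    then have "singular_form f" using sing by simp
    have cases: "\<exists>l\<in>L. \<exists>m\<in>L. r = l * m" if "r \<in> R" for r
      using R(3)[OF that]
    proof (cases rule: nforms_2_cases)
      case (reducible l m)
      then show ?thesis using \<open>\<And>m l. l * m \<in> R \<Longrightarrow> _ \<Longrightarrow> _ \<Longrightarrow> _\<close>[of l m] that by auto
    next
      case irr
      then show ?thesis using mixed that False by blast
    qed
    obtain l where l: "l \<in> L" using False by blast
    show ?thesis
    proof (cases "L = {l}")
      case True
      have "r = l * l" if "r \<in> R" for r using cases[OF that] True by auto
      then have "(\<Sum>r\<in>R. eps (cls 2 r)) = (\<Sum>r\<in>R. 0)"
        using eps_mult[OF L(3)[OF l] L(3)[OF l]] by (intro sum.cong) auto
      then show ?thesis using True \<open>singular_form f\<close> by simp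
    next
      case False
      then obtain m where m: "m \<in> L" "m \<noteq> l" using l by blast
      then have Leq: "L = {l, m}" using three l by blast
      have "l * m \<in> R"
        using two[OF l m(1)] m(2) nforms_mult_1_1[OF L(3)[OF l] L(3)[OF m(1)]] by (auto simp: R_def)
      then have "(\<Sum>r\<in>R. eps (cls 2 r)) = (\<Sum>r\<in>{l * m}. eps (cls 2 r))"
      proof (intro sum.mono_neutral_right fin ballI)
        fix r assume "r \<in> R - {l * m}"
        then have "r = l * l \<or> r = m * m" using cases[of r] by (auto simp: Leq mult.commute)
        then show "eps (cls 2 r) = 0" using eps_mult[OF L(3)[OF l] L(3)[OF l]]
            eps_mult[OF L(3)[OF m(1)] L(3)[OF m(1)]] by auto
      qed auto
      also have "\<dots> = 1" using eps_mult[OF L(3)[OF l] L(3)[OF m(1)]] m(2) by simp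
      finally show ?thesis using Leq m \<open>singular_form f\<close> by simp
    qed
  qed
  then show ?thesis unfolding L_def R_def .
qed

(* Below, \<open>$\<close> denotes the entries of vectors. *)
no_notation fps_nth (infixl \<open>$\<close> 75)

section \<open>Repeated factors over finite fields\<close>

lemma degree_pderiv_le: "degree (pderiv p) \<le> degree p - 1"
  by (rule degree_le) (auto simp: coeff_pderiv coeff_eq_0)

lemma CHAR_prime_finite_field: "prime CHAR('a::{field,finite})"
  by (rule prime_CHAR_semidom) (simp add: finite_imp_CHAR_pos)

lemma frobenius_surj: "\<exists>y. y ^ CHAR('a) = (x :: 'a::{field,finite})"
proof -
  have "inj (\<lambda>y :: 'a. y ^ CHAR('a))"
  proof (rule injI)
    fix x y :: 'a assume eq: "x ^ CHAR('a) = y ^ CHAR('a)"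
    have "x ^ CHAR('a) = ((x - y) + y) ^ CHAR('a)" by simp
    also have "\<dots> = (x - y) ^ CHAR('a) + y ^ CHAR('a)"
      by (rule freshmans_dream) (rule CHAR_prime_finite_field, simp)
    finally have "(x - y) ^ CHAR('a) = 0" using eq by simp
    then show "x = y" by simp
  qed
  then have "surj (\<lambda>y :: 'a. y ^ CHAR('a))" by (rule finite_UNIV_inj_surj[OF finite_class.finite_UNIV])
  then show ?thesis by (metis surjD)
qed

text \<open>
  Finite fields are perfect: a polynomial with vanishing derivative is a polynomial in \<open>x ^ p\<close>, and since
  its coefficients are \<open>p\<close>-th powers, it is itself a \<open>p\<close>-th power.
\<close>

lemma pderiv_zero_imp_power:
  fixes r :: "'a::{field,finite} poly"
  assumes "pderiv r = 0"
  obtains s where "r = s ^ CHAR('a)"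
proof -
  define p where "p = CHAR('a)"
  have p: "prime p" using CHAR_prime_finite_field[where 'a = 'a] by (simp add: p_def)
  have dvd: "p dvd i" if "coeff r i \<noteq> 0" for i
  proof (cases i)
    case (Suc k)
    have "coeff (pderiv r) k = 0" using assms by simp
    then have "of_nat i = (0 :: 'a)" using that Suc by (simp add: coeff_pderiv)
    then show ?thesis by (simp add: of_nat_eq_0_iff_char_dvd p_def)
  qed simp
  obtain g where g: "g x ^ p = x" for x :: 'a using frobenius_surj unfolding p_def by metis
  define s where "s = (\<Sum>j\<le>degree r. monom (g (coeff r (p * j))) j)"
  have "s ^ CHAR('a poly) = (\<Sum>j\<le>degree r. monom (g (coeff r (p * j))) j ^ CHAR('a poly))"
    unfolding s_def by (rule freshmans_dream_sum) (use CHAR_prime_finite_field in simp_all)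
  then have *: "s ^ p = (\<Sum>j\<le>degree r. monom (coeff r (p * j)) (p * j))"
    by (simp add: p_def[symmetric] monom_power g mult.commute)
  have "r = s ^ p"
  proof (rule poly_eqI)
    fix i
    have "coeff (s ^ p) i = (\<Sum>j\<le>degree r. if p * j = i then coeff r i else 0)"
      unfolding * coeff_sum by (intro sum.cong) auto
    also have "\<dots> = coeff r i"
    proof (cases "coeff r i = 0")
      case False
      then obtain j where j: "i = p * j" using dvd by (auto elim: dvdE)
      have "i \<le> degree r" using False by (rule le_degree)
      moreover have "j \<le> i" unfolding j using p prime_gt_0_nat[OF p] by simp
      ultimately have "j \<in> {..degree r}" by simp
      moreover have "(if p * k = i then coeff r i else 0) = (if k = j then coeff r i else 0)" for k
        using prime_gt_0_nat[OF p] by (simp add: j)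
      ultimately show ?thesis by simp
    qed simp
    finally show "coeff r i = coeff (s ^ p) i" by simp
  qed
  then show ?thesis using that by (simp add: p_def)
qed

lemma irreducible_pderiv_nonzero:
  fixes r :: "'a::{field,finite} poly"
  assumes "irreducible r"
  shows "pderiv r \<noteq> 0"
proof
  assume "pderiv r = 0"
  then obtain s where s: "r = s ^ CHAR('a)" by (rule pderiv_zero_imp_power)
  obtain k where k: "CHAR('a) = Suc (Suc k)"
    using prime_ge_2_nat[OF CHAR_prime_finite_field[where 'a = 'a]]
    by (cases "CHAR('a)"; cases "CHAR('a) - 1") auto
  have "r = s * s ^ Suc k" unfolding s k by simp
  then have "is_unit s \<or> is_unit (s ^ Suc k)" using assms irreducibleD by blast
  then have "is_unit s" by (auto simp: is_unit_power_iff)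
  then have "is_unit r" unfolding s by (simp add: is_unit_power_iff)
  then show False using assms by (simp add: irreducible_def)
qed

lemma repeated_factor_if_dvd_pderiv:
  fixes p r :: "'a::{field,finite} poly"
  assumes r: "irreducible r" "r dvd p" "r dvd pderiv p"
  shows "r\<^sup>2 dvd p"
proof -
  obtain s where s: "p = r * s" using r(2) by (auto elim: dvdE)
  have prime: "prime_elem r" using r(1) by (rule field_poly_irreducible_imp_prime)
  have "pderiv p = r * pderiv s + s * pderiv r" by (simp add: s pderiv_mult)
  then have "r dvd r * pderiv s + s * pderiv r" using r(3) by simp
  then have "r dvd s * pderiv r" by (subst (asm) dvd_add_right_iff) simp_all
  then have "r dvd s \<or> r dvd pderiv r" using prime by (simp add: prime_elem_dvd_mult_iff)
  moreover have "\<not> r dvd pderiv r"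
  proof
    assume "r dvd pderiv r"
    then have "degree r \<le> degree (pderiv r)"
      using irreducible_pderiv_nonzero[OF r(1)] by (rule dvd_imp_degree_le)
    moreover have "degree r \<noteq> 0"
      using r(1) by (auto simp: irreducible_def is_unit_iff_degree)
    moreover have "degree (pderiv r) \<le> degree r - 1" by (rule degree_pderiv_le)
    ultimately show False by simp
  qed
  ultimately show ?thesis by (auto simp: s power2_eq_square)
qed

lemma exists_irreducible_factor:
  fixes p :: "'a::field poly"
  assumes "degree p > 0"
  shows "\<exists>r. irreducible r \<and> r dvd p"
  using assms
proof (induction "degree p" arbitrary: p rule: less_induct)
  case less
  show ?case
  proof (cases "irreducible p")
    case True
    then show ?thesis using dvd_refl by blast
  next
    case False
    have "p \<noteq> 0" using less.prems by auto
    moreover from this have "\<not> is_unit p" using less.prems by (simp add: is_unit_iff_degree)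
    ultimately obtain a b where ab: "p = a * b" "\<not> is_unit a" "\<not> is_unit b"
      using False unfolding irreducible_def by blast
    have nz: "a \<noteq> 0" "b \<noteq> 0" using \<open>p \<noteq> 0\<close> ab by auto
    then have "degree a > 0" "degree b > 0" using ab by (auto simp: is_unit_iff_degree)
    then have "degree a < degree p" using nz ab by (simp add: degree_mult_eq)
    then obtain r where "irreducible r" "r dvd a" using less.hyps[of a] \<open>degree a > 0\<close> by blast
    then show ?thesis using ab(1) dvd_mult2 by blast
  qed
qed

text \<open>
  If \<open>p\<close> divides \<open>V p'\<close> for a nonzero \<open>V\<close> of smaller degree, then \<open>p\<close> and \<open>p'\<close> have a common factor: divide
  \<open>p\<close> and \<open>V\<close> by a common divisor of maximal degree, and take an irreducible factor of what remains of \<open>p\<close>.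
\<close>

lemma repeated_factor_if_syzygy:
  fixes p U V :: "'a::{field,finite} poly"
  assumes eq: "U * p + V * pderiv p = 0" and V: "V \<noteq> 0" "degree V < degree p"
  obtains r where "irreducible r" "r\<^sup>2 dvd p"
proof -
  have p0: "p \<noteq> 0" using V by auto
  define P where "P d \<longleftrightarrow> d dvd p \<and> d dvd V" for d
  have bound: "\<forall>d. P d \<longrightarrow> degree d < Suc (degree p)"
    using dvd_imp_degree_le[OF _ p0] by (auto simp: P_def less_Suc_eq_le)
  have P1: "P 1" by (simp add: P_def)
  obtain d where d: "P d" "\<And>e. P e \<Longrightarrow> degree e \<le> degree d"
    using ex_has_greatest_nat[of P 1 degree, OF P1 bound] by blast
  obtain p1 V1 where p1: "p = d * p1" and V1: "V = d * V1" using d(1) by (auto simp: P_def elim!: dvdE)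
  have nz: "d \<noteq> 0" "p1 \<noteq> 0" "V1 \<noteq> 0" using p0 V p1 V1 by auto
  have "degree V = degree d + degree V1" "degree p = degree d + degree p1"
    using nz by (simp_all add: p1 V1 degree_mult_eq)
  then have "degree p1 > 0" using V(2) by simp
  then obtain r where r: "irreducible r" "r dvd p1" using exists_irreducible_factor by blast
  have "d * (U * p1 + V1 * pderiv p) = 0" using eq by (simp add: V1 algebra_simps) (simp add: p1 algebra_simps)
  then have "V1 * pderiv p = - U * p1" using nz by (simp add: add_eq_0_iff)
  then have "r dvd V1 * pderiv p" using r(2) by simp
  then have "r dvd V1 \<or> r dvd pderiv p"
    using field_poly_irreducible_imp_prime[OF r(1)] by (simp add: prime_elem_dvd_mult_iff)
  \<comment> \<open>Otherwise \<open>d * r\<close> is a common divisor of larger degree.\<close>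
  moreover have "\<not> r dvd V1"
  proof
    assume "r dvd V1"
    then have "P (d * r)" using r(2) by (simp add: P_def p1 V1 mult_dvd_mono)
    then have "degree (d * r) \<le> degree d" by (rule d(2))
    moreover have "r \<noteq> 0" "degree r > 0" using r(1) by (auto simp: irreducible_def is_unit_iff_degree)
    ultimately show False using nz by (simp add: degree_mult_eq)
  qed
  ultimately have "r dvd pderiv p" by blast
  moreover have "r dvd p" using r(2) by (simp add: p1)
  ultimately show ?thesis using repeated_factor_if_dvd_pderiv[OF r(1)] that r(1) by blast
qed

section \<open>The discriminant and syzygies\<close>

lemma coeff_mult_bounded:
  fixes u p :: "'a::comm_semiring_0 poly"
  assumes "\<And>j. j \<ge> m \<Longrightarrow> coeff u j = 0"
  shows "coeff (u * p) k = (\<Sum>j<m. coeff u j * (if j \<le> k then coeff p (k - j) else 0))"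
proof -
  have "coeff (u * p) k = (\<Sum>j\<le>k. coeff u j * coeff p (k - j))" by (rule coeff_mult)
  also have "\<dots> = (\<Sum>j\<in>{..k} \<inter> {..<m}. coeff u j * coeff p (k - j))"
    by (intro sum.mono_neutral_right) (auto simp: assms not_less)
  also have "\<dots> = (\<Sum>j<m. coeff u j * (if j \<le> k then coeff p (k - j) else 0))"
    by (intro sum.mono_neutral_cong_left) auto
  finally show ?thesis .
qed

lemma coeff_mult_top:
  fixes u p :: "'a::comm_semiring_0 poly"
  assumes "degree u \<le> a" "degree p \<le> b"
  shows "coeff (u * p) (a + b) = coeff u a * coeff p b"
proof -
  have "coeff (u * p) (a + b) = (\<Sum>j<Suc a. coeff u j * (if j \<le> a + b then coeff p (a + b - j) else 0))"
    by (rule coeff_mult_bounded) (use assms in \<open>auto intro: coeff_eq_0\<close>)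
  also have "\<dots> = (\<Sum>j<Suc a. if j = a then coeff u a * coeff p b else 0)"
  proof (rule sum.cong)
    fix j assume "j \<in> {..<Suc a}"
    then have "j = a \<or> a + b - j > degree p" using assms(2) by auto
    then show "coeff u j * (if j \<le> a + b then coeff p (a + b - j) else 0) =
        (if j = a then coeff u a * coeff p b else 0)"
      using \<open>j \<in> {..<Suc a}\<close> by (auto simp: coeff_eq_0)
  qed simp
  finally show ?thesis by simp
qed

text \<open>
  The matrix in the definition of \<open>disc n\<close>, for \<open>p = f(x, 1)\<close>: the Sylvester matrix of \<open>p\<close> and \<open>p'\<close> in formal
  degrees \<open>n\<close> and \<open>n - 1\<close> with the factor \<open>coeff p n\<close> removed from the first column. The coefficient of
  \<open>x ^ (n - i) y ^ i\<close> in \<open>f\<close> is \<open>coeff p (n - i)\<close>.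
\<close>

definition disc_mat :: "nat \<Rightarrow> 'a::field poly \<Rightarrow> 'a mat" where
  "disc_mat n p = mat (2 * n - 1) (2 * n - 1) (\<lambda>(row, col).
     let b = (\<lambda>i. if col = 0 then 1 else coeff p (n - i)) in
     if row < n - 1 then (if row \<le> col \<and> col - row \<le> n then b (col - row) else 0)
     else (let k = row - (n - 1) in
       if k \<le> col \<and> col - k \<le> n - 1 then of_nat (n - (col - k)) * b (col - k) else 0))"

lemma disc_eq_det:
  assumes "f \<in> forms n"
  shows "disc n f = (-1) ^ (n * (n - 1) div 2) * det (disc_mat n (dehom f))"
proof -
  have coeffs: "coeff (coeff f i) (n - i) = coeff (dehom f) (n - i)" if "i \<le> n" for i
    using coeff_dehom[OF assms, of "n - i"] that by simp
  have coeffs': "coeff (coeff f i) (n - i) = coeff (dehom f) (n - i)" if "i \<le> n - 1" for i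
    using coeffs that by simp
  have "mat (2 * n - 1) (2 * n - 1) (\<lambda>(r, c).
           if r < n - 1
           then (if r \<le> c \<and> c - r \<le> n then (if c = 0 then 1 else coeff (coeff f (c - r)) (n - (c - r))) else 0)
           else (let k = r - (n - 1) in
                 if k \<le> c \<and> c - k \<le> n - 1
                 then of_nat (n - (c - k)) * (if c = 0 then 1 else coeff (coeff f (c - k)) (n - (c - k))) else 0))
      = disc_mat n (dehom f)"
    unfolding disc_mat_def
  proof (rule cong_mat)
    fix i j
    show "(case (i, j) of (r, c) \<Rightarrow>
           if r < n - 1
           then (if r \<le> c \<and> c - r \<le> n then (if c = 0 then 1 else coeff (coeff f (c - r)) (n - (c - r))) else 0)
           else (let k = r - (n - 1) in
                 if k \<le> c \<and> c - k \<le> n - 1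
                 then of_nat (n - (c - k)) * (if c = 0 then 1 else coeff (coeff f (c - k)) (n - (c - k))) else 0)) =
      (case (i, j) of (r, c) \<Rightarrow>
     let b = (\<lambda>i. if c = 0 then 1 else coeff (dehom f) (n - i)) in
     if r < n - 1 then (if r \<le> c \<and> c - r \<le> n then b (c - r) else 0)
     else (let k = r - (n - 1) in
       if k \<le> c \<and> c - k \<le> n - 1 then of_nat (n - (c - k)) * b (c - k) else 0))"
      unfolding Let_def prod.case using coeffs[of "j - i"] coeffs'[of "j - (i - (n - 1))"]
      by (simp del: diff_diff_right diff_diff_left)
  qed simp_all
  then show ?thesis unfolding disc_def Let_def by simp
qed

text \<open>
  The coefficients of \<open>U\<close> (formal degree \<open>n - 2\<close>) followed by those of \<open>V\<close> (formal degree \<open>n - 1\<close>), from the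
  leading one downwards.
\<close>

definition syz_vec :: "nat \<Rightarrow> 'a::field poly \<Rightarrow> 'a poly \<Rightarrow> 'a vec" where
  "syz_vec n U V = vec (2 * n - 1)
     (\<lambda>i. if i < n - 1 then coeff U (n - 2 - i) else coeff V (n - 1 - (i - (n - 1))))"

text \<open>
  The transposed Sylvester matrix maps \<open>(U, V)\<close> to the coefficients of \<open>U p + V p'\<close>, starting with that of
  \<open>x ^ (2 n - 2)\<close>. That top coefficient is \<open>coeff p n * (coeff U (n - 2) + n * coeff V (n - 1))\<close>; in the
  modified matrix the factor \<open>coeff p n\<close> disappears.
\<close>

lemma disc_mat_syz_vec:
  assumes n: "n \<ge> 2" and p: "degree p \<le> n" and U: "degree U \<le> n - 2" and V: "degree V \<le> n - 1"
    and l: "l < 2 * n - 1"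
  shows "(transpose_mat (disc_mat n p) *\<^sub>v syz_vec n U V) $ l =
    (if l = 0 then coeff U (n - 2) + of_nat n * coeff V (n - 1)
     else coeff (U * p + V * pderiv p) (2 * n - 2 - l))"
proof -
  let ?M = "disc_mat n p" and ?v = "syz_vec n U V"
  have mem: "x < 2 * n - 1 \<longleftrightarrow> x < n - 1 \<or> (\<exists>k<n. x = k + (n - 1))" for x
  proof (cases "x < n - 1")
    case False
    show ?thesis
    proof
      assume "x < 2 * n - 1"
      then have "x - (n - 1) < n" "x = (x - (n - 1)) + (n - 1)" using False by linarith+
      then show "x < n - 1 \<or> (\<exists>k<n. x = k + (n - 1))" by (intro disjI2 exI conjI)
    next
      assume "x < n - 1 \<or> (\<exists>k<n. x = k + (n - 1))"
      then show "x < 2 * n - 1" by (elim disjE exE conjE) linarith+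
    qed
  qed linarith
  have split: "{0..<2 * n - 1} = {..<n - 1} \<union> (\<lambda>k. k + (n - 1)) ` {..<n}"
    "{..<n - 1} \<inter> (\<lambda>k. k + (n - 1)) ` {..<n} = {}"
  proof -
    show "{0..<2 * n - 1} = {..<n - 1} \<union> (\<lambda>k. k + (n - 1)) ` {..<n}"
    proof (rule Set.set_eqI)
      fix x
      have "x \<in> {..<n - 1} \<union> (\<lambda>k. k + (n - 1)) ` {..<n} \<longleftrightarrow> x < n - 1 \<or> (\<exists>k<n. x = k + (n - 1))"
        by (simp only: Un_iff lessThan_iff image_iff Bex_def)
      then show "x \<in> {0..<2 * n - 1} \<longleftrightarrow> x \<in> {..<n - 1} \<union> (\<lambda>k. k + (n - 1)) ` {..<n}"
        using mem[of x] by (simp only: atLeastLessThan_iff le0 simp_thms)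
    qed
  qed auto
  obtain N where N: "n = Suc N" using n by (cases n) auto
  have "(transpose_mat ?M *\<^sub>v ?v) $ l = (\<Sum>i\<in>{0..<2 * n - 1}. ?M $$ (i, l) * ?v $ i)"
    using l by (simp add: scalar_prod_def disc_mat_def syz_vec_def)
  also have "\<dots> = (\<Sum>i<n - 1. ?M $$ (i, l) * ?v $ i) + (\<Sum>k<n. ?M $$ (k + (n - 1), l) * ?v $ (k + (n - 1)))"
    unfolding split(1)
  proof (subst sum.union_disjoint)
    have "inj_on (\<lambda>k. k + (n - 1)) {..<n}" by (simp add: inj_on_def)
    then show "(\<Sum>i<n - 1. ?M $$ (i, l) * ?v $ i) +
        (\<Sum>i\<in>(\<lambda>k. k + (n - 1)) ` {..<n}. ?M $$ (i, l) * ?v $ i) =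
        (\<Sum>i<n - 1. ?M $$ (i, l) * ?v $ i) + (\<Sum>k<n. ?M $$ (k + (n - 1), l) * ?v $ (k + (n - 1)))"
      by (simp only: sum.reindex o_def)
  qed (use split(2) in simp_all)
  also have "(\<Sum>i<n - 1. ?M $$ (i, l) * ?v $ i) =
      (if l = 0 then coeff U (n - 2) else coeff (U * p) (2 * n - 2 - l))"
  proof (cases "l = 0")
    case True
    have "(\<Sum>i<n - 1. ?M $$ (i, l) * ?v $ i) = (\<Sum>i<n - 1. if i = 0 then coeff U (n - 2) else 0)"
      by (intro sum.cong) (use True n in \<open>auto simp: disc_mat_def syz_vec_def numeral_2_eq_2\<close>)
    then show ?thesis using True n by simp
  next
    case False
    have "coeff (U * p) (2 * n - 2 - l) = (\<Sum>j<n - 1. coeff U j *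
        (if j \<le> 2 * n - 2 - l then coeff p (2 * n - 2 - l - j) else 0))"
      by (rule coeff_mult_bounded) (use U n in \<open>auto intro!: coeff_eq_0\<close>)
    also have "\<dots> = (\<Sum>i<n - 1. coeff U (n - 1 - Suc i) *
        (if n - 1 - Suc i \<le> 2 * n - 2 - l then coeff p (2 * n - 2 - l - (n - 1 - Suc i)) else 0))"
      by (rule sum.nat_diff_reindex[symmetric])
    also have "\<dots> = (\<Sum>i<n - 1. ?M $$ (i, l) * ?v $ i)"
    proof (rule sum.cong)
      fix i assume "i \<in> {..<n - 1}"
      then have i: "i < n - 1" by simp
      have e: "n - 1 - Suc i = n - 2 - i" by simp
      have M: "?M $$ (i, l) = (if i \<le> l \<and> l - i \<le> n then coeff p (n - (l - i)) else 0)"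
        using i l False by (simp add: disc_mat_def)
      have v: "?v $ i = coeff U (n - 2 - i)" using i by (simp add: syz_vec_def)
      have "(if n - 2 - i \<le> 2 * n - 2 - l then coeff p (2 * n - 2 - l - (n - 2 - i)) else 0) = ?M $$ (i, l)"
      proof (cases "i \<le> l")
        case True
        then have "2 * n - 2 - l - (n - 2 - i) = n - (l - i)" if "l - i \<le> n" using that i by linarith
        moreover have "n - 2 - i \<le> 2 * n - 2 - l \<longleftrightarrow> l - i \<le> n" using True i l by linarith
        ultimately show ?thesis using True M by auto
      next
        case False
        then have "2 * n - 2 - l - (n - 2 - i) > n" using i by linarith
        then show ?thesis using False M p by (auto intro: coeff_eq_0)
      qed
      then show "coeff U (n - 1 - Suc i) *
        (if n - 1 - Suc i \<le> 2 * n - 2 - l then coeff p (2 * n - 2 - l - (n - 1 - Suc i)) else 0) =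
        ?M $$ (i, l) * ?v $ i" unfolding e v by (simp only: mult.commute)
    qed simp
    finally show ?thesis using False by simp
  qed
  also have "(\<Sum>k<n. ?M $$ (k + (n - 1), l) * ?v $ (k + (n - 1))) =
      (if l = 0 then of_nat n * coeff V (n - 1) else coeff (V * pderiv p) (2 * n - 2 - l))"
  proof (cases "l = 0")
    case True
    have "(\<Sum>k<n. ?M $$ (k + (n - 1), l) * ?v $ (k + (n - 1))) =
        (\<Sum>k<n. if k = 0 then of_nat n * coeff V (n - 1) else 0)"
      by (intro sum.cong) (use True n in \<open>auto simp: disc_mat_def syz_vec_def\<close>)
    then show ?thesis using True n by simp
  next
    case False
    have "coeff (V * pderiv p) (2 * n - 2 - l) = (\<Sum>j<n. coeff V j *
        (if j \<le> 2 * n - 2 - l then coeff (pderiv p) (2 * n - 2 - l - j) else 0))"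
      by (rule coeff_mult_bounded) (use V n in \<open>auto intro!: coeff_eq_0\<close>)
    also have "\<dots> = (\<Sum>k<n. coeff V (n - Suc k) *
        (if n - Suc k \<le> 2 * n - 2 - l then coeff (pderiv p) (2 * n - 2 - l - (n - Suc k)) else 0))"
      by (rule sum.nat_diff_reindex[symmetric])
    also have "\<dots> = (\<Sum>k<n. ?M $$ (k + (n - 1), l) * ?v $ (k + (n - 1)))"
    proof (rule sum.cong)
      fix k assume "k \<in> {..<n}"
      then have k: "k < n" by simp
      have e: "n - 1 - k = n - Suc k" by simp
      have M: "?M $$ (k + (n - 1), l) =
          (if k \<le> l \<and> l - k \<le> n - 1 then of_nat (n - (l - k)) * coeff p (n - (l - k)) else 0)"
        using k l False unfolding N by (simp add: disc_mat_def)
      have v: "?v $ (k + (n - 1)) = coeff V (n - Suc k)" using k unfolding N by (simp add: syz_vec_def)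
      have "(if n - Suc k \<le> 2 * n - 2 - l then coeff (pderiv p) (2 * n - 2 - l - (n - Suc k)) else 0) =
          ?M $$ (k + (n - 1), l)"
      proof (cases "k \<le> l")
        case True
        then have "Suc (2 * n - 2 - l - (n - Suc k)) = n - (l - k)" if "l - k \<le> n - 1"
          using that k n by linarith
        moreover have "n - Suc k \<le> 2 * n - 2 - l \<longleftrightarrow> l - k \<le> n - 1" using True k l by linarith
        ultimately show ?thesis using True M by (auto simp: coeff_pderiv simp del: of_nat_Suc)
      next
        case False
        then have "Suc (2 * n - 2 - l - (n - Suc k)) > n" using k by linarith
        then show ?thesis using False M p by (auto simp: coeff_pderiv coeff_eq_0)
      qed
      then show "coeff V (n - Suc k) *
        (if n - Suc k \<le> 2 * n - 2 - l then coeff (pderiv p) (2 * n - 2 - l - (n - Suc k)) else 0) =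
        ?M $$ (k + (n - 1), l) * ?v $ (k + (n - 1))" unfolding v by (simp only: mult.commute)
    qed simp
    finally show ?thesis using False by simp
  qed
  finally show ?thesis by simp
qed

text \<open>
  The condition \<open>coeff U (n - 2) + n * coeff V (n - 1) = 0\<close> follows from \<open>U p + V p' = 0\<close> if \<open>p\<close> has degree \<open>n\<close>;
  otherwise it accounts for the behaviour of \<open>f\<close> at the point at infinity \<open>y = 0\<close>.
\<close>

lemma disc_eq_0_iff_syzygy:
  assumes n: "n \<ge> 2" and f: "f \<in> forms n"
  defines "p \<equiv> dehom f"
  shows "disc n f = 0 \<longleftrightarrow> (\<exists>U V. (U \<noteq> 0 \<or> V \<noteq> 0) \<and> degree U \<le> n - 2 \<and> degree V \<le> n - 1 \<and>
    U * p + V * pderiv p = 0 \<and> coeff U (n - 2) + of_nat n * coeff V (n - 1) = 0)"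
    (is "_ \<longleftrightarrow> (\<exists>U V. ?R U V)")
proof -
  let ?m = "2 * n - 1" and ?M = "disc_mat n p"
  have p: "degree p \<le> n" unfolding p_def by (rule degree_dehom_le[OF f])
  have M: "?M \<in> carrier_mat ?m ?m" by (simp add: disc_mat_def)
  have vanish: "transpose_mat ?M *\<^sub>v syz_vec n U V = 0\<^sub>v ?m \<longleftrightarrow>
      U * p + V * pderiv p = 0 \<and> coeff U (n - 2) + of_nat n * coeff V (n - 1) = 0"
    if U: "degree U \<le> n - 2" and V: "degree V \<le> n - 1" for U V
  proof -
    have dim: "dim_vec (transpose_mat ?M *\<^sub>v syz_vec n U V) = ?m" by (simp add: disc_mat_def)
    have dp: "degree (pderiv p) \<le> n - 1" using degree_pderiv_le[of p] p by simp
    have e: "n - 2 + n = 2 * n - 2" "n - 1 + (n - 1) = 2 * n - 2" using n by linarith+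
    have "coeff (U * p + V * pderiv p) (2 * n - 2) =
        coeff U (n - 2) * coeff p n + coeff V (n - 1) * coeff (pderiv p) (n - 1)"
      using coeff_mult_top[OF U p] coeff_mult_top[OF V dp] unfolding e by simp
    also have "\<dots> = coeff p n * (coeff U (n - 2) + of_nat n * coeff V (n - 1))"
      using n by (simp add: coeff_pderiv algebra_simps of_nat_diff)
    finally have top: "coeff (U * p + V * pderiv p) (2 * n - 2) =
      coeff p n * (coeff U (n - 2) + of_nat n * coeff V (n - 1))" .
    have deg: "degree (U * p + V * pderiv p) \<le> 2 * n - 2"
      using degree_mult_le[of U p] degree_mult_le[of V "pderiv p"] U V p dp n
      by (intro degree_add_le) linarith+
    show ?thesis
    proof
      assume 0: "transpose_mat ?M *\<^sub>v syz_vec n U V = 0\<^sub>v ?m"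
      have l: "(if l = 0 then coeff U (n - 2) + of_nat n * coeff V (n - 1)
          else coeff (U * p + V * pderiv p) (2 * n - 2 - l)) = 0" if "l < ?m" for l
        using disc_mat_syz_vec[OF n p U V that] that unfolding 0 by simp
      have c0: "coeff U (n - 2) + of_nat n * coeff V (n - 1) = 0" using l[of 0] n by simp
      have "coeff (U * p + V * pderiv p) k = 0" for k
      proof -
        consider "k > 2 * n - 2" | "k = 2 * n - 2" | "k < 2 * n - 2" by linarith
        then show ?thesis
        proof cases
          case 1 then show ?thesis using deg by (intro coeff_eq_0) linarith
        next
          case 2 then show ?thesis using top c0 by simp
        next
          case 3
          then have "2 * n - 2 - k < ?m" "2 * n - 2 - k \<noteq> 0" "2 * n - 2 - (2 * n - 2 - k) = k" by linarith+
          then show ?thesis using l[of "2 * n - 2 - k"] by simp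
        qed
      qed
      then show "U * p + V * pderiv p = 0 \<and> coeff U (n - 2) + of_nat n * coeff V (n - 1) = 0"
        using c0 by (simp add: poly_eq_iff)
    next
      assume *: "U * p + V * pderiv p = 0 \<and> coeff U (n - 2) + of_nat n * coeff V (n - 1) = 0"
      show "transpose_mat ?M *\<^sub>v syz_vec n U V = 0\<^sub>v ?m"
      proof (rule eq_vecI)
        fix i assume "i < dim_vec (0\<^sub>v ?m :: 'a vec)"
        then have "i < ?m" by simp
        then show "(transpose_mat ?M *\<^sub>v syz_vec n U V) $ i = 0\<^sub>v ?m $ i"
          using disc_mat_syz_vec[OF n p U V] * by simp
      qed (use dim in simp)
    qed
  qed
  have "disc n f = 0 \<longleftrightarrow> det (transpose_mat ?M) = 0"
    unfolding disc_eq_det[OF f] p_def[symmetric] using det_transpose[OF M] by simp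
  also have "\<dots> \<longleftrightarrow> (\<exists>v. v \<in> carrier_vec ?m \<and> v \<noteq> 0\<^sub>v ?m \<and> transpose_mat ?M *\<^sub>v v = 0\<^sub>v ?m)"
    using M by (intro det_0_iff_vec_prod_zero_field) simp
  also have "\<dots> \<longleftrightarrow> (\<exists>U V. ?R U V)"
  proof
    assume "\<exists>v. v \<in> carrier_vec ?m \<and> v \<noteq> 0\<^sub>v ?m \<and> transpose_mat ?M *\<^sub>v v = 0\<^sub>v ?m"
    then obtain v where v: "v \<in> carrier_vec ?m" "v \<noteq> 0\<^sub>v ?m" "transpose_mat ?M *\<^sub>v v = 0\<^sub>v ?m" by blast
    define U where "U = (\<Sum>j<n - 1. monom (v $ (n - 2 - j)) j)"
    define V where "V = (\<Sum>j<n. monom (v $ (2 * n - 2 - j)) j)"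
    have cU: "coeff U j = (if j < n - 1 then v $ (n - 2 - j) else 0)" for j
      by (simp add: U_def coeff_sum)
    have cV: "coeff V j = (if j < n then v $ (2 * n - 2 - j) else 0)" for j
      by (simp add: V_def coeff_sum)
    have U: "degree U \<le> n - 2" by (rule degree_le) (use n in \<open>auto simp: cU\<close>)
    have V: "degree V \<le> n - 1" by (rule degree_le) (use n in \<open>auto simp: cV\<close>)
    have "syz_vec n U V = v"
    proof (rule eq_vecI)
      fix i assume "i < dim_vec v"
      then have i: "i < ?m" using v by simp
      show "syz_vec n U V $ i = v $ i"
      proof (cases "i < n - 1")
        case True
        then have "n - 2 - (n - 2 - i) = i" "n - 2 - i < n - 1" by linarith+
        then show ?thesis using True i by (simp add: syz_vec_def cU)
      next
        case False
        then have "2 * n - 2 - (n - 1 - (i - (n - 1))) = i" "n - 1 - (i - (n - 1)) < n" using i by linarith+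
        then show ?thesis using False i by (simp add: syz_vec_def cV)
      qed
    qed (use v in \<open>simp add: syz_vec_def\<close>)
    then have "U * p + V * pderiv p = 0 \<and> coeff U (n - 2) + of_nat n * coeff V (n - 1) = 0"
      using vanish[OF U V] v by simp
    moreover have "U \<noteq> 0 \<or> V \<noteq> 0"
    proof (rule ccontr)
      assume "\<not> (U \<noteq> 0 \<or> V \<noteq> 0)"
      then have "syz_vec n U V = 0\<^sub>v ?m" by (intro eq_vecI) (auto simp: syz_vec_def)
      then show False using v \<open>syz_vec n U V = v\<close> by simp
    qed
    ultimately show "\<exists>U V. ?R U V" using U V by blast
  next
    assume "\<exists>U V. ?R U V"
    then obtain U V where UV: "?R U V" by blast
    have nz: "syz_vec n U V \<noteq> 0\<^sub>v ?m"
    proof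
      assume 0: "syz_vec n U V = 0\<^sub>v ?m"
      have "coeff U j = 0" for j
      proof (cases "j \<le> n - 2")
        case True
        then have "n - 2 - (n - 2 - j) = j" "n - 2 - j < n - 1" "n - 2 - j < ?m" using n by linarith+
        then show ?thesis using arg_cong[OF 0, of "\<lambda>v. v $ (n - 2 - j)"] by (simp add: syz_vec_def)
      next
        case False
        then show ?thesis using UV by (intro coeff_eq_0) linarith
      qed
      moreover have "coeff V j = 0" for j
      proof (cases "j \<le> n - 1")
        case True
        then have "n - 1 - (2 * n - 2 - j - (n - 1)) = j" "\<not> 2 * n - 2 - j < n - 1" "2 * n - 2 - j < ?m"
          using n by linarith+
        then show ?thesis using arg_cong[OF 0, of "\<lambda>v. v $ (2 * n - 2 - j)"] by (simp add: syz_vec_def)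
      next
        case False
        then show ?thesis using UV by (intro coeff_eq_0) linarith
      qed
      ultimately show False using UV by (auto simp: poly_eq_iff)
    qed
    show "\<exists>v. v \<in> carrier_vec ?m \<and> v \<noteq> 0\<^sub>v ?m \<and> transpose_mat ?M *\<^sub>v v = 0\<^sub>v ?m"
      by (intro exI[of _ "syz_vec n U V"] conjI nz)
        (use vanish[of U V] UV in \<open>auto simp: syz_vec_def\<close>)
  qed
  finally show ?thesis .
qed

section \<open>Discriminant and repeated factors of quintics\<close>

lemma square_dvd_homog:
  assumes f: "f \<in> forms 5" and r: "r\<^sup>2 dvd dehom f" "degree r \<le> 2" and nz: "dehom f \<noteq> 0"
  shows "(homog (degree r) r)\<^sup>2 dvd f"
proof -
  obtain s where s: "dehom f = r\<^sup>2 * s" using r(1) by (auto elim: dvdE)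
  then have rs: "r \<noteq> 0" "s \<noteq> 0" using nz by auto
  then have "degree (dehom f) = 2 * degree r + degree s"
    by (simp add: s degree_mult_eq degree_power_eq)
  then have ds: "degree s \<le> 5 - 2 * degree r" "2 * degree r \<le> 5" using degree_dehom_le[OF f] by auto
  have "(homog (degree r) r)\<^sup>2 \<in> forms (2 * degree r)" by (rule forms_power[OF homog_forms]) simp
  then have "(homog (degree r) r)\<^sup>2 * homog (5 - 2 * degree r) s \<in> forms 5"
    using ds by (intro forms_mult'[OF _ homog_forms]) auto
  then have "f = (homog (degree r) r)\<^sup>2 * homog (5 - 2 * degree r) s"
    using f by (intro dehom_inj[of f 5]) (use ds s in auto)
  then show ?thesis by simp
qed

lemma homog_irreducible_quadratic:
  assumes "irreducible r" "degree r = 2"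
  shows "irreducible (homog 2 r)"
proof (rule irreducible_formI[OF homog_forms])
  have d: "dehom (homog 2 r) = r" using assms by simp
  show "homog 2 r \<noteq> 0" using d assms(2) by (metis dehom_0 degree_0 zero_neq_numeral)
  fix u v i j assume uv: "u \<in> forms i" "v \<in> forms j" "homog 2 r = u * v" "i + j = 2"
  have r: "r = dehom u * dehom v" using d uv(3) by simp
  then have nz: "dehom u \<noteq> 0" "dehom v \<noteq> 0" using assms by (auto simp: irreducible_def)
  have "is_unit (dehom u) \<or> is_unit (dehom v)" using assms(1) r irreducibleD by blast
  then have "degree (dehom u) = 0 \<or> degree (dehom v) = 0" using nz by (auto simp: is_unit_iff_degree)
  moreover have "degree (dehom u) + degree (dehom v) = 2" using assms(2) nz by (simp add: r degree_mult_eq)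
  ultimately have "degree (dehom u) = 2 \<or> degree (dehom v) = 2" by auto
  then have "i \<ge> 2 \<or> j \<ge> 2" using degree_dehom_le[OF uv(1)] degree_dehom_le[OF uv(2)] by auto
  then show "i = 0 \<or> j = 0" using uv(4) by auto
qed simp

lemma Y_square_dvd:
  assumes f: "f \<in> forms 5" and d: "degree (dehom f) \<le> 3"
  shows "Y\<^sup>2 dvd f"
proof -
  have "Y\<^sup>2 * homog 3 (dehom f) \<in> forms 5"
    by (intro forms_mult'[OF forms_power[OF Y_forms refl] homog_forms]) simp
  then have "f = Y\<^sup>2 * homog 3 (dehom f)"
    using f by (intro dehom_inj[of f 5]) (use d in auto)
  then show ?thesis by (metis dvd_triv_left)
qed

lemma singular_formI:
  assumes "l \<in> forms n" "l \<noteq> 0" "l\<^sup>2 dvd f" "n = 1 \<or> n = 2 \<and> irreducible l"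
  shows "singular_form f"
proof -
  obtain c r where r: "c \<noteq> 0" "r \<in> nforms n" "l = scale c r" using nforms_exists[OF assms(1,2)] .
  have dvd: "r\<^sup>2 dvd f" using assms(3) r by (simp add: scale_power)
  show ?thesis
  proof (cases "n = 1")
    case True
    then show ?thesis using dvd r unfolding singular_form_def by blast
  next
    case False
    then have n: "n = 2" "irreducible l" using assms(4) by auto
    have "r = scale (1 / c) l" using r by simp
    then have "irreducible r" using irreducible_scale[OF _ n(2), of "1 / c"] r(1) by simp
    then show ?thesis using dvd r n unfolding singular_form_def by blast
  qed
qed

text \<open>
  If \<open>p = s\<^sup>2 t\<close>, then \<open>p' = s (2 s' t + s t')\<close>, so \<open>V = s t\<close> and \<open>U = - (2 s' t + s t')\<close> satisfy
  \<open>U p + V p' = 0\<close>.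
\<close>

lemma syzygy_if_repeated_factor:
  fixes p s :: "'a::{field,finite} poly"
  assumes p: "p \<noteq> 0" and s: "degree s > 0" "s\<^sup>2 dvd p"
  obtains U V where "V \<noteq> 0" "U * p + V * pderiv p = 0" "degree V \<le> degree p - 1" "degree U \<le> degree p - 2"
proof -
  obtain t where t: "p = s\<^sup>2 * t" using s(2) by (auto elim: dvdE)
  define U where "U = - (2 * pderiv s * t + s * pderiv t)"
  define V where "V = s * t"
  have nz: "s \<noteq> 0" "t \<noteq> 0" using p t by auto
  have dp: "degree p = 2 * degree s + degree t" using nz by (simp add: t degree_mult_eq degree_power_eq)
  have "pderiv p = s * (2 * pderiv s * t + s * pderiv t)"
    by (simp add: t pderiv_mult power2_eq_square algebra_simps)
  then have eq: "U * p + V * pderiv p = 0" by (simp add: U_def V_def t power2_eq_square algebra_simps)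
  have dV: "degree V = degree s + degree t" using nz by (simp add: V_def degree_mult_eq)
  have "degree (pderiv s * t) \<le> degree s - 1 + degree t"
    using degree_mult_le[of "pderiv s" t] degree_pderiv_le[of s] by linarith
  moreover have "degree (2 * pderiv s * t) \<le> degree (pderiv s * t)"
    by (metis degree_add_le mult.assoc mult_2 order_refl)
  moreover have "degree (s * pderiv t) \<le> degree s - 1 + degree t"
  proof (cases "degree t = 0")
    case True
    then have "pderiv t = 0" by (elim degree_eq_zeroE) simp
    then show ?thesis by simp
  next
    case False
    then show ?thesis using degree_mult_le[of s "pderiv t"] degree_pderiv_le[of t] s(1) by linarith
  qed
  ultimately have "degree (2 * pderiv s * t + s * pderiv t) \<le> degree s - 1 + degree t"
    by (intro degree_add_le) linarith+
  then have "degree U \<le> degree p - 2" using s(1) unfolding U_def degree_minus dp by linarith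
  moreover have "V \<noteq> 0" using nz by (simp add: V_def)
  moreover have "degree V \<le> degree p - 1" using s(1) unfolding dV dp by linarith
  ultimately show ?thesis using that eq by blast
qed

text \<open>
  Let \<open>p = f(x, 1)\<close>. If \<open>p\<close> has degree at most \<open>3\<close>, then \<open>y\<^sup>2\<close> divides \<open>f\<close>, and \<open>(U, V) = (- p', p)\<close> shows that the
  discriminant vanishes (for \<open>p = 0\<close> one takes \<open>(1, 0)\<close>). If \<open>p\<close> has degree \<open>4\<close> or \<open>5\<close>, then \<open>y\<^sup>2\<close> does not divide \<open>f\<close>, and repeated factors
  of \<open>f\<close> correspond to those of \<open>p\<close>.
\<close>

lemma disc_eq_0_iff_singular:
  fixes f :: "'a::{field,finite} binpoly"
  assumes f: "f \<in> forms 5"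
  shows "disc 5 f = 0 \<longleftrightarrow> singular_form f"
proof -
  define p where "p = dehom f"
  have deg5: "degree p \<le> 5" unfolding p_def by (rule degree_dehom_le[OF f])
  have iff: "disc 5 f = 0 \<longleftrightarrow> (\<exists>U V. (U \<noteq> 0 \<or> V \<noteq> 0) \<and> degree U \<le> 3 \<and> degree V \<le> 4 \<and>
    U * p + V * pderiv p = 0 \<and> coeff U 3 + of_nat 5 * coeff V 4 = 0)"
    using disc_eq_0_iff_syzygy[OF _ f] unfolding p_def by simp
  have Y: "Y \<in> forms 1" "(Y :: 'a binpoly) \<noteq> 0" by (rule Y_forms) (simp add: Y_def)
  show ?thesis
  proof (cases "degree p \<le> 3")
    case True
    have "singular_form f"
      using singular_formI[OF Y(1,2) Y_square_dvd[OF f]] True by (simp add: p_def)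
    moreover have "disc 5 f = 0"
    proof (cases "p = 0")
      case True
      then show ?thesis unfolding iff by (intro exI[of _ 1] exI[of _ 0]) (simp add: coeff_1)
    next
      case False
      have dp: "degree (pderiv p) \<le> 2" using degree_pderiv_le[of p] True by linarith
      then have "coeff (pderiv p) 3 = 0" "coeff p 4 = 0" using True by (auto intro!: coeff_eq_0)
      then show ?thesis unfolding iff using False True dp
        by (intro exI[of _ "- pderiv p"] exI[of _ p]) (simp add: mult.commute)
    qed
    ultimately show ?thesis by simp
  next
    case False
    then have p0: "p \<noteq> 0" by auto
    show ?thesis
    proof
      assume "disc 5 f = 0"
      then obtain U V where UV: "U \<noteq> 0 \<or> V \<noteq> 0" "degree U \<le> 3" "degree V \<le> 4"
        "U * p + V * pderiv p = 0" "coeff U 3 + of_nat 5 * coeff V 4 = 0" unfolding iff by blast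
      have V: "V \<noteq> 0" using UV p0 by auto
      \<comment> \<open>In degree \<open>4\<close>, the coefficient of \<open>x ^ 7\<close> in the syzygy gives \<open>U\<^sub>3 + 4 V\<^sub>4 = 0\<close>; with
        \<open>U\<^sub>3 + 5 V\<^sub>4 = 0\<close> this yields \<open>V\<^sub>4 = 0\<close>.\<close>
      have "degree V < degree p"
      proof (cases "degree p = 5")
        case True
        then show ?thesis using UV by simp
      next
        case False
        then have d4: "degree p = 4" using \<open>\<not> degree p \<le> 3\<close> deg5 by simp
        have dp: "degree (pderiv p) \<le> 3" using degree_pderiv_le[of p] d4 by simp
        have "coeff (U * p + V * pderiv p) 7 = coeff U 3 * coeff p 4 + coeff V 4 * coeff (pderiv p) 3"
          using coeff_mult_top[OF UV(2), of p 4] coeff_mult_top[OF UV(3) dp] d4 by simp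
        then have "coeff U 3 * coeff p 4 + coeff V 4 * (4 * coeff p 4) = 0"
          using UV(4) by (simp add: coeff_pderiv)
        moreover have "coeff U 3 = - (5 * coeff V 4)" using UV(5) by (simp add: add_eq_0_iff2)
        ultimately have "- (coeff V 4 * coeff p 4) = 0" by (simp add: algebra_simps)
        moreover have "coeff p 4 \<noteq> 0" using d4 p0 by (metis leading_coeff_0_iff)
        ultimately have "coeff V 4 = 0" by simp
        then have "degree V \<noteq> 4" using V by (metis leading_coeff_0_iff)
        then show ?thesis using UV(3) d4 by simp
      qed
      then obtain r where r: "irreducible r" "r\<^sup>2 dvd p" using repeated_factor_if_syzygy UV(4) V by blast
      have r0: "r \<noteq> 0" "degree r > 0" using r(1) by (auto simp: irreducible_def is_unit_iff_degree)
      have "degree (r\<^sup>2) \<le> degree p" using r(2) p0 by (rule dvd_imp_degree_le)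
      then have dr: "degree r \<le> 2" using deg5 r0 by (simp add: degree_power_eq)
      have dvd: "(homog (degree r) r)\<^sup>2 dvd f"
        using square_dvd_homog[OF f _ dr] r(2) p0 unfolding p_def by blast
      have nz: "homog (degree r) r \<noteq> 0" using r0 dehom_homog[of r "degree r"] by (metis dehom_0 order_refl)
      have "degree r = 1 \<or> degree r = 2" using r0 dr by linarith
      then have "degree r = 1 \<or> degree r = 2 \<and> irreducible (homog (degree r) r)"
        using homog_irreducible_quadratic[OF r(1)] by auto
      then show "singular_form f" by (rule singular_formI[OF homog_forms nz dvd])
    next
      assume "singular_form f"
      then obtain s k where s: "s \<in> forms k" "s\<^sup>2 dvd f" "s \<noteq> 0" "k = 1 \<or> k = 2 \<and> irreducible s"
        unfolding singular_form_def using nforms_forms nforms_nonzero by metis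
      have "degree (dehom s) > 0"
      proof (cases "k = 1")
        case True
        have s2: "s\<^sup>2 \<in> forms 2" using forms_power[of s 1 2 2] s True by simp
        obtain g where g: "f = s\<^sup>2 * g" "g \<in> forms (5 - 2)"
          using form_dvdE[OF s(2) f s2] s(3) by auto
        have "degree p \<le> degree ((dehom s)\<^sup>2) + degree (dehom g)"
          unfolding p_def g(1) using degree_mult_le[of "(dehom s)\<^sup>2" "dehom g"] by simp
        moreover have "degree (dehom g) \<le> 3" using degree_dehom_le[OF g(2)] by simp
        ultimately have "degree ((dehom s)\<^sup>2) > 0" using False by linarith
        then show ?thesis using degree_power_le[of "dehom s" 2] by (metis mult_0_right mult_0 not_gr_zero le_zero_eq)
      next
        case False
        then show ?thesis using s irreducible_dehom(1)[of s] by simp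
      qed
      moreover have "(dehom s)\<^sup>2 dvd p" using dehom_dvd[OF s(2)] by (simp add: p_def)
      ultimately obtain U V where UV: "V \<noteq> 0" "U * p + V * pderiv p = 0"
        "degree V \<le> degree p - 1" "degree U \<le> degree p - 2"
        using syzygy_if_repeated_factor[OF p0] by metis
      have d: "degree U \<le> 3" "degree V \<le> 4" using UV(3,4) deg5 by linarith+
      have dp: "degree (pderiv p) \<le> 4" using degree_pderiv_le[of p] deg5 by simp
      have "coeff U 3 + of_nat 5 * coeff V 4 = 0"
      proof (cases "degree p = 5")
        case True
        have "coeff (U * p + V * pderiv p) 8 = coeff U 3 * coeff p 5 + coeff V 4 * coeff (pderiv p) 4"
          using coeff_mult_top[OF d(1) deg5] coeff_mult_top[OF d(2) dp] by simp
        then have "coeff p 5 * (coeff U 3 + of_nat 5 * coeff V 4) = 0"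
          using UV(2) by (simp add: coeff_pderiv algebra_simps)
        moreover have "coeff p 5 \<noteq> 0" using True p0 by (metis leading_coeff_0_iff)
        ultimately show ?thesis by simp
      next
        case False
        then have "degree U < 3" "degree V < 4" using UV(3,4) deg5 \<open>\<not> degree p \<le> 3\<close> by linarith+
        then show ?thesis by (simp add: coeff_eq_0)
      qed
      then show "disc 5 f = 0" unfolding iff using UV d by blast
    qed
  qed
qed

section \<open>The Fourier transform\<close>

text \<open>
  The sieve writes the indicator function of the forms of discriminant zero as a combination of indicator
  functions of the spaces of multiples of \<open>l\<^sup>2\<close> and \<open>r\<^sup>2\<close>, which have \<open>q ^ 4\<close> and \<open>q\<^sup>2\<close> elements. The character
  \<open>f \<mapsto> \<psi> (w f)\<close> sums to zero over such a space unless it is trivial there, i.e. unless \<open>l\<^sup>2\<close>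
  or \<open>r\<^sup>2\<close> is apolar to \<open>w\<close>.
\<close>

lemma Phi_hat_formula:
  fixes \<psi> :: "'a::{field,finite} \<Rightarrow> complex"
  assumes \<psi>: "nontrivial_additive_character \<psi>" and w: "w \<in> dual_forms 5"
  defines "q \<equiv> of_nat CARD('a)"
  shows "Phi_hat \<psi> w =
    of_nat (card {l \<in> nforms 1. l\<^sup>2 \<in> apolar_ideal 5 w}) / q ^ 2 + C w / q ^ 4"
proof -
  have q0: "q \<noteq> 0" by (simp add: q_def)
  let ?V = "forms 5 :: 'a binpoly set" and ?L = "nforms 1 :: 'a binpoly set" and ?R = "nforms 2 :: 'a binpoly set"
  let ?e = "\<lambda>r :: 'a binpoly. eps (cls 2 r)"
  have "(\<Sum>f | f \<in> ?V \<and> disc 5 f = 0. \<psi> (w f)) = (\<Sum>f\<in>?V. if disc 5 f = 0 then \<psi> (w f) else 0)"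
    by (simp add: sum.inter_filter)
  also have "\<dots> = (\<Sum>f\<in>?V. (of_nat (card {l \<in> ?L. l\<^sup>2 dvd f}) - (\<Sum>r | r \<in> ?R \<and> r\<^sup>2 dvd f. ?e r)) * \<psi> (w f))"
  proof (rule sum.cong)
    fix f assume "f \<in> ?V"
    then show "(if disc 5 f = 0 then \<psi> (w f) else 0) =
        (of_nat (card {l \<in> ?L. l\<^sup>2 dvd f}) - (\<Sum>r | r \<in> ?R \<and> r\<^sup>2 dvd f. ?e r)) * \<psi> (w f)"
      unfolding disc_eq_0_iff_singular[OF \<open>f \<in> ?V\<close>] square_sieve[OF \<open>f \<in> ?V\<close>] by simp
  qed simp
  also have "\<dots> = (\<Sum>f\<in>?V. \<Sum>l | l \<in> ?L \<and> l\<^sup>2 dvd f. \<psi> (w f)) -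
      (\<Sum>f\<in>?V. \<Sum>r | r \<in> ?R \<and> r\<^sup>2 dvd f. ?e r * \<psi> (w f))"
    by (simp add: left_diff_distrib sum_subtractf sum_distrib_right)
  also have "(\<Sum>f\<in>?V. \<Sum>l | l \<in> ?L \<and> l\<^sup>2 dvd f. \<psi> (w f)) =
      (\<Sum>l\<in>?L. \<Sum>f | f \<in> ?V \<and> l\<^sup>2 dvd f. \<psi> (w f))"
    by (rule sum.swap_restrict) simp_all
  also have "\<dots> = (\<Sum>l\<in>?L. if l\<^sup>2 \<in> apolar_ideal 5 w then q ^ 4 else 0)"
  proof (rule sum.cong)
    fix l assume l: "l \<in> ?L"
    have "l\<^sup>2 \<in> forms 2" using forms_power[OF nforms_forms[OF l], of 2 2] by simp
    then show "(\<Sum>f | f \<in> ?V \<and> l\<^sup>2 dvd f. \<psi> (w f)) = (if l\<^sup>2 \<in> apolar_ideal 5 w then q ^ 4 else 0)"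
      using sum_multiples[OF \<psi> w, of "l\<^sup>2" 2 3] nforms_nonzero[OF l] by (simp add: q_def eval_nat_numeral)
  qed simp
  also have "\<dots> = q ^ 4 * of_nat (card {l \<in> ?L. l\<^sup>2 \<in> apolar_ideal 5 w})"
    by (simp add: sum.inter_filter[symmetric])
  also have "(\<Sum>f\<in>?V. \<Sum>r | r \<in> ?R \<and> r\<^sup>2 dvd f. ?e r * \<psi> (w f)) =
      (\<Sum>r\<in>?R. \<Sum>f | f \<in> ?V \<and> r\<^sup>2 dvd f. ?e r * \<psi> (w f))"
    by (rule sum.swap_restrict) simp_all
  also have "\<dots> = (\<Sum>r\<in>?R. if r\<^sup>2 \<in> apolar_ideal 5 w then q ^ 2 * ?e r else 0)"
  proof (rule sum.cong)
    fix r assume r: "r \<in> ?R"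
    have "r\<^sup>2 \<in> forms 4" using forms_power[OF nforms_forms[OF r], of 4 2] by simp
    then show "(\<Sum>f | f \<in> ?V \<and> r\<^sup>2 dvd f. ?e r * \<psi> (w f)) =
        (if r\<^sup>2 \<in> apolar_ideal 5 w then q ^ 2 * ?e r else 0)"
      using sum_multiples[OF \<psi> w, of "r\<^sup>2" 4 1] nforms_nonzero[OF r]
      by (simp add: q_def eval_nat_numeral sum_distrib_left[symmetric])
  qed simp
  also have "\<dots> = - (q ^ 2 * C w)"
    unfolding C_eq_sum_nforms[OF w] by (simp add: sum.inter_filter[symmetric] sum_distrib_left)
  finally have "Phi_hat \<psi> w =
      (q ^ 4 * of_nat (card {l \<in> ?L. l\<^sup>2 \<in> apolar_ideal 5 w}) + q ^ 2 * C w) / q ^ 6"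
    unfolding Phi_hat_def by (simp add: card_forms q_def eval_nat_numeral)
  then show ?thesis using q0 by (simp add: add_divide_distrib eval_nat_numeral)
qed

section \<open>Kernels and ranks over finite fields\<close>

lemma (in vectorspace) card_carrier_eq_power_dim:
  assumes "fin_dim" "finite (carrier K)"
  shows "card (carrier V) = card (carrier K) ^ dim"
proof -
  obtain B where B: "finite B" "basis B" using finite_basis_exists[OF assms(1)] by blast
  have BV: "B \<subseteq> carrier V" using B(2) unfolding basis_def by blast
  have ex1: "\<exists>!a. a \<in> B \<rightarrow>\<^sub>E carrier K \<and> lincomb a B = v" if "v \<in> carrier V" for v
    using iffD1[OF basis_criterion[OF B(1) BV] B(2)] that by (elim allE impE)
  have "bij_betw (\<lambda>a. lincomb a B) (B \<rightarrow>\<^sub>E carrier K) (carrier V)"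
  proof (rule bij_betw_imageI)
    have closed: "lincomb a B \<in> carrier V" if "a \<in> B \<rightarrow>\<^sub>E carrier K" for a
      by (rule lincomb_closed[OF BV]) (use that in auto)
    show "inj_on (\<lambda>a. lincomb a B) (B \<rightarrow>\<^sub>E carrier K)"
    proof (rule inj_onI)
      fix a b assume ab: "a \<in> B \<rightarrow>\<^sub>E carrier K" "b \<in> B \<rightarrow>\<^sub>E carrier K" "lincomb a B = lincomb b B"
      then show "a = b" using ex1[OF closed[OF ab(1)]] by auto
    qed
    show "(\<lambda>a. lincomb a B) ` (B \<rightarrow>\<^sub>E carrier K) = carrier V"
    proof
      show "(\<lambda>a. lincomb a B) ` (B \<rightarrow>\<^sub>E carrier K) \<subseteq> carrier V" using closed by auto
      show "carrier V \<subseteq> (\<lambda>a. lincomb a B) ` (B \<rightarrow>\<^sub>E carrier K)"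
      proof
        fix v assume "v \<in> carrier V"
        then obtain a where "a \<in> B \<rightarrow>\<^sub>E carrier K" "lincomb a B = v" using ex1[of v] by auto
        then show "v \<in> (\<lambda>a. lincomb a B) ` (B \<rightarrow>\<^sub>E carrier K)" by auto
      qed
    qed
  qed
  then have "card (carrier V) = card (B \<rightarrow>\<^sub>E carrier K)" by (rule bij_betw_same_card[symmetric])
  then show ?thesis using B(1) dim_basis[OF B] by (simp add: card_PiE)
qed

lemma finite_carrier_vec: "finite (carrier_vec n :: 'a::finite vec set)"
  and card_carrier_vec_finite: "card (carrier_vec n :: 'a::finite vec set) = CARD('a) ^ n"
proof -
  have bij: "bij_betw (\<lambda>f. vec n f) ({..<n} \<rightarrow>\<^sub>E (UNIV :: 'a set)) (carrier_vec n)"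
  proof (rule bij_betw_byWitness[where f' = "\<lambda>v. restrict (vec_index v) {..<n}"])
    show "\<forall>f\<in>{..<n} \<rightarrow>\<^sub>E (UNIV :: 'a set). restrict (vec_index (vec n f)) {..<n} = f"
    proof (intro ballI ext)
      fix f i assume f: "f \<in> {..<n} \<rightarrow>\<^sub>E (UNIV :: 'a set)"
      show "restrict (vec_index (vec n f)) {..<n} i = f i"
        using PiE_arb[OF f, of i] by (cases "i < n") simp_all
    qed
    show "\<forall>v\<in>carrier_vec n. vec n (restrict (vec_index v) {..<n}) = (v :: 'a vec)"
    proof
      fix v :: "'a vec" assume "v \<in> carrier_vec n"
      then show "vec n (restrict (vec_index v) {..<n}) = v" by (intro eq_vecI) simp_all
    qed
  qed (intro image_subsetI, simp)+
  show "finite (carrier_vec n :: 'a vec set)"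
    using finite_PiE[of "{..<n}" "\<lambda>_. UNIV :: 'a set"] bij_betw_finite[OF bij] by simp
  show "card (carrier_vec n :: 'a vec set) = CARD('a) ^ n"
    using bij_betw_same_card[OF bij] by (simp add: card_PiE)
qed

text \<open>
  Rank-nullity by counting: the image of \<open>A\<close> is the span of its columns, with \<open>q ^ rank\<close> elements, and
  all nonempty fibres of \<open>v \<mapsto> A v\<close> are translates of the kernel.
\<close>

lemma card_kernel_times_power_rank:
  fixes A :: "'a::{field,finite} mat"
  assumes A: "A \<in> carrier_mat n nc"
  shows "card {v \<in> carrier_vec nc. A *\<^sub>v v = 0\<^sub>v n} * CARD('a) ^ vec_space.rank n A = CARD('a) ^ nc"
proof -
  interpret vec_space "TYPE('a)" n .
  let ?S = "set (cols A)" and ?I = "(\<lambda>v. A *\<^sub>v v) ` carrier_vec nc"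
  have S: "?S \<subseteq> carrier_vec n" using cols_dim A by blast
  have sub: "submodule class_ring (span ?S) V" using span_is_submodule[OF S] .
  interpret W: vectorspace class_ring "vs (span ?S)"
    by (rule subspace_is_vs[OF span_is_subspace[OF S]])
  have gen: "W.span ?S = span ?S"
    using span_li_not_depend(1)[OF in_own_span[OF S] sub] by simp
  have "W.fin_dim"
    unfolding W.fin_dim_def using gen in_own_span[OF S] by (intro exI[of _ ?S] conjI) simp_all
  then have "card (span ?S) = CARD('a) ^ rank A"
    using W.card_carrier_eq_power_dim unfolding rank_def by (simp add: class_ring_simps)
  moreover have "span ?S = ?I"
  proof -
    have "span ?S = {y \<in> carrier_vec n. \<exists>x\<in>carrier_vec nc. A *\<^sub>v x = y}"
      using col_space_eq[OF A] A unfolding col_space_def by simp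
    also have "\<dots> = ?I"
    proof
      show "?I \<subseteq> {y \<in> carrier_vec n. \<exists>x\<in>carrier_vec nc. A *\<^sub>v x = y}"
        using mult_mat_vec_carrier[OF A] by auto
    qed auto
    finally show ?thesis .
  qed
  ultimately have cardI: "card ?I = CARD('a) ^ rank A" by simp
  have fiber: "card {v \<in> carrier_vec nc. A *\<^sub>v v = y} = card {v \<in> carrier_vec nc. A *\<^sub>v v = 0\<^sub>v n}"
    if "y \<in> ?I" for y
  proof -
    from that obtain u where u: "u \<in> carrier_vec nc" "y = A *\<^sub>v u" by auto
    have cancel: "v + u - u = v" "v - u + u = v" if "v \<in> carrier_vec nc" for v
      using that u(1) unfolding carrier_vec_def by (auto intro!: eq_vecI)
    have "bij_betw (\<lambda>v. v + u) {v \<in> carrier_vec nc. A *\<^sub>v v = 0\<^sub>v n} {v \<in> carrier_vec nc. A *\<^sub>v v = y}"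
    proof (rule bij_betw_byWitness[where f' = "\<lambda>v. v - u"])
      show "(\<lambda>v. v + u) ` {v \<in> carrier_vec nc. A *\<^sub>v v = 0\<^sub>v n} \<subseteq> {v \<in> carrier_vec nc. A *\<^sub>v v = y}"
        using u A by (simp add: image_subset_iff mult_add_distrib_mat_vec)
      show "(\<lambda>v. v - u) ` {v \<in> carrier_vec nc. A *\<^sub>v v = y} \<subseteq> {v \<in> carrier_vec nc. A *\<^sub>v v = 0\<^sub>v n}"
        using u A by (simp add: image_subset_iff mult_minus_distrib_mat_vec)
      show "\<forall>v\<in>{v \<in> carrier_vec nc. A *\<^sub>v v = 0\<^sub>v n}. v + u - u = v"
        using cancel by simp
      show "\<forall>v\<in>{v \<in> carrier_vec nc. A *\<^sub>v v = y}. v - u + u = v"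
        using cancel by simp
    qed
    then show ?thesis by (rule bij_betw_same_card[symmetric])
  qed
  have "CARD('a) ^ nc = (\<Sum>y\<in>?I. card {v \<in> carrier_vec nc. A *\<^sub>v v = y})"
    using sum.image_gen[OF finite_carrier_vec, of "\<lambda>_. 1 :: nat" nc "\<lambda>v. A *\<^sub>v v"]
    by (simp add: card_carrier_vec_finite)
  also have "\<dots> = card ?I * card {v \<in> carrier_vec nc. A *\<^sub>v v = 0\<^sub>v n}"
    using fiber by simp
  finally show ?thesis using cardI by simp
qed

section \<open>Hankel rank and the apolar ideal\<close>

lemma monomial_forms [simp]: "j \<le> n \<Longrightarrow> X ^ (n - j) * Y ^ j \<in> forms n"
  by (rule forms_mult'[OF forms_power[OF X_forms refl] forms_power[OF Y_forms refl]]) simp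

lemma linear_on_sum:
  assumes u: "linear_on n u" and g: "\<And>i. i \<in> I \<Longrightarrow> g i \<in> forms n" and fin: "finite I"
  shows "u (\<Sum>i\<in>I. g i) = (\<Sum>i\<in>I. u (g i))"
proof -
  have "u (\<Sum>i\<in>I. g i) = (\<Sum>i\<in>I. u (g i)) \<and> (\<Sum>i\<in>I. g i) \<in> forms n"
    using fin g by (induction I rule: finite_induct) (auto simp: linear_on_0[OF u] linear_on_add[OF u])
  then show ?thesis by simp
qed

lemma form_eq_sum_monomials:
  "f \<in> forms n \<Longrightarrow> f = (\<Sum>j\<le>n. scale (coeff (coeff f j) (n - j)) (X ^ (n - j) * Y ^ j))"
  using hom_comp_form[of f n n] by (simp add: hom_comp_def)

lemma linear_on_vanishes_iff:
  fixes u :: "'a::field binpoly \<Rightarrow> 'a"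
  assumes "linear_on n u"
  shows "(\<forall>f\<in>forms n. u f = 0) \<longleftrightarrow> (\<forall>j\<le>n. u (X ^ (n - j) * Y ^ j) = 0)"
proof
  assume *: "\<forall>j\<le>n. u (X ^ (n - j) * Y ^ j) = 0"
  show "\<forall>f\<in>forms n. u f = 0"
  proof
    fix f :: "'a binpoly" assume "f \<in> forms n"
    then have "u f = u (\<Sum>j\<le>n. scale (coeff (coeff f j) (n - j)) (X ^ (n - j) * Y ^ j))"
      using form_eq_sum_monomials by metis
    also have "\<dots> = (\<Sum>j\<le>n. u (scale (coeff (coeff f j) (n - j)) (X ^ (n - j) * Y ^ j)))"
      by (rule linear_on_sum[OF assms]) auto
    also have "\<dots> = 0" using * linear_on_scale[OF assms] by (intro sum.neutral) auto
    finally show "u f = 0" .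
  qed
qed simp

text \<open>
  The cubic form with coefficient vector \<open>v\<close>, the entry \<open>j\<close> belonging to \<open>x ^ (3 - j) y ^ j\<close>.
\<close>

definition cubic_of :: "'a::field vec \<Rightarrow> 'a binpoly" where
  "cubic_of v = (\<Sum>j\<le>3. scale (vec_index v j) (X ^ (3 - j) * Y ^ j))"

lemma cubic_of_forms: "cubic_of v \<in> forms 3"
proof -
  have "(\<Sum>j\<in>J. scale (vec_index v j) (X ^ (3 - j) * Y ^ j)) \<in> forms 3" if "finite J" "J \<subseteq> {..3}" for J
    using that monomial_forms[of _ 3]
    by (induction J rule: finite_induct) (simp_all add: forms_add forms_scale)
  then show ?thesis unfolding cubic_of_def by simp
qed

lemma coeff_cubic_of: "j \<le> 3 \<Longrightarrow> coeff (coeff (cubic_of v) j) (3 - j) = vec_index v j"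
proof -
  assume j: "j \<le> 3"
  have "coeff (coeff (cubic_of v) j) (3 - j) = (\<Sum>k\<le>3. if k = j then vec_index v j else 0)"
    unfolding cubic_of_def coeff_sum coeff_scale X_power_Y_power
    by (intro sum.cong) (use j in auto)
  then show ?thesis using j by simp
qed

text \<open>
  The cubic form with coefficient vector \<open>v\<close> is apolar to \<open>w\<close> if and only if \<open>v\<close> lies in the kernel of the
  Hankel matrix: the entry \<open>i\<close> of the product is the value of \<open>w\<close> at the form multiplied by \<open>x ^ (2 - i) y ^ i\<close>.
\<close>

lemma card_apolar_cubics:
  fixes w :: "'a::{field,finite} binpoly \<Rightarrow> 'a"
  assumes w: "w \<in> dual_forms 5"
  shows "card {f \<in> forms 3. f \<in> apolar_ideal 5 w} * CARD('a) ^ hankel_rank w = CARD('a) ^ 4"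
proof -
  define A where "A = mat 3 4 (\<lambda>(i, j). w (X ^ (5 - (i + j)) * Y ^ (i + j)))"
  have A: "A \<in> carrier_mat 3 4" by (simp add: A_def)
  have w5: "linear_on 5 w" using dual_forms_linear[OF w] .
  have entry: "vec_index (A *\<^sub>v v) i = w (cubic_of v * (X ^ (2 - i) * Y ^ i))"
    if v: "v \<in> carrier_vec 4" and i: "i < 3" for v i
  proof -
    have m: "X ^ (2 - i) * Y ^ i \<in> forms 2" using i by simp
    have mono: "(X ^ (3 - j) * Y ^ j) * (X ^ (2 - i) * Y ^ i) = X ^ (5 - (i + j)) * (Y :: 'a binpoly) ^ (i + j)"
      if "j \<le> 3" for j
    proof -
      have e: "5 - (i + j) = (3 - j) + (2 - i)" using that i by simp
      show ?thesis unfolding e power_add by (simp only: mult.assoc mult.left_commute mult.commute)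
    qed
    have "w (cubic_of v * (X ^ (2 - i) * Y ^ i)) =
        w (\<Sum>j\<le>3. scale (vec_index v j) (X ^ (5 - (i + j)) * Y ^ (i + j)))"
      unfolding cubic_of_def sum_distrib_right by (intro arg_cong[of _ _ w] sum.cong) (auto simp: scale_mult_left mono)
    also have "\<dots> = (\<Sum>j\<le>3. w (scale (vec_index v j) (X ^ (5 - (i + j)) * Y ^ (i + j))))"
      using i by (intro linear_on_sum[OF w5]) auto
    also have "\<dots> = (\<Sum>j\<le>3. w (X ^ (5 - (i + j)) * Y ^ (i + j)) * vec_index v j)"
      using i by (intro sum.cong) (auto simp: linear_on_scale[OF w5])
    also have "\<dots> = (\<Sum>j\<in>{0..<4}. w (X ^ (5 - (i + j)) * Y ^ (i + j)) * vec_index v j)"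
      by (intro sum.cong) auto
    also have "\<dots> = vec_index (A *\<^sub>v v) i"
      using v i by (simp add: A_def scalar_prod_def)
    finally show ?thesis by simp
  qed
  have ker: "A *\<^sub>v v = 0\<^sub>v 3 \<longleftrightarrow> cubic_of v \<in> apolar_ideal 5 w" if v: "v \<in> carrier_vec 4" for v
  proof -
    have u: "linear_on 2 (\<lambda>g. w (cubic_of v * g))"
      using linear_on_polar'[OF _ cubic_of_forms, of 2 w v] w5 by simp
    have "A *\<^sub>v v = 0\<^sub>v 3 \<longleftrightarrow> (\<forall>i<3. vec_index (A *\<^sub>v v) i = 0)"
      using A by (auto simp: vec_eq_iff)
    also have "\<dots> \<longleftrightarrow> (\<forall>i\<le>2. w (cubic_of v * (X ^ (2 - i) * Y ^ i)) = 0)"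
      using entry[OF v] by auto
    also have "\<dots> \<longleftrightarrow> (\<forall>g\<in>forms 2. w (cubic_of v * g) = 0)"
      using linear_on_vanishes_iff[OF u] by simp
    also have "\<dots> \<longleftrightarrow> cubic_of v \<in> apolar_ideal 5 w"
      using apolar_iff[OF w cubic_of_forms, of 2 v] by simp
    finally show ?thesis .
  qed
  have "bij_betw cubic_of {v \<in> carrier_vec 4. A *\<^sub>v v = 0\<^sub>v 3} {f \<in> forms 3. f \<in> apolar_ideal 5 w}"
  proof (rule bij_betw_byWitness[where f' = "\<lambda>f. vec 4 (\<lambda>j. coeff (coeff f j) (3 - j))"])
    have inv: "cubic_of (vec 4 (\<lambda>j. coeff (coeff f j) (3 - j))) = f" if "f \<in> forms 3" for f :: "'a binpoly"
    proof -
      have "cubic_of (vec 4 (\<lambda>j. coeff (coeff f j) (3 - j))) =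
          (\<Sum>j\<le>3. scale (coeff (coeff f j) (3 - j)) (X ^ (3 - j) * Y ^ j))"
        unfolding cubic_of_def by (intro sum.cong) auto
      then show ?thesis using form_eq_sum_monomials[OF that] by simp
    qed
    then show "\<forall>f\<in>{f \<in> forms 3. f \<in> apolar_ideal 5 w}. cubic_of (vec 4 (\<lambda>j. coeff (coeff f j) (3 - j))) = f"
      by blast
    show "(\<lambda>f. vec 4 (\<lambda>j. coeff (coeff f j) (3 - j))) ` {f \<in> forms 3. f \<in> apolar_ideal 5 w}
        \<subseteq> {v \<in> carrier_vec 4. A *\<^sub>v v = 0\<^sub>v 3}"
      using ker inv by auto
    show "\<forall>v\<in>{v \<in> carrier_vec 4. A *\<^sub>v v = 0\<^sub>v 3}. vec 4 (\<lambda>j. coeff (coeff (cubic_of v) j) (3 - j)) = v"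
      by (intro ballI eq_vecI) (auto simp: coeff_cubic_of)
    show "cubic_of ` {v \<in> carrier_vec 4. A *\<^sub>v v = 0\<^sub>v 3} \<subseteq> {f \<in> forms 3. f \<in> apolar_ideal 5 w}"
      using ker cubic_of_forms by auto
  qed
  then have "card {f \<in> forms 3. f \<in> apolar_ideal 5 w} = card {v \<in> carrier_vec 4. A *\<^sub>v v = 0\<^sub>v 3}"
    by (simp add: bij_betw_same_card)
  then show ?thesis
    using card_kernel_times_power_rank[OF A] unfolding hankel_rank_def A_def by simp
qed

lemma card_apolar_quadratics:
  fixes w :: "'a::{field,finite} binpoly \<Rightarrow> 'a"
  assumes "nontrivial_additive_character (\<psi> :: 'a \<Rightarrow> complex)" and w: "w \<in> dual_forms 5"
  shows "card {f \<in> forms 2. f \<in> apolar_ideal 5 w} * CARD('a) ^ hankel_rank w = CARD('a) ^ 3"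
proof -
  have "CARD('a) * (card {f \<in> forms 2. f \<in> apolar_ideal 5 w} * CARD('a) ^ hankel_rank w) = CARD('a) * CARD('a) ^ 3"
    using card_apolar_cubics[OF w] card_apolar_duality[OF assms] by (simp add: eval_nat_numeral mult.assoc)
  then show ?thesis by simp
qed

section \<open>Coordinates relative to two linear forms\<close>

text \<open>
  If \<open>l\<close> and \<open>m\<close> are independent linear forms, the monomials in \<open>l\<close> and \<open>m\<close> span the forms of degree \<open>n\<close>.
\<close>

lemma vanishes_if_zero_on_monomials:
  assumes lm: "l \<in> forms 1" "l \<noteq> 0" "m \<in> forms 1" "\<not> l dvd m"
    and u: "linear_on n u" and 0: "\<And>i. i \<le> n \<Longrightarrow> u (l ^ (n - i) * m ^ i) = 0"
    and f: "f \<in> forms n"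
  shows "u f = 0"
  using u 0 f
proof (induction n arbitrary: u f)
  case 0
  obtain c where "f = [:[:c:]:]" using 0(3) forms_0_cases by blast
  then have "f = scale c 1" by (simp add: scale_conv_mult one_pCons)
  then show ?case using linear_on_scale[OF 0(1) forms_1, of c] 0(2)[of 0] by simp
next
  case (Suc n)
  obtain g c where g: "g \<in> forms n" "f = l * g + scale c (m ^ Suc n)"
    using forms_decomp[OF lm Suc.prems(3)] by blast
  have lin: "linear_on n (\<lambda>g. u (l * g))"
    using linear_on_polar'[of 1 n u l] Suc.prems(1) lm(1) by simp
  have "u (l * g) = 0"
  proof (rule Suc.IH[OF lin _ g(1)])
    fix i assume "i \<le> n"
    then have "l ^ (Suc n - i) * m ^ i = l * (l ^ (n - i) * m ^ i)" by (simp add: Suc_diff_le mult.assoc)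
    then show "u (l * (l ^ (n - i) * m ^ i)) = 0" using Suc.prems(2)[of i] \<open>i \<le> n\<close> by (simp only:)
  qed
  moreover have m: "m ^ Suc n \<in> forms (Suc n)" by (rule forms_power[OF lm(3)]) simp
  moreover have "u (m ^ Suc n) = 0" using Suc.prems(2)[of "Suc n"] by simp
  moreover have "l * g \<in> forms (Suc n)" using forms_mult'[OF lm(1) g(1)] by simp
  ultimately show ?case
    unfolding g(2) using linear_on_add[OF Suc.prems(1)] linear_on_scale[OF Suc.prems(1) m] forms_scale[OF m] by simp
qed

lemma scale_minus_1: "scale (- 1) f = - f"
proof -
  have "[:- 1:] = (- 1 :: 'a poly)" by (simp add: one_pCons)
  then show ?thesis by (simp add: scale_def)
qed

lemma quadratic_coordinates:
  assumes lm: "l \<in> forms 1" "l \<noteq> 0" "m \<in> forms 1" "\<not> l dvd m" and f: "f \<in> forms 2"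
  obtains a b c where "f = scale a (l\<^sup>2) + scale b (l * m) + scale c (m\<^sup>2)"
proof -
  obtain g c where g: "g \<in> forms 1" "f = l * g + scale c (m ^ Suc 1)"
    using forms_decomp[OF lm, of f 1] f by (auto simp: numeral_2_eq_2)
  obtain a b where "g = scale a l + scale b m" using linear_span[OF lm g(1)] .
  then have "f = scale a (l\<^sup>2) + scale b (l * m) + scale c (m\<^sup>2)"
    by (simp add: g(2) distrib_left scale_mult_right power2_eq_square)
  then show ?thesis by (rule that)
qed

lemma scale_square_sum:
  "(scale a f + scale b g + scale c h)\<^sup>2 * k =
    scale (a\<^sup>2) (f * f * k) + scale (2 * a * b) (f * g * k) + scale (b\<^sup>2) (g * g * k) +
    scale (2 * a * c) (f * h * k) + scale (2 * b * c) (g * h * k) + scale (c\<^sup>2) (h * h * k)"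
proof -
  have K: "[:[:a * b:]:] = [:[:a:]:] * [:[:b:]:]" "[:[:2:]:] = (2 :: 'a::field binpoly)" for a b :: 'a
    by (simp_all add: numeral_poly)
  show ?thesis
    unfolding scale_conv_mult power2_eq_square K by (simp only: algebra_simps mult_2 mult_2_right)
qed

lemma linear_on_scale_sum6:
  assumes u: "linear_on n u" and f: "f1 \<in> forms n" "f2 \<in> forms n" "f3 \<in> forms n" "f4 \<in> forms n"
    "f5 \<in> forms n" "f6 \<in> forms n"
  shows "u (scale c1 f1 + scale c2 f2 + scale c3 f3 + scale c4 f4 + scale c5 f5 + scale c6 f6) =
    c1 * u f1 + c2 * u f2 + c3 * u f3 + c4 * u f4 + c5 * u f5 + c6 * u f6"
  using f by (simp add: linear_on_add[OF u] linear_on_scale[OF u] forms_add forms_scale)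

lemma square_pairing_general:
  assumes w: "linear_on 5 w" and f: "f \<in> forms i" "g \<in> forms i" "h \<in> forms i"
    and k: "k \<in> forms j" "2 * i + j = 5"
  shows "w ((scale a f + scale b g + scale c h)\<^sup>2 * k) =
    a\<^sup>2 * w (f * f * k) + 2 * a * b * w (f * g * k) + b\<^sup>2 * w (g * g * k) +
    2 * a * c * w (f * h * k) + 2 * b * c * w (g * h * k) + c\<^sup>2 * w (h * h * k)"
proof -
  have "x * y * k \<in> forms 5" if "x \<in> forms i" "y \<in> forms i" for x y
    using forms_mult'[OF forms_mult[OF that] k(1)] k(2) by (simp add: mult_2)
  then show ?thesis unfolding scale_square_sum
    using f by (intro linear_on_scale_sum6[OF w])
qed

text \<open>
  The coefficients of \<open>(a l\<^sup>2 + b l m + c m\<^sup>2)\<^sup>2\<close>, paired with \<open>w\<close> after multiplication by \<open>k\<close>.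
\<close>

lemma square_pairing:
  assumes w: "linear_on 5 w" and l: "l \<in> forms 1" and m: "m \<in> forms 1"
    and f: "f = scale a (l\<^sup>2) + scale b (l * m) + scale c (m\<^sup>2)" and k: "k \<in> forms 1"
  shows "w (f\<^sup>2 * k) = a\<^sup>2 * w (l ^ 4 * k) + 2 * a * b * w (l ^ 3 * m * k) +
    (b\<^sup>2 + 2 * a * c) * w (l\<^sup>2 * m\<^sup>2 * k) + 2 * b * c * w (l * m ^ 3 * k) + c\<^sup>2 * w (m ^ 4 * k)"
proof -
  have fm: "l\<^sup>2 \<in> forms 2" "l * m \<in> forms 2" "m\<^sup>2 \<in> forms 2"
    using l m forms_power[of _ 1 2 2] forms_mult_1_1 by auto
  have e: "l\<^sup>2 * l\<^sup>2 * k = l ^ 4 * k" "l\<^sup>2 * (l * m) * k = l ^ 3 * m * k" "l * m * (l * m) * k = l\<^sup>2 * m\<^sup>2 * k"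
    "l * m * m\<^sup>2 * k = l * m ^ 3 * k" "m\<^sup>2 * m\<^sup>2 * k = m ^ 4 * k"
    by (simp_all add: eval_nat_numeral mult_ac)
  show ?thesis
    unfolding f square_pairing_general[OF w fm k, simplified] e by (simp add: algebra_simps)
qed

section \<open>Apolarity for a fixed quintic functional\<close>

text \<open>
  The data of the theorem; the field is finite, so the first assumption says that its characteristic is odd.
\<close>

locale quintic_functional =
  fixes \<psi> :: "'a::{field,finite} \<Rightarrow> complex" and w :: "'a binpoly \<Rightarrow> 'a"
  assumes char: "CHAR('a) > 2"
    and \<psi>: "nontrivial_additive_character \<psi>"
    and w: "w \<in> dual_forms 5"
begin

text \<open>
  The degree \<open>m\<close> part of \<open>w\<^sup>\<bottom>\<close>.
\<close>

definition apolar :: "nat \<Rightarrow> 'a binpoly set" where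
  "apolar m = {f \<in> forms m. f \<in> apolar_ideal 5 w}"

text \<open>
  Representatives of the classes of quadratic forms whose square is apolar to \<open>w\<close>: the index set of the
  sum that defines \<open>C w\<close> (lemma \<open>C_eq\<close>).
\<close>

definition square_zeros :: "'a binpoly set" where
  "square_zeros = {r \<in> nforms 2. r\<^sup>2 \<in> apolar_ideal 5 w}"

lemma two_nonzero: "(2 :: 'a) \<noteq> 0"
proof
  assume "(2 :: 'a) = 0"
  then have "of_nat 2 = (0 :: 'a)" by simp
  then have "CHAR('a) dvd 2" by (simp only: of_nat_eq_0_iff_char_dvd)
  then have "CHAR('a) \<le> 2" by (rule dvd_imp_le) simp
  then show False using char by simp
qed

lemma card_gt_1: "CARD('a) > 1"
  using card_mono[of UNIV "{0, 1 :: 'a}"] by auto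

lemma lin: "linear_on 5 w"
  using dual_forms_linear[OF w] .

lemma apolarD: "f \<in> apolar m \<Longrightarrow> f \<in> forms m"
  and apolar_ideal_if: "f \<in> apolar m \<Longrightarrow> f \<in> apolar_ideal 5 w"
  by (auto simp: apolar_def)

lemma apolar_eq: "m + n = 5 \<Longrightarrow> f \<in> forms m \<Longrightarrow> f \<in> apolar m \<longleftrightarrow> (\<forall>g\<in>forms n. w (f * g) = 0)"
  using apolar_iff[OF w] by (auto simp: apolar_def)

lemma apolar_pair: "f \<in> apolar m \<Longrightarrow> g \<in> forms n \<Longrightarrow> m + n = 5 \<Longrightarrow> w (f * g) = 0"
  using apolar_eq apolarD by blast

lemma apolar_scale: "f \<in> apolar m \<Longrightarrow> m \<le> 5 \<Longrightarrow> scale c f \<in> apolar m"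
proof -
  assume f: "f \<in> apolar m" "m \<le> 5"
  show ?thesis
  proof (cases "c = 0")
    case True
    have "(0 :: 'a binpoly) \<in> apolar m"
      using apolar_eq[of m "5 - m" 0] f linear_on_0[OF lin] by simp
    then show ?thesis using True by simp
  next
    case False
    then show ?thesis using apolar_scale_iff[OF w, of f m c] f by (auto simp: apolar_def)
  qed
qed

lemma apolar_scale_iff': "f \<in> forms m \<Longrightarrow> m \<le> 5 \<Longrightarrow> c \<noteq> 0 \<Longrightarrow> scale c f \<in> apolar m \<longleftrightarrow> f \<in> apolar m"
  using apolar_scale_iff[OF w, of f m c] by (auto simp: apolar_def)

lemma apolar_mult: "f \<in> apolar m \<Longrightarrow> g \<in> forms k \<Longrightarrow> m + k \<le> 5 \<Longrightarrow> f * g \<in> apolar (m + k)"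
proof -
  assume f: "f \<in> apolar m" and g: "g \<in> forms k" and mk: "m + k \<le> 5"
  have fg: "f * g \<in> forms (m + k)" using apolarD[OF f] g by blast
  have "w (f * g * h) = 0" if "h \<in> forms (5 - (m + k))" for h
  proof -
    have "g * h \<in> forms (5 - m)" using forms_mult'[OF g that] mk by simp
    then show ?thesis using apolar_pair[OF f] mk by (simp add: mult.assoc)
  qed
  then show ?thesis using apolar_eq[of "m + k" "5 - (m + k)", OF _ fg] mk by simp
qed

lemma finite_apolar: "finite (apolar m)"
  by (rule finite_subset[OF _ finite_forms[of m]]) (auto simp: apolar_def)

lemma square_zeros_iff: "r \<in> nforms 2 \<Longrightarrow> r \<in> square_zeros \<longleftrightarrow> (\<forall>k\<in>forms 1. w (r\<^sup>2 * k) = 0)"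
proof -
  assume "r \<in> nforms 2"
  then have r: "r\<^sup>2 \<in> forms 4" using forms_power[OF nforms_forms, of r 2 4 2] by simp
  show ?thesis using apolar_iff[OF w r, of 1] \<open>r \<in> nforms 2\<close> by (simp add: square_zeros_def)
qed

lemma finite_square_zeros: "finite square_zeros"
  by (simp add: square_zeros_def)

lemma C_eq: "C w = - (\<Sum>r\<in>square_zeros. eps (cls 2 r))"
  using C_eq_sum_nforms[OF w] by (simp add: square_zeros_def)

lemma square_zerosI:
  assumes "f \<in> apolar m" "f dvd r" "r \<in> nforms 2" "f \<noteq> 0" "m = 2"
  shows "r \<in> square_zeros"
proof -
  obtain v where v: "r = f * v" using assms(2) by (auto elim: dvdE)
  have r2: "r \<in> forms 2" using nforms_forms[OF assms(3)] .
  have "v \<in> forms (2 - m)"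
    using form_cofactor[of f v 2 m] assms apolarD[OF assms(1)] r2 v by simp
  then have "v * r \<in> forms (2 - m + 2)" using r2 by blast
  then have "f * (v * r) \<in> apolar (m + (2 - m + 2))" using assms by (intro apolar_mult) auto
  then have "f * (v * r) \<in> apolar_ideal 5 w" by (rule apolar_ideal_if)
  moreover have "r\<^sup>2 = f * (v * r)" by (simp add: v power2_eq_square mult_ac)
  ultimately show ?thesis using assms by (simp add: square_zeros_def)
qed

section \<open>The least generator\<close>

lemma card_apolar_2: "card (apolar 2) * CARD('a) ^ hankel_rank w = CARD('a) ^ 3"
  using card_apolar_quadratics[OF \<psi> w] by (simp add: apolar_def)

lemma card_apolar_3: "card (apolar 3) * CARD('a) ^ hankel_rank w = CARD('a) ^ 4"
  using card_apolar_cubics[OF w] by (simp add: apolar_def)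

text \<open>
  There are \<open>q ^ (3 - s)\<close> apolar quadratic forms, where \<open>s\<close> is the Hankel rank; so many apolar quadratic forms
  mean a small rank.
\<close>

lemma hankel_rank_le:
  assumes "CARD('a) ^ k \<le> card (apolar 2)" "k \<le> 3"
  shows "hankel_rank w \<le> 3 - k"
proof -
  have "CARD('a) ^ (k + hankel_rank w) \<le> CARD('a) ^ 3"
    unfolding power_add card_apolar_2[symmetric] using assms(1) by (rule mult_le_mono1)
  then have "k + hankel_rank w \<le> 3" by (rule power_le_imp_le_exp[OF card_gt_1])
  then show ?thesis by simp
qed

lemma zero_apolar: "m \<le> 5 \<Longrightarrow> 0 \<in> apolar m"
  using apolar_eq[of m "5 - m" 0] linear_on_0[OF lin] by simp

lemma hankel_rank_le_3: "hankel_rank w \<le> 3"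
proof -
  have "0 \<in> apolar 2" by (rule zero_apolar) simp
  then have "apolar 2 \<noteq> {}" by blast
  then have "card (apolar 2) \<noteq> 0" using card_0_eq[OF finite_apolar[of 2]] by (simp only: simp_thms)
  then have "CARD('a) ^ 0 \<le> card (apolar 2)" by (simp only: power_0)
  from hankel_rank_le[OF this] show ?thesis by simp
qed

lemma card_multiples:
  assumes "f \<noteq> (0 :: 'a binpoly)"
  shows "card ((\<lambda>c. scale c f) ` UNIV) = CARD('a)"
proof -
  have "inj (\<lambda>c. scale c f)"
  proof (rule injI)
    fix c d assume "scale c f = scale d f"
    then have "smult [:c - d:] f = 0"
      using smult_diff_left[of "[:c:]" "[:d:]" f] by (simp add: scale_def)
    then show "c = d" using assms by (simp add: smult_eq_0_iff)
  qed
  then show ?thesis by (simp add: card_image)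
qed

lemma hankel_rank_le_2:
  assumes "f \<in> apolar 2" "f \<noteq> 0"
  shows "hankel_rank w \<le> 2"
proof -
  have "(\<lambda>c. scale c f) ` UNIV \<subseteq> apolar 2" using apolar_scale[OF assms(1)] by auto
  then have "card ((\<lambda>c. scale c f) ` UNIV) \<le> card (apolar 2)" by (rule card_mono[OF finite_apolar])
  then have "CARD('a) \<le> card (apolar 2)" by (simp only: card_multiples[OF assms(2)])
  then show ?thesis using hankel_rank_le[of 1] by simp
qed

lemma hankel_rank_le_1:
  assumes "l \<in> apolar 1" "l \<noteq> 0"
  shows "hankel_rank w \<le> 1"
proof -
  have "l * g \<in> apolar 2" if "g \<in> forms 1" for g
    using apolar_mult[OF assms(1) that] by (simp add: numeral_2_eq_2)
  then have sub: "(*) l ` forms 1 \<subseteq> apolar 2" by auto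
  have "inj_on ((*) l) (forms 1)" using assms(2) by (auto intro: inj_onI)
  then have "card ((*) l ` forms 1) = CARD('a) ^ 2"
    by (simp add: card_image card_forms power2_eq_square)
  then have "CARD('a) ^ 2 \<le> card (apolar 2)"
    using card_mono[OF finite_apolar[of 2] sub] by simp
  then show ?thesis using hankel_rank_le[of 2] by simp
qed

lemma no_apolar_constant:
  assumes "f \<in> apolar 0" "f \<noteq> 0"
  shows "w = zero_dual"
proof -
  obtain c where c: "f = [:[:c:]:]" using apolarD[OF assms(1)] forms_0_cases by blast
  then have f: "f * g = scale c g" for g by (simp add: scale_conv_mult)
  have "c \<noteq> 0" using c assms(2) by auto
  have "w g = 0" if "g \<in> forms 5" for g
    using apolar_pair[OF assms(1) that] linear_on_scale[OF lin that, of c] \<open>c \<noteq> 0\<close> by (simp add: f)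
  then show ?thesis using dual_forms_eq_zero_iff[OF w] by blast
qed

text \<open>
  A nonzero apolar form of degree \<open>1\<close> or \<open>2\<close> has \<open>q\<^sup>2\<close> or \<open>q\<close> multiples of degree \<open>2\<close>, which bounds the rank.
\<close>

lemma rank_le_degree:
  assumes "w \<noteq> zero_dual" "g \<in> forms m" "g \<noteq> 0" "g \<in> apolar_ideal 5 w"
  shows "hankel_rank w \<le> m"
proof -
  have g: "g \<in> apolar m" using assms by (simp add: apolar_def)
  consider "m = 0" | "m = 1" | "m = 2" | "m \<ge> 3" by linarith
  then show ?thesis
  proof cases
    case 1 then show ?thesis using no_apolar_constant[of g] assms g by simp
  next
    case 2 then show ?thesis using hankel_rank_le_1[of g] assms g by simp
  next
    case 3 then show ?thesis using hankel_rank_le_2[of g] assms g by simp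
  next
    case 4 then show ?thesis using hankel_rank_le_3 by simp
  qed
qed

lemma least_generatorI:
  assumes "w \<noteq> zero_dual" "\<phi> \<in> apolar (hankel_rank w)" "\<phi> \<noteq> 0"
  shows "is_least_generator w \<phi>"
  unfolding is_least_generator_def
  using assms rank_le_degree[OF assms(1)] by (auto simp: apolar_def)

text \<open>
  Every monomial of degree \<open>5\<close> is a multiple of a monomial of degree \<open>n\<close>.
\<close>

lemma all_apolar_imp_zero:
  assumes "forms n \<subseteq> apolar n" "n \<le> 5"
  shows "w = zero_dual"
proof -
  note all = subsetD[OF assms(1)]
  have "w h = 0" if "h \<in> forms 5" for h
  proof -
    have "w (X ^ (5 - e) * Y ^ e) = 0" if e: "e \<le> 5" for e
    proof (cases "e \<le> n")
      case True
      have p: "X ^ (n - e) * Y ^ e \<in> forms n" using True by simp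
      have x: "X ^ (5 - n) \<in> forms (5 - n)" by (rule forms_power[OF X_forms]) simp
      have "5 - e = (n - e) + (5 - n)" using True assms(2) by simp
      then have "X ^ (5 - e) * Y ^ e = (X ^ (n - e) * Y ^ e) * (X :: 'a binpoly) ^ (5 - n)"
        by (simp only: power_add mult.assoc mult.left_commute mult.commute)
      then show ?thesis using apolar_pair[OF all[OF p] x] assms(2) by (simp only: le_add_diff_inverse)
    next
      case False
      have p: "Y ^ n \<in> forms n" by (rule forms_power[OF Y_forms]) simp
      have x: "X ^ (5 - e) * Y ^ (e - n) \<in> forms (5 - n)"
        by (rule forms_mult'[OF forms_power[OF X_forms refl] forms_power[OF Y_forms refl]]) (use False e in simp)
      have "Y ^ e = Y ^ n * (Y :: 'a binpoly) ^ (e - n)" using False by (simp only: power_add[symmetric]) simp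
      then have "X ^ (5 - e) * Y ^ e = Y ^ n * (X ^ (5 - e) * (Y :: 'a binpoly) ^ (e - n))"
        by (simp only: mult.assoc mult.left_commute mult.commute)
      then show ?thesis using apolar_pair[OF all[OF p] x] assms(2) by (simp only: le_add_diff_inverse)
    qed
    then show ?thesis using linear_on_vanishes_iff[OF lin] that by blast
  qed
  then show ?thesis using dual_forms_eq_zero_iff[OF w] by blast
qed

text \<open>
  A dimension count: if the apolar forms \<open>f\<close> and \<open>g\<close> satisfy no relation \<open>f u + g v = 0\<close> in degree \<open>n\<close>, and the spaces
  of \<open>u\<close> and of \<open>v\<close> together have the dimension of the forms of degree \<open>n\<close>, then all forms of degree \<open>n\<close> are
  combinations of \<open>f\<close> and \<open>g\<close> and hence apolar.
\<close>

lemma zero_if_no_relation: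
  assumes f: "f \<in> apolar i" and g: "g \<in> apolar j" and ij: "i + a = n" "j + b = n" "n \<le> 5"
    and dim: "Suc a + Suc b = Suc n"
    and inj: "\<And>u v. u \<in> forms a \<Longrightarrow> v \<in> forms b \<Longrightarrow> f * u + g * v = 0 \<Longrightarrow> u = 0 \<and> v = 0"
  shows "w = zero_dual"
proof -
  let ?m = "\<lambda>(u, v). f * u + g * v"
  have "inj_on ?m (forms a \<times> forms b)"
  proof (rule inj_onI)
    fix x y assume x: "x \<in> forms a \<times> forms b" and y: "y \<in> forms a \<times> forms b" and eq: "?m x = ?m y"
    obtain u v where xe: "x = (u, v)" by (cases x)
    obtain u' v' where ye: "y = (u', v')" by (cases y)
    have "f * (u - u') + g * (v - v') = 0" using eq by (simp add: xe ye algebra_simps)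
    then have "u - u' = 0 \<and> v - v' = 0" using x y by (intro inj) (auto simp: xe ye)
    then show "x = y" by (simp add: xe ye)
  qed
  then have card: "card (?m ` (forms a \<times> forms b)) = CARD('a) ^ Suc n"
    by (simp add: card_image card_cartesian_product card_forms dim[symmetric] power_add)
  have "f * u + g * v \<in> forms n" if "u \<in> forms a" "v \<in> forms b" for u v
    using forms_mult'[OF apolarD[OF f] that(1) ij(1)[symmetric]]
      forms_mult'[OF apolarD[OF g] that(2) ij(2)[symmetric]] by (rule forms_add)
  then have sub: "?m ` (forms a \<times> forms b) \<subseteq> forms n" by auto
  have onto: "?m ` (forms a \<times> forms b) = forms n"
    by (rule card_subset_eq[OF _ sub]) (simp_all add: card card_forms)
  have all: "h \<in> apolar n" if h: "h \<in> forms n" for h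
  proof -
    have "h \<in> ?m ` (forms a \<times> forms b)" using h onto by simp
    then obtain u v where uv: "u \<in> forms a" "v \<in> forms b" "h = f * u + g * v" by auto
    have fu: "f * u \<in> apolar n" using apolar_mult[OF f uv(1)] ij by simp
    have gv: "g * v \<in> apolar n" using apolar_mult[OF g uv(2)] ij by simp
    have "w (h * k) = 0" if k: "k \<in> forms (5 - n)" for k
    proof -
      have e: "n + (5 - n) = 5" using ij by simp
      have "f * u * k \<in> forms 5" "g * v * k \<in> forms 5"
        using forms_mult'[OF apolarD[OF fu] k] forms_mult'[OF apolarD[OF gv] k] e by auto
      then show ?thesis
        using apolar_pair[OF fu k e] apolar_pair[OF gv k e] linear_on_add[OF lin] by (simp add: uv distrib_right)
    qed
    then show ?thesis using apolar_eq[of n "5 - n", OF _ h] ij by simp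
  qed
  then have "forms n \<subseteq> apolar n" by blast
  then show ?thesis using all_apolar_imp_zero ij(3) by blast
qed

text \<open>
  The case of rank \<open>1\<close>. Two independent apolar quadratic forms \<open>f\<close> and \<open>g\<close> satisfy a linear relation
  \<open>f u + g v = 0\<close>, as otherwise all cubic forms are apolar. Here \<open>u\<close> and \<open>v\<close> are independent, so \<open>g = m u\<close> and
  \<open>f = - m v\<close> for a linear form \<open>m\<close>. All multiples of \<open>m\<close> by linear forms are apolar, and hence so is \<open>m\<close>.
\<close>

lemma linear_apolar_exists:
  assumes "w \<noteq> zero_dual" "card (apolar 2) \<ge> CARD('a) ^ 2"
  obtains l where "l \<in> apolar 1" "l \<noteq> 0"
proof -
  have q2: "CARD('a) < CARD('a) ^ 2" using card_gt_1 by (simp add: power2_eq_square)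
  have "card (apolar 2) > 1" using assms(2) card_gt_1 q2 by linarith
  then have "\<not> apolar 2 \<subseteq> {0}" using card_mono[of "{0}" "apolar 2"] by auto
  then obtain f where f: "f \<in> apolar 2" "f \<noteq> 0" by blast
  have "card ((\<lambda>c. scale c f) ` UNIV) < card (apolar 2)"
    using card_multiples[OF f(2)] assms(2) q2 by linarith
  then have "\<not> apolar 2 \<subseteq> (\<lambda>c. scale c f) ` UNIV" using card_mono[of "(\<lambda>c. scale c f) ` UNIV" "apolar 2"] by auto
  then obtain g where g: "g \<in> apolar 2" "g \<notin> (\<lambda>c. scale c f) ` UNIV" by blast
  have f2: "f \<in> forms 2" and g2: "g \<in> forms 2" using f g apolarD by auto
  have "\<not> (\<forall>u v. u \<in> forms 1 \<longrightarrow> v \<in> forms 1 \<longrightarrow> f * u + g * v = 0 \<longrightarrow> u = 0 \<and> v = 0)"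
    using zero_if_no_relation[OF f(1) g(1), of 1 3 1] assms(1) by auto
  then obtain u v where uv: "u \<in> forms 1" "v \<in> forms 1" "f * u + g * v = 0" "u \<noteq> 0 \<or> v \<noteq> 0" by blast
  have "g \<noteq> 0"
  proof
    assume "g = 0"
    then have "g = scale 0 f" by simp
    then show False using g(2) by blast
  qed
  then have nz: "u \<noteq> 0" "v \<noteq> 0" using uv(3,4) f(2) by auto
  have nd: "\<not> u dvd v"
  proof
    assume "u dvd v"
    then obtain c where c: "v = scale c u" using linear_dvd_linear[OF uv(1,2) nz(1)] by blast
    then have "c \<noteq> 0" using nz by auto
    have "u * (f + scale c g) = 0" using uv(3) by (simp add: c scale_mult_right distrib_left mult.commute)
    then have "f + scale c g = 0" using nz by simp
    then have "scale (- 1 / c) (f + scale c g) = 0" by simp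
    then have "scale (- 1 / c) f + scale (- 1) g = 0" using \<open>c \<noteq> 0\<close> by (simp only: scale_add) simp
    moreover have "scale (- 1) g = - g" by (rule scale_minus_1)
    ultimately have "g = scale (- 1 / c) f" by simp
    then show False using g(2) by auto
  qed
  have "g * v = u * (- f)" using uv(3) by (simp add: add_eq_0_iff mult.commute)
  then have "u dvd g * v" by simp
  then have "u dvd g" using linear_prime[OF uv(1) nz(1) g2 uv(2)] nd by blast
  then obtain m where m: "g = u * m" "m \<in> forms (2 - 1)" using form_dvdE[OF _ g2 uv(1) nz(1)] by auto
  have "u * (f + m * v) = 0" using uv(3) by (simp add: m algebra_simps)
  then have fm: "f + m * v = 0" using nz by simp
  have m1: "m \<in> forms 1" "m \<noteq> 0" using m \<open>g \<noteq> 0\<close> by auto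
  have mk: "m * k \<in> apolar 2" if k: "k \<in> forms 1" for k
  proof -
    obtain a b where ab: "k = scale a u + scale b v" using linear_span[OF uv(1) nz(1) uv(2) nd k] .
    have mv: "m * v = scale (- 1) f" using fm by (simp add: scale_minus_1 add_eq_0_iff)
    have "m * k = scale a (u * m) + scale b (m * v)"
      by (simp add: ab distrib_left scale_mult_right mult.commute[of m u])
    then have "m * k = scale a g + scale (- b) f"
      by (simp add: mv m(1))
    moreover have "w ((scale a g + scale (- b) f) * h) = 0" if h: "h \<in> forms 3" for h
    proof -
      have "g * h \<in> forms 5" "f * h \<in> forms 5" using forms_mult'[OF g2 h] forms_mult'[OF f2 h] by auto
      then show ?thesis using apolar_pair[OF g(1) h] apolar_pair[OF f(1) h]
        by (simp add: distrib_right scale_mult_left linear_on_add[OF lin] linear_on_scale[OF lin] forms_scale)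
    qed
    ultimately show ?thesis
      using apolar_eq[of 2 3 "m * k"] forms_mult_1_1[OF m1(1) k] by simp
  qed
  have "w (m * f) = 0" if f: "f \<in> forms 4" for f
  proof -
    obtain g h where gh: "g \<in> forms 3" "h \<in> forms 3" "f = X * g + Y * h"
      using forms_Suc_cases[of f 3] f by auto
    have "m * X * g \<in> forms 5" "m * Y * h \<in> forms 5"
      using forms_mult'[OF forms_mult_1_1[OF m1(1) X_forms] gh(1)] forms_mult'[OF forms_mult_1_1[OF m1(1) Y_forms] gh(2)]
      by auto
    then show ?thesis
      using apolar_pair[OF mk[OF X_forms] gh(1)] apolar_pair[OF mk[OF Y_forms] gh(2)]
      by (simp add: gh(3) distrib_left linear_on_add[OF lin] mult.assoc[symmetric])
  qed
  then have "m \<in> apolar 1" using apolar_eq[of 1 4 m] m1(1) by simp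
  then show ?thesis using that m1 by blast
qed

text \<open>
  In rank \<open>0\<close> all quadratic forms would be apolar; in rank \<open>2\<close> and \<open>3\<close> there are \<open>q\<close> apolar forms of degree \<open>2\<close> and
  \<open>3\<close> respectively.
\<close>

lemma least_generator_exists:
  assumes w0: "w \<noteq> zero_dual"
  obtains \<phi> where "is_least_generator w \<phi>" "\<phi> \<in> apolar (hankel_rank w)" "\<phi> \<noteq> 0" "hankel_rank w \<in> {1, 2, 3}"
proof -
  have q: "CARD('a) > 0" by simp
  have nontriv: "\<exists>\<phi>\<in>apolar m. \<phi> \<noteq> 0" if "card (apolar m) = CARD('a)" for m
  proof -
    have "\<not> apolar m \<subseteq> {0}" using card_mono[of "{0}" "apolar m"] that card_gt_1 by auto
    then show ?thesis by blast
  qed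
  consider "hankel_rank w = 0" | "hankel_rank w = 1" | "hankel_rank w = 2" | "hankel_rank w = 3"
    using hankel_rank_le_3 by linarith
  then have "hankel_rank w \<in> {1, 2, 3} \<and> (\<exists>\<phi>\<in>apolar (hankel_rank w). \<phi> \<noteq> 0)"
  proof cases
    case 1
    then have "card (apolar 2) = CARD('a) ^ 3" using card_apolar_2 by simp
    then have "apolar 2 = forms 2"
      by (intro card_subset_eq) (auto simp: card_forms apolar_def eval_nat_numeral)
    then show ?thesis using all_apolar_imp_zero[of 2] w0 by simp
  next
    case 2
    then have "CARD('a) * card (apolar 2) = CARD('a) * CARD('a) ^ 2"
      using card_apolar_2 by (simp add: eval_nat_numeral mult_ac)
    then have "card (apolar 2) = CARD('a) ^ 2" by simp
    then show ?thesis using linear_apolar_exists[OF w0] 2 by auto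
  next
    case 3
    then have "CARD('a) ^ 2 * card (apolar 2) = CARD('a) ^ 2 * CARD('a)"
      using card_apolar_2 by (simp add: eval_nat_numeral mult_ac)
    then have "card (apolar 2) = CARD('a)" by simp
    then show ?thesis using nontriv 3 by simp
  next
    case 4
    then have "CARD('a) ^ 3 * card (apolar 3) = CARD('a) ^ 3 * CARD('a)"
      using card_apolar_3 by (simp add: eval_nat_numeral mult_ac)
    then have "card (apolar 3) = CARD('a)" by simp
    then show ?thesis using nontriv 4 by simp
  qed
  then show ?thesis using that least_generatorI[OF w0] by blast
qed

end

section \<open>Splitting types of quadratic and cubic forms\<close>

lemma splitting_type_single:
  assumes "has_splitting_type f {#(d, e)#}"
  obtains c g where "c \<noteq> 0" "irreducible g" "g \<in> forms d" "f = scale c (g ^ e)"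
proof -
  obtain c S d' e' where S: "c \<noteq> 0" "finite S" "\<forall>g\<in>S. irreducible g \<and> g \<in> forms (d' g) \<and> e' g \<ge> 1"
    "f = scale c (\<Prod>g\<in>S. g ^ e' g)" "{#(d, e)#} = image_mset (\<lambda>g. (d' g, e' g)) (mset_set S)"
    using assms unfolding has_splitting_type_def by blast
  have "size (image_mset (\<lambda>g. (d' g, e' g)) (mset_set S)) = 1" unfolding S(5)[symmetric] by simp
  then have "card S = 1" by simp
  then obtain g where g: "S = {g}" by (auto simp: card_1_singleton_iff)
  have "d' g = d" "e' g = e" using S(5) by (auto simp: g)
  then show ?thesis using S(1,3,4) that[of c g] by (simp add: g)
qed

lemma splitting_type_pair:
  assumes "has_splitting_type f {#(d1, e1), (d2, e2)#}"
  obtains c g h where "c \<noteq> 0" "g \<in> forms d1" "h \<in> forms d2" "irreducible g" "irreducible h"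
    "\<not> proportional g h" "f = scale c (g ^ e1 * h ^ e2)"
proof -
  obtain c S d' e' where S: "c \<noteq> 0" "finite S" "\<forall>g\<in>S. irreducible g \<and> g \<in> forms (d' g) \<and> e' g \<ge> 1"
    "\<forall>g\<in>S. \<forall>h\<in>S. g \<noteq> h \<longrightarrow> \<not> proportional g h"
    "f = scale c (\<Prod>g\<in>S. g ^ e' g)" "{#(d1, e1), (d2, e2)#} = image_mset (\<lambda>g. (d' g, e' g)) (mset_set S)"
    using assms unfolding has_splitting_type_def by blast
  have "size (image_mset (\<lambda>g. (d' g, e' g)) (mset_set S)) = 2" unfolding S(6)[symmetric] by simp
  then have "card S = 2" by simp
  then obtain g h where gh: "S = {g, h}" "g \<noteq> h" by (auto simp: card_2_iff)
  have "{#(d1, e1), (d2, e2)#} = {#(d' g, e' g), (d' h, e' h)#}" using S(6) gh by simp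
  then consider "(d1, e1) = (d' g, e' g)" "(d2, e2) = (d' h, e' h)" | "(d1, e1) = (d' h, e' h)" "(d2, e2) = (d' g, e' g)"
    by (auto simp: add_eq_conv_ex)
  then show ?thesis
  proof cases
    case 1
    then show ?thesis using S(1,3,4,5) gh that[of c g h] by simp
  next
    case 2
    then show ?thesis using S(1,3,4,5) gh that[of c h g] by (simp add: mult.commute)
  qed
qed

lemma splitting_typeI:
  assumes "c \<noteq> 0" "finite S" "\<And>g. g \<in> S \<Longrightarrow> irreducible g \<and> g \<in> forms (d g) \<and> e g \<ge> 1"
    "\<And>g h. g \<in> S \<Longrightarrow> h \<in> S \<Longrightarrow> g \<noteq> h \<Longrightarrow> \<not> proportional g h"
  shows "has_splitting_type (scale c (\<Prod>g\<in>S. g ^ e g)) (image_mset (\<lambda>g. (d g, e g)) (mset_set S))"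
  unfolding has_splitting_type_def using assms by (intro exI[of _ c] exI[of _ S] exI[of _ d] exI[of _ e]) auto

lemma has_splitting_type_power:
  assumes "c \<noteq> 0" "irreducible g" "g \<in> forms d" "e \<ge> 1"
  shows "has_splitting_type (scale c (g ^ e)) {#(d, e)#}"
  using splitting_typeI[of c "{g}" "\<lambda>_. d" "\<lambda>_. e"] assms by simp

lemma nforms_1_not_proportional:
  "l \<in> nforms 1 \<Longrightarrow> m \<in> nforms 1 \<Longrightarrow> l \<noteq> m \<Longrightarrow> \<not> proportional l m"
  using nforms_scale_eq[of l 1 m] unfolding proportional_def by metis

lemma nforms_1_irreducible: "l \<in> nforms 1 \<Longrightarrow> irreducible l \<and> l \<in> forms 1"
  using linear_irreducible[OF nforms_forms nforms_nonzero] nforms_forms by blast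

lemma proportional_forms_degree:
  assumes "proportional f g" "f \<in> forms m" "g \<in> forms n" "f \<noteq> 0"
  shows "m = n"
proof -
  obtain c where c: "c \<noteq> 0" "g = scale c f" using assms(1) unfolding proportional_def by blast
  then have "f \<in> forms n" using assms(3) by simp
  then show ?thesis using forms_degree_unique[OF assms(2) _ assms(4)] by blast
qed

lemma cubic_splitting_types:
  assumes "\<phi> \<in> forms 3" "\<phi> \<noteq> (0 :: 'a::field binpoly)"
  shows "\<exists>T\<in>{{#(1, 3)#}, {#(1, 2), (1, 1)#}, {#(1, 1), (1, 1), (1, 1)#}, {#(2, 1), (1, 1)#}, {#(3, 1)#}}.
    has_splitting_type \<phi> T"
proof (cases "irreducible \<phi>")
  case True
  then have "has_splitting_type (scale 1 (\<phi> ^ 1)) {#(3, 1)#}"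
    using assms by (intro has_splitting_type_power) auto
  then show ?thesis by simp
next
  case False
  have "\<exists>l q. l \<in> forms 1 \<and> q \<in> forms 2 \<and> \<phi> = l * q"
  proof -
    obtain u v i j where uv: "u \<in> forms i" "v \<in> forms j" "\<phi> = u * v" "i + j = 3" "i \<noteq> 0" "j \<noteq> 0"
      using irreducible_formI[OF assms] False by auto
    then have "i = 1 \<and> j = 2 \<or> i = 2 \<and> j = 1" by linarith
    then show ?thesis
    proof
      assume "i = 1 \<and> j = 2"
      then show ?thesis using uv by blast
    next
      assume "i = 2 \<and> j = 1"
      then show ?thesis using uv mult.commute[of u v] by blast
    qed
  qed
  then obtain l q where lq: "l \<in> forms 1" "q \<in> forms 2" "\<phi> = l * q" by blast
  then have nz: "l \<noteq> 0" "q \<noteq> 0" using assms by auto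
  obtain x k where k: "x \<noteq> 0" "k \<in> nforms 1" "l = scale x k" using nforms_exists[OF lq(1) nz(1)] .
  obtain y r where r: "y \<noteq> 0" "r \<in> nforms 2" "q = scale y r" using nforms_exists[OF lq(2) nz(2)] .
  have \<phi>: "\<phi> = scale (x * y) (k * r)" by (simp add: lq k r scale_mult_left scale_mult_right mult.commute)
  have xy: "x * y \<noteq> 0" using k r by simp
  show ?thesis
    using r(2)
  proof (cases rule: nforms_2_cases)
    case (reducible m n)
    have sq: "has_splitting_type \<phi> {#(1, 2), (1, 1)#}"
      if f: "f \<in> nforms 1" "g \<in> nforms 1" "f \<noteq> g" "k * r = f\<^sup>2 * g" for f g
    proof -
      have "has_splitting_type (scale (x * y) (\<Prod>z\<in>{f, g}. z ^ (if z = f then 2 else 1)))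
          (image_mset (\<lambda>z. (1, if z = f then 2 else 1)) (mset_set {f, g}))"
        by (rule splitting_typeI)
          (use xy f nforms_1_irreducible nforms_1_not_proportional in auto)
      then show ?thesis unfolding \<phi> f(4) using f(3) by simp
    qed
    consider "k = m" "m = n" | "k = m" "m \<noteq> n" | "k = n" "m \<noteq> n" | "m = n" "k \<noteq> m" | "k \<noteq> m" "m \<noteq> n" "k \<noteq> n" by blast
    then show ?thesis
    proof cases
      case 1
      have "has_splitting_type (scale (x * y) (k ^ 3)) {#(1, 3)#}"
        using nforms_1_irreducible[OF k(2)] xy by (intro has_splitting_type_power) auto
      moreover have "k * r = k ^ 3" using 1 reducible by (simp add: power3_eq_cube mult.assoc)
      ultimately have "has_splitting_type \<phi> {#(1, 3)#}" unfolding \<phi> by (simp only:)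
      then show ?thesis by blast
    next
      case 2
      have "k * r = m\<^sup>2 * n" unfolding 2(1) reducible(3) power2_eq_square by (simp only: mult.assoc)
      then have "has_splitting_type \<phi> {#(1, 2), (1, 1)#}" by (rule sq[OF reducible(1,2) 2(2)])
      then show ?thesis by blast
    next
      case 3
      have "k * r = n\<^sup>2 * m" unfolding 3(1) reducible(3) power2_eq_square
        by (simp only: mult.assoc mult.left_commute mult.commute)
      then have "has_splitting_type \<phi> {#(1, 2), (1, 1)#}" by (rule sq[OF reducible(2,1) 3(2)[symmetric]])
      then show ?thesis by blast
    next
      case 4
      have "k * r = m\<^sup>2 * k" unfolding reducible(3) 4(1)[symmetric] power2_eq_square
        by (simp only: mult.assoc mult.left_commute mult.commute)
      then have "has_splitting_type \<phi> {#(1, 2), (1, 1)#}" by (rule sq[OF reducible(1) k(2) 4(2)[symmetric]])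
      then show ?thesis by blast
    next
      case 5
      have "has_splitting_type (scale (x * y) (\<Prod>g\<in>{k, m, n}. g ^ 1))
          (image_mset (\<lambda>g. (1, 1)) (mset_set {k, m, n}))"
        by (rule splitting_typeI)
          (use xy k reducible 5 nforms_1_irreducible nforms_1_not_proportional in auto)
      moreover have "(\<Prod>g\<in>{k, m, n}. g ^ 1) = k * r" using 5 reducible by simp
      moreover have "image_mset (\<lambda>g. (1 :: nat, 1 :: nat)) (mset_set {k, m, n}) = {#(1, 1), (1, 1), (1 :: nat, 1 :: nat)#}" using 5 by simp
      ultimately have "has_splitting_type \<phi> {#(1, 1), (1, 1), (1, 1)#}" unfolding \<phi> by (simp only:)
      then show ?thesis by blast
    qed
  next
    case irr
    have r2: "r \<in> forms 2" and k1: "k \<in> forms 1" and kr: "r \<noteq> k"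
      using nforms_forms[OF r(2)] nforms_forms[OF k(2)] forms_degree_unique[of r 2 1] nforms_nonzero[OF r(2)] by auto
    have np: "\<not> proportional r k" "\<not> proportional k r"
      using proportional_forms_degree[OF _ r2 k1 nforms_nonzero[OF r(2)]]
        proportional_forms_degree[OF _ k1 r2 nforms_nonzero[OF k(2)]] by auto
    have "has_splitting_type (scale (x * y) (\<Prod>g\<in>{r, k}. g ^ 1))
        (image_mset (\<lambda>g. (if g = r then 2 else 1, 1)) (mset_set {r, k}))"
      by (rule splitting_typeI) (use xy irr r2 k1 np nforms_1_irreducible[OF k(2)] in auto)
    then show ?thesis unfolding \<phi> using kr by (simp add: mult.commute)
  qed
qed

lemma quadratic_splitting_types:
  assumes "\<phi> \<in> forms 2" "\<phi> \<noteq> (0 :: 'a::field binpoly)"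
  shows "\<exists>T\<in>{{#(1, 2)#}, {#(1, 1), (1, 1)#}, {#(2, 1)#}}. has_splitting_type \<phi> T"
proof -
  obtain y r where r: "y \<noteq> 0" "r \<in> nforms 2" "\<phi> = scale y r" using nforms_exists[OF assms] .
  show ?thesis
    using r(2)
  proof (cases rule: nforms_2_cases)
    case (reducible m n)
    show ?thesis
    proof (cases "m = n")
      case True
      have "has_splitting_type (scale y (m ^ 2)) {#(1, 2)#}"
        using nforms_1_irreducible[OF reducible(1)] r(1) by (intro has_splitting_type_power) auto
      then show ?thesis using True reducible by (simp add: r power2_eq_square)
    next
      case False
      have "has_splitting_type (scale y (\<Prod>g\<in>{m, n}. g ^ 1)) (image_mset (\<lambda>g. (1, 1)) (mset_set {m, n}))"
        by (rule splitting_typeI)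
          (use r(1) reducible False nforms_1_irreducible nforms_1_not_proportional in auto)
      then show ?thesis using False reducible by (simp add: r)
    qed
  next
    case irr
    then have "has_splitting_type (scale y (r ^ 1)) {#(2, 1)#}"
      using r nforms_forms by (intro has_splitting_type_power) auto
    then show ?thesis by (simp add: r)
  qed
qed

section \<open>Bounds for sums of \<open>\<epsilon>\<close>\<close>

lemma eps_cases: "r \<in> nforms 2 \<Longrightarrow> eps (cls 2 r) \<in> {1, 0, -1}"
proof -
  assume r: "r \<in> nforms 2"
  then show ?thesis
  proof (cases rule: nforms_2_cases)
    case (reducible l m)
    then show ?thesis using eps_mult[of l m] by (auto split: if_splits)
  next
    case irr
    then show ?thesis using eps_irreducible[OF nforms_forms[OF r]] by simp
  qed
qed

lemma sum_eps_integer: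
  assumes "finite S" "S \<subseteq> nforms 2"
  shows "\<exists>n::int. \<bar>n\<bar> \<le> int (card S) \<and> (\<Sum>r\<in>S. eps (cls 2 r)) = of_int n"
  using assms
proof (induction S rule: finite_induct)
  case (insert r S)
  then obtain n :: int where n: "\<bar>n\<bar> \<le> int (card S)" "(\<Sum>r\<in>S. eps (cls 2 r)) = of_int n" by auto
  have "eps (cls 2 r) \<in> {1, 0, -1}" using eps_cases insert by blast
  then obtain e :: int where e: "eps (cls 2 r) = of_int e" "\<bar>e\<bar> \<le> 1"
    by (elim insertE) (auto intro: that[of 1] that[of 0] that[of "-1"])
  show ?case using insert n e by (intro exI[of _ "e + n"]) auto
qed simp

lemma distinct_elements_if_card_ge:
  assumes "card S \<ge> n"
  obtains xs where "set xs \<subseteq> S" "distinct xs" "length xs = n"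
proof -
  obtain T where T: "T \<subseteq> S" "card T = n" "finite T" using obtain_subset_with_card_n[OF assms] .
  obtain xs where "set xs = T" "distinct xs" using finite_distinct_list[OF T(3)] by blast
  then show ?thesis using that[of xs] T distinct_card[of xs] by simp
qed

section \<open>Degenerate generators\<close>

lemma X_nforms: "X \<in> nforms 1" and Y_nforms: "Y \<in> nforms 1"
  by (simp_all add: nforms_def X_forms[simplified] Y_forms[simplified])

lemma X_neq_Y: "X \<noteq> Y"
  by (metis dehom_X dehom_Y one_pCons pCons_eq_iff zero_neq_one)

lemma exists_complement:
  assumes l: "l \<in> forms 1" "l \<noteq> 0"
  obtains m where "m \<in> forms 1" "\<not> l dvd m"
proof -
  obtain c k where k: "c \<noteq> 0" "k \<in> nforms 1" "l = scale c k" using nforms_exists[OF l] .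
  have "\<not> (k dvd X \<and> k dvd Y)" using nforms_1_dvd_iff[OF k(2) X_nforms] nforms_1_dvd_iff[OF k(2) Y_nforms] X_neq_Y by auto
  then have "\<not> l dvd X \<or> \<not> l dvd Y" using k by auto
  then show ?thesis using that X_forms Y_forms by blast
qed

lemma eps_product:
  assumes lm: "l \<in> forms 1" "l \<noteq> 0" "m \<in> forms 1" "\<not> l dvd m"
    and r: "t \<noteq> 0" "r \<in> nforms 2" "l * m = scale t r"
  shows "eps (cls 2 r) = 1"
proof -
  have m: "m \<noteq> 0" using lm(4) by auto
  have "\<not> proportional l m" using proportional_iff_dvd[OF lm(1,3,2) m] lm(4) by simp
  then have "split_form (l * m)" using lm m unfolding split_form_def by blast
  then have "split_form (scale (1 / t) (l * m))" using r(1) by (intro split_form_scale) auto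
  then show ?thesis using r by (intro eps_split nforms_forms) auto
qed

context quintic_functional
begin

lemma monomial_apolar_vanish:
  assumes l: "l \<in> forms 1" and m: "m \<in> forms 1" and f: "l ^ p * m ^ s \<in> apolar (p + s)"
    and i: "p \<le> 5 - i" "s \<le> i" "i \<le> 5"
  shows "w (l ^ (5 - i) * m ^ i) = 0"
proof -
  have g: "l ^ (5 - i - p) * m ^ (i - s) \<in> forms (5 - (p + s))"
    by (rule forms_mult'[OF forms_power[OF l refl] forms_power[OF m refl]]) (use i in simp)
  have "l ^ (5 - i) = l ^ p * l ^ (5 - i - p)" "m ^ i = m ^ s * m ^ (i - s)"
    using i by (simp_all only: power_add[symmetric] le_add_diff_inverse)
  then have "l ^ (5 - i) * m ^ i = (l ^ p * m ^ s) * (l ^ (5 - i - p) * m ^ (i - s))"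
    by (simp only: mult.assoc mult.left_commute mult.commute)
  then show ?thesis using apolar_pair[OF f g] i by simp
qed

lemma monomial_apolarI:
  assumes lm: "l \<in> forms 1" "l \<noteq> 0" "m \<in> forms 1" "\<not> l dvd m" and d: "p + s + n = 5"
    and 0: "\<And>i. s \<le> i \<Longrightarrow> i \<le> s + n \<Longrightarrow> w (l ^ (5 - i) * m ^ i) = 0"
  shows "l ^ p * m ^ s \<in> apolar (p + s)"
proof -
  have f: "l ^ p * m ^ s \<in> forms (p + s)"
    by (rule forms_mult'[OF forms_power[OF lm(1) refl] forms_power[OF lm(3) refl]]) simp
  have u: "linear_on n (\<lambda>g. w (l ^ p * m ^ s * g))"
    using linear_on_polar'[of "p + s" n w] lin f d by simp
  have "w (l ^ p * m ^ s * g) = 0" if g: "g \<in> forms n" for g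
  proof (rule vanishes_if_zero_on_monomials[OF lm u _ g])
    fix i assume i: "i \<le> n"
    have e: "p + (n - i) = 5 - (s + i)" using d i by simp
    have "l ^ p * m ^ s * (l ^ (n - i) * m ^ i) = l ^ (p + (n - i)) * m ^ (s + i)"
      by (simp only: power_add mult.assoc mult.left_commute mult.commute)
    then show "w (l ^ p * m ^ s * (l ^ (n - i) * m ^ i)) = 0" using 0[of "s + i"] i e by simp
  qed
  then show ?thesis using apolar_eq[of "p + s" n, OF d f] by simp
qed

text \<open>
  The values of \<open>w\<close> on the monomials in \<open>l\<close> and \<open>m\<close>; for independent \<open>l\<close> and \<open>m\<close> these are the coordinates of \<open>w\<close>.
\<close>

definition coord :: "'a binpoly \<Rightarrow> 'a binpoly \<Rightarrow> nat \<Rightarrow> 'a" where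
  "coord l m i = w (l ^ (5 - i) * m ^ i)"

lemma monomial_apolar_iff:
  assumes lm: "l \<in> forms 1" "l \<noteq> 0" "m \<in> forms 1" "\<not> l dvd m" and d: "p + s + n = 5"
  shows "l ^ p * m ^ s \<in> apolar (p + s) \<longleftrightarrow> (\<forall>i\<in>set [s..<Suc (s + n)]. coord l m i = 0)"
proof
  assume "l ^ p * m ^ s \<in> apolar (p + s)"
  then have "coord l m i = 0" if "s \<le> i" "i \<le> s + n" for i
    unfolding coord_def using monomial_apolar_vanish[OF lm(1,3)] that d by simp
  then show "\<forall>i\<in>set [s..<Suc (s + n)]. coord l m i = 0" by auto
next
  assume *: "\<forall>i\<in>set [s..<Suc (s + n)]. coord l m i = 0"
  have "w (l ^ (5 - i) * m ^ i) = 0" if "s \<le> i" "i \<le> s + n" for i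
    using bspec[OF *, of i] that by (simp add: coord_def del: upt_Suc)
  then show "l ^ p * m ^ s \<in> apolar (p + s)" by (intro monomial_apolarI[OF lm d])
qed

text \<open>
  A monomial in \<open>l\<close> and \<open>m\<close> is apolar if and only if \<open>w\<close> vanishes on all its multiples among the monomials of
  degree \<open>5\<close>.
\<close>

lemma apolar_monomials:
  assumes lm: "l \<in> forms 1" "l \<noteq> 0" "m \<in> forms 1" "\<not> l dvd m"
  defines "A \<equiv> coord l m"
  shows "1 \<in> apolar 0 \<longleftrightarrow> A 0 = 0 \<and> A 1 = 0 \<and> A 2 = 0 \<and> A 3 = 0 \<and> A 4 = 0 \<and> A 5 = 0"
    and "l \<in> apolar 1 \<longleftrightarrow> A 0 = 0 \<and> A 1 = 0 \<and> A 2 = 0 \<and> A 3 = 0 \<and> A 4 = 0"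
    and "m \<in> apolar 1 \<longleftrightarrow> A 1 = 0 \<and> A 2 = 0 \<and> A 3 = 0 \<and> A 4 = 0 \<and> A 5 = 0"
    and "l\<^sup>2 \<in> apolar 2 \<longleftrightarrow> A 0 = 0 \<and> A 1 = 0 \<and> A 2 = 0 \<and> A 3 = 0"
    and "l * m \<in> apolar 2 \<longleftrightarrow> A 1 = 0 \<and> A 2 = 0 \<and> A 3 = 0 \<and> A 4 = 0"
    and "l ^ 3 \<in> apolar 3 \<longleftrightarrow> A 0 = 0 \<and> A 1 = 0 \<and> A 2 = 0"
    and "l\<^sup>2 * m \<in> apolar 3 \<longleftrightarrow> A 1 = 0 \<and> A 2 = 0 \<and> A 3 = 0"
  unfolding A_def
  using monomial_apolar_iff[OF lm, of 0 0 5] monomial_apolar_iff[OF lm, of 1 0 4]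
    monomial_apolar_iff[OF lm, of 0 1 4] monomial_apolar_iff[OF lm, of 2 0 3]
    monomial_apolar_iff[OF lm, of 1 1 3] monomial_apolar_iff[OF lm, of 3 0 2]
    monomial_apolar_iff[OF lm, of 2 1 2]
  by (simp_all add: upt_rec eval_nat_numeral)

text \<open>
  The two equations are \<open>w (r\<^sup>2 l) = 0\<close> and \<open>w (r\<^sup>2 m) = 0\<close>.
\<close>

lemma square_zeros_coordinates:
  assumes lm: "l \<in> forms 1" "l \<noteq> 0" "m \<in> forms 1" "\<not> l dvd m"
    and r: "r \<in> nforms 2" "r = scale a (l\<^sup>2) + scale b (l * m) + scale c (m\<^sup>2)"
  defines "A \<equiv> coord l m"
  shows "r \<in> square_zeros \<longleftrightarrow>
    a\<^sup>2 * A 0 + 2 * a * b * A 1 + (b\<^sup>2 + 2 * a * c) * A 2 + 2 * b * c * A 3 + c\<^sup>2 * A 4 = 0 \<and>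
    a\<^sup>2 * A 1 + 2 * a * b * A 2 + (b\<^sup>2 + 2 * a * c) * A 3 + 2 * b * c * A 4 + c\<^sup>2 * A 5 = 0"
proof -
  have r2: "r\<^sup>2 \<in> forms 4" using forms_power[OF nforms_forms[OF r(1)], of 4 2] by simp
  have e: "w (r\<^sup>2 * l) = a\<^sup>2 * A 0 + 2 * a * b * A 1 + (b\<^sup>2 + 2 * a * c) * A 2 + 2 * b * c * A 3 + c\<^sup>2 * A 4"
    "w (r\<^sup>2 * m) = a\<^sup>2 * A 1 + 2 * a * b * A 2 + (b\<^sup>2 + 2 * a * c) * A 3 + 2 * b * c * A 4 + c\<^sup>2 * A 5"
    unfolding square_pairing[OF lin lm(1,3) r(2) lm(1)] square_pairing[OF lin lm(1,3) r(2) lm(3)] A_def coord_def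
    by (simp_all add: eval_nat_numeral mult_ac)
  have "(\<forall>k\<in>forms 1. w (r\<^sup>2 * k) = 0) \<longleftrightarrow> w (r\<^sup>2 * l) = 0 \<and> w (r\<^sup>2 * m) = 0"
  proof
    assume *: "w (r\<^sup>2 * l) = 0 \<and> w (r\<^sup>2 * m) = 0"
    have u: "linear_on 1 (\<lambda>k. w (r\<^sup>2 * k))" using linear_on_polar'[of 4 1 w] lin r2 by simp
    show "\<forall>k\<in>forms 1. w (r\<^sup>2 * k) = 0"
    proof
      fix k :: "'a binpoly" assume "k \<in> forms 1"
      then obtain x y where "k = scale x l + scale y m" using linear_span[OF lm] by blast
      then show "w (r\<^sup>2 * k) = 0"
        using * linear_on_add[OF u forms_scale[OF lm(1)] forms_scale[OF lm(3)]]
          linear_on_scale[OF u lm(1)] linear_on_scale[OF u lm(3)] by simp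
    qed
  qed (use lm in auto)
  then show ?thesis using square_zeros_iff[OF r(1)] e by simp
qed

lemma square_zero_scale_eq:
  assumes "r \<in> nforms 2" "r' \<in> nforms 2" "r = scale c p" "r' = scale c' p" "c \<noteq> 0"
  shows "r' = r"
proof -
  have "r' = scale (c' / c) r" using assms by simp
  then show ?thesis using nforms_scale_eq assms by blast
qed

text \<open>
  The Waring types \<open>\<langle>1\<rangle>\<close> and \<open>\<langle>1\<^sup>2\<rangle>\<close>. The square zeros are all the multiples of \<open>l\<close>, for which the values of
  \<open>\<epsilon>\<close> add up to \<open>q\<close>, and \<open>l\<^sup>2\<close> is the only apolar square of a linear form up to scalars. The transform is
  therefore \<open>1 / q\<^sup>2 - q / q ^ 4\<close>.
\<close>

lemma Phi_hat_if_linear_square_apolar: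
  assumes l: "l \<in> forms 1" "l \<noteq> 0" and case_l: "l \<in> apolar 1 \<and> w \<noteq> zero_dual \<or> l\<^sup>2 \<in> apolar 2 \<and> l \<notin> apolar 1"
  shows "Phi_hat \<psi> w = 1 / of_nat CARD('a) ^ 2 - 1 / of_nat CARD('a) ^ 3"
proof -
  obtain m where "m \<in> forms 1" "\<not> l dvd m" using exists_complement[OF l] .
  then have lm: "l \<in> forms 1" "l \<noteq> 0" "m \<in> forms 1" "\<not> l dvd m" using l by auto
  define A where "A = coord l m"
  note mono = apolar_monomials[OF lm, folded A_def]
  have l2: "l\<^sup>2 \<in> apolar 2"
    using case_l apolar_mult[of l 1 l 1] l by (auto simp: power2_eq_square numeral_2_eq_2)
  have A03: "A 0 = 0" "A 1 = 0" "A 2 = 0" "A 3 = 0" using l2 mono by simp_all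
  have key: "A 4 = 0 \<and> A 5 \<noteq> 0 \<or> A 4 \<noteq> 0"
    using case_l no_apolar_constant[of 1] A03 mono by auto
  have divides: "l dvd r" if r: "r \<in> square_zeros" for r
  proof -
    have r': "r \<in> nforms 2" using r by (simp add: square_zeros_def)
    obtain a b c where abc: "r = scale a (l\<^sup>2) + scale b (l * m) + scale c (m\<^sup>2)"
      using quadratic_coordinates[OF lm nforms_forms[OF r']] .
    \<comment> \<open>The equations reduce to \<open>c\<^sup>2 A\<^sub>4 = 0\<close> and \<open>2 b c A\<^sub>4 + c\<^sup>2 A\<^sub>5 = 0\<close>.\<close>
    have "c = 0"
      using square_zeros_coordinates[OF lm r' abc] r A03 key by (auto simp: A_def)
    then have "r = l * (scale a l + scale b m)" by (simp add: abc power2_eq_square distrib_left scale_mult_right)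
    then show ?thesis by simp
  qed
  have divides1: "l dvd k" if k: "k \<in> nforms 1" "k\<^sup>2 \<in> apolar_ideal 5 w" for k
  proof -
    have kf: "k \<in> forms 1" using nforms_forms[OF k(1)] .
    have "k\<^sup>2 \<in> apolar 2" using k(2) forms_power[OF kf, of 2 2] by (simp add: apolar_def)
    then have "k * k \<in> square_zeros"
      using square_zerosI[of "k\<^sup>2" 2 "k * k"] nforms_mult_1_1[OF k(1) k(1)] nforms_nonzero[OF k(1)]
      by (simp add: power2_eq_square)
    then have "l dvd k * k" by (rule divides)
    then show ?thesis using linear_prime[OF lm(1,2) kf kf] by blast
  qed
  obtain t l0 where l0: "t \<noteq> 0" "l0 \<in> nforms 1" "l = scale t l0" using nforms_exists[OF lm(1,2)] .
  have l0sq: "l0\<^sup>2 \<in> apolar 2"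
    using l2 l0 forms_power[OF nforms_forms[OF l0(2)], of 2 2] apolar_scale_iff'[of "l0\<^sup>2" 2 "t\<^sup>2"]
    by (simp add: scale_power)
  have zeros: "square_zeros = {r \<in> nforms 2. l0 dvd r}"
  proof (intro subset_antisym subsetI)
    fix r assume "r \<in> square_zeros"
    then show "r \<in> {r \<in> nforms 2. l0 dvd r}" using divides[of r] l0 by (auto simp: square_zeros_def)
  next
    fix r assume "r \<in> {r \<in> nforms 2. l0 dvd r}"
    then have r: "r \<in> nforms 2" "l0 dvd r" by auto
    then have r2: "r\<^sup>2 \<in> forms 4" "l0\<^sup>2 dvd r\<^sup>2"
      using forms_power[OF nforms_forms[OF r(1)], of 4 2] by (auto simp: dvd_power_same)
    then obtain v where v: "r\<^sup>2 = l0\<^sup>2 * v" "v \<in> forms (4 - 2)"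
      using form_dvdE[OF r2(2,1) apolarD[OF l0sq]] nforms_nonzero[OF l0(2)] by auto
    have "r\<^sup>2 \<in> apolar_ideal 5 w"
      using apolar_ideal_if[OF apolar_mult[OF l0sq v(2)]] v(1) by simp
    then show "r \<in> square_zeros" using r by (simp add: square_zeros_def)
  qed
  have "{k \<in> nforms 1. k\<^sup>2 \<in> apolar_ideal 5 w} = {l0}"
  proof (intro subset_antisym subsetI)
    fix k assume "k \<in> {k \<in> nforms 1. k\<^sup>2 \<in> apolar_ideal 5 w}"
    then have k: "k \<in> nforms 1" "k\<^sup>2 \<in> apolar_ideal 5 w" by blast+
    then have "l0 dvd k" using divides1[OF k] l0(1,3) by simp
    then show "k \<in> {l0}" using nforms_1_dvd_iff[OF l0(2) k(1)] by simp
  next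
    fix k assume "k \<in> {l0}"
    then show "k \<in> {k \<in> nforms 1. k\<^sup>2 \<in> apolar_ideal 5 w}"
      using l0(2) apolar_ideal_if[OF l0sq] by blast
  qed
  then have "card {k \<in> nforms 1. k\<^sup>2 \<in> apolar_ideal 5 w} = 1" by simp
  moreover have "C w = - of_nat CARD('a)" using sum_eps_multiples[OF l0(2)] by (simp add: C_eq zeros)
  ultimately show ?thesis
    unfolding Phi_hat_formula[OF \<psi> w] by (simp add: eval_nat_numeral)
qed

lemma Phi_hat_eq_C:
  assumes "\<And>l. l \<in> nforms 1 \<Longrightarrow> l\<^sup>2 \<notin> apolar_ideal 5 w"
  shows "Phi_hat \<psi> w = C w / of_nat CARD('a) ^ 4"
proof -
  have "{l \<in> nforms 1. l\<^sup>2 \<in> apolar_ideal 5 w} = {}" using assms by blast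
  then have "card {l \<in> nforms 1. l\<^sup>2 \<in> apolar_ideal 5 w} = 0" by (simp only: card.empty)
  then show ?thesis unfolding Phi_hat_formula[OF \<psi> w] by simp
qed

text \<open>
  Only \<open>A\<^sub>0\<close> and \<open>A\<^sub>5\<close> are nonzero, so the equations read \<open>a\<^sup>2 A\<^sub>0 = 0\<close> and \<open>c\<^sup>2 A\<^sub>5 = 0\<close>, and \<open>l m\<close> is the only
  square zero.
\<close>

lemma C_split_quadratic:
  assumes lm: "l \<in> forms 1" "l \<noteq> 0" "m \<in> forms 1" "\<not> l dvd m"
    and gen: "l * m \<in> apolar 2" and no: "l \<notin> apolar 1" "m \<notin> apolar 1"
  shows "C w = -1"
proof -
  define A where "A = coord l m"
  note mono = apolar_monomials[OF lm, folded A_def]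
  have A14: "A 1 = 0" "A 2 = 0" "A 3 = 0" "A 4 = 0" and A0: "A 0 \<noteq> 0" and A5: "A 5 \<noteq> 0"
    using gen no mono by auto
  have mnz: "m \<noteq> 0" using lm by auto
  obtain t r0 where r0: "t \<noteq> 0" "r0 \<in> nforms 2" "l * m = scale t r0"
    using nforms_exists[OF forms_mult_1_1[OF lm(1,3)]] lm(2) mnz by auto
  have "square_zeros = {r0}"
  proof (intro subset_antisym subsetI)
    fix r assume r: "r \<in> square_zeros"
    have r': "r \<in> nforms 2" using r by (simp add: square_zeros_def)
    obtain a b c where abc: "r = scale a (l\<^sup>2) + scale b (l * m) + scale c (m\<^sup>2)"
      using quadratic_coordinates[OF lm nforms_forms[OF r']] .
    have "a = 0" "c = 0"
      using square_zeros_coordinates[OF lm r' abc] r A14 A0 A5 by (auto simp: A_def)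
    then have "r = scale (b * t) r0" by (simp add: abc r0(3))
    then show "r \<in> {r0}" using nforms_scale_eq[OF r0(2) r'] by simp
  next
    fix r assume "r \<in> {r0}"
    then show "r \<in> square_zeros"
      using square_zerosI[OF gen _ r0(2)] r0(1,3) lm(2) mnz nforms_nonzero[OF r0(2)] by simp
  qed
  moreover have "eps (cls 2 r0) = 1" using eps_product[OF lm r0] .
  ultimately show ?thesis by (simp add: C_eq)
qed

text \<open>
  If \<open>r\<^sup>2\<close> is apolar and \<open>r\<close> is not proportional to \<open>g\<close>, then \<open>g\<close> and \<open>r\<^sup>2\<close> are coprime and hence have no relation
  in degree \<open>5\<close>. Their multiples by cubic and by linear forms, respectively, then fill the space of
  quintic forms, of dimension \<open>4 + 2 = 6\<close>, so that \<open>w = 0\<close>.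
\<close>

lemma C_irreducible_quadratic:
  assumes w0: "w \<noteq> zero_dual" and g: "irreducible g" "g \<in> apolar 2"
  shows "C w = 1"
proof -
  have g2: "g \<in> forms 2" using apolarD[OF g(2)] .
  have gnz: "g \<noteq> 0" using g(1) by (auto simp: irreducible_def)
  obtain t r0 where r0: "t \<noteq> 0" "r0 \<in> nforms 2" "g = scale t r0" using nforms_exists[OF g2 gnz] .
  have "r0 = scale (1 / t) g" using r0 by simp
  then have irr: "irreducible r0" using irreducible_scale[OF _ g(1), of "1 / t"] r0(1) by simp
  have r0a: "r0 \<in> apolar 2" using apolar_scale_iff'[OF nforms_forms[OF r0(2)], of t] g(2) r0 by simp
  have "square_zeros = {r0}"
  proof (intro subset_antisym subsetI)
    fix r assume r: "r \<in> square_zeros"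
    have r': "r \<in> nforms 2" using r by (simp add: square_zeros_def)
    have ra: "r\<^sup>2 \<in> apolar 4"
      using r forms_power[OF nforms_forms[OF r'], of 4 2] by (simp add: square_zeros_def apolar_def)
    show "r \<in> {r0}"
    proof (rule ccontr)
      assume "r \<notin> {r0}"
      then have ne: "r \<noteq> r0" by simp
      have "u = 0 \<and> v = 0" if u: "u \<in> forms 3" and v: "v \<in> forms 1" and eq: "r0 * u + r\<^sup>2 * v = 0" for u v
      proof -
        have "r\<^sup>2 * v = r0 * (- u)" using eq by (simp add: add_eq_0_iff)
        then have "r0 dvd r\<^sup>2 * v" by simp
        then have "v = 0" using irreducible_quadratic_prime[OF r0(2) irr r' v] ne by blast
        then show ?thesis using eq nforms_nonzero[OF r0(2)] by simp
      qed
      then have "w = zero_dual"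
        using zero_if_no_relation[OF r0a ra, of 3 5 1] by simp
      then show False using w0 by simp
    qed
  next
    fix r assume "r \<in> {r0}"
    then show "r \<in> square_zeros"
      using square_zerosI[OF r0a, of r0] r0(2) nforms_nonzero[OF r0(2)] by simp
  qed
  then show ?thesis using eps_irreducible[OF nforms_forms[OF r0(2)] irr] by (simp add: C_eq)
qed

text \<open>
  With \<open>A\<^sub>0 = A\<^sub>1 = A\<^sub>2 = 0\<close> and \<open>A\<^sub>3 \<noteq> 0\<close> the solutions are \<open>l\<^sup>2\<close>, where \<open>\<epsilon>\<close> vanishes, and one further form,
  determined up to scalars: for \<open>c = 1\<close> the first equation determines \<open>b\<close> and the second then determines \<open>a\<close>.
\<close>

lemma C_cube:
  assumes l: "l \<in> forms 1" "l \<noteq> 0" and gen: "l ^ 3 \<in> apolar 3" and no: "l\<^sup>2 \<notin> apolar 2"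
  shows "C w \<in> {0, 1, -1}"
proof -
  obtain m where "m \<in> forms 1" "\<not> l dvd m" using exists_complement[OF l] .
  then have lm: "l \<in> forms 1" "l \<noteq> 0" "m \<in> forms 1" "\<not> l dvd m" using l by auto
  define A where "A = coord l m"
  note mono = apolar_monomials[OF lm, folded A_def]
  have A02: "A 0 = 0" "A 1 = 0" "A 2 = 0" and A3: "A 3 \<noteq> 0" using gen no mono by auto
  have l2: "l\<^sup>2 \<in> forms 2" using forms_power[OF l(1), of 2 2] by simp
  obtain t r0 where r0: "t \<noteq> 0" "r0 \<in> nforms 2" "l\<^sup>2 = scale t r0"
    using nforms_exists[OF l2] l(2) by auto
  have eps0: "eps (cls 2 r0) = 0"
  proof (intro eps_ramified nforms_forms[OF r0(2)])
    have "r0 = scale (1 / t) (l\<^sup>2)" using r0 by simp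
    then show "ramified_form r0" unfolding ramified_form_def using l r0(1) by (intro exI[of _ "1 / t"] bexI[of _ l]) auto
  qed
  \<comment> \<open>The values of \<open>b\<close> and \<open>a\<close> that solve \<open>2 b A\<^sub>3 + A\<^sub>4 = 0\<close> and
    \<open>(b\<^sup>2 + 2 a) A\<^sub>3 + 2 b A\<^sub>4 + A\<^sub>5 = 0\<close>, the equations for \<open>c = 1\<close>.\<close>
  define \<beta> where "\<beta> = - A 4 / (2 * A 3)"
  define \<alpha> where "\<alpha> = - (\<beta>\<^sup>2 * A 3 + 2 * \<beta> * A 4 + A 5) / (2 * A 3)"
  define p where "p = scale \<alpha> (l\<^sup>2) + scale \<beta> (l * m) + m\<^sup>2"
  have other: "\<exists>c. c \<noteq> 0 \<and> r = scale c p" if r: "r \<in> square_zeros" "r \<noteq> r0" for r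
  proof -
    have r': "r \<in> nforms 2" using r by (simp add: square_zeros_def)
    obtain a b c where abc: "r = scale a (l\<^sup>2) + scale b (l * m) + scale c (m\<^sup>2)"
      using quadratic_coordinates[OF lm nforms_forms[OF r']] .
    have E: "2 * b * c * A 3 + c\<^sup>2 * A 4 = 0" "(b\<^sup>2 + 2 * a * c) * A 3 + 2 * b * c * A 4 + c\<^sup>2 * A 5 = 0"
      using square_zeros_coordinates[OF lm r' abc] r A02 by (simp_all add: A_def)
    have c: "c \<noteq> 0"
    proof
      assume "c = 0"
      then have "b = 0" using E(2) A3 by simp
      then have "r = scale (a * t) r0" using \<open>c = 0\<close> by (simp add: abc r0(3))
      then show False using nforms_scale_eq[OF r0(2) r'] r(2) by simp
    qed
    have "c * (2 * b * A 3 + c * A 4) = 0" using E(1) by (simp add: power2_eq_square algebra_simps)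
    then have "2 * b * A 3 + c * A 4 = 0" using c by simp
    then have b2: "b * (2 * A 3) = - (c * A 4)" by (simp add: algebra_simps add_eq_0_iff2)
    have two3: "2 * A 3 \<noteq> 0" using A3 two_nonzero by simp
    have \<beta>2: "\<beta> * (2 * A 3) = - A 4" using two3 by (simp add: \<beta>_def)
    have "b * (2 * A 3) = c * (\<beta> * (2 * A 3))" unfolding \<beta>2 b2 by simp
    then have "b * (2 * A 3) = (\<beta> * c) * (2 * A 3)" by (simp only: mult.assoc mult.left_commute mult.commute)
    then have b: "b = \<beta> * c" using two3 by (metis mult_right_cancel)
    have \<alpha>2: "\<alpha> * (2 * A 3) = - (\<beta>\<^sup>2 * A 3 + 2 * \<beta> * A 4 + A 5)" using two3 by (simp add: \<alpha>_def)
    have e: "c * (a * (2 * A 3) + c * (\<beta>\<^sup>2 * A 3 + 2 * \<beta> * A 4 + A 5)) =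
        (b\<^sup>2 + 2 * a * c) * A 3 + 2 * b * c * A 4 + c\<^sup>2 * A 5"
      unfolding b by (simp add: power2_eq_square algebra_simps)
    have "c * (a * (2 * A 3) + c * (\<beta>\<^sup>2 * A 3 + 2 * \<beta> * A 4 + A 5)) = 0" unfolding e by (rule E(2))
    then have "a * (2 * A 3) + c * (\<beta>\<^sup>2 * A 3 + 2 * \<beta> * A 4 + A 5) = 0" using c by (simp only: mult_eq_0_iff simp_thms)
    then have "a * (2 * A 3) = c * (\<alpha> * (2 * A 3))" unfolding \<alpha>2 by (simp only: add_eq_0_iff2 mult_minus_right)
    then have "a * (2 * A 3) = (\<alpha> * c) * (2 * A 3)" by (simp only: mult.assoc mult.left_commute mult.commute)
    then have a: "a = \<alpha> * c" using two3 by (metis mult_right_cancel)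
    have "r = scale c p" by (simp add: abc p_def a b scale_add mult.commute)
    then show ?thesis using c by blast
  qed
  define Z where "Z = square_zeros - {r0}"
  have fin: "finite Z" using finite_square_zeros by (simp add: Z_def)
  have sub: "Z \<subseteq> nforms 2" by (auto simp: Z_def square_zeros_def)
  have "card Z \<le> 1"
  proof (rule ccontr)
    assume "\<not> card Z \<le> 1"
    then obtain xs where xs: "set xs \<subseteq> Z" "distinct xs" "length xs = 2"
      using distinct_elements_if_card_ge[of 2 Z] by auto
    then obtain r r' where rr: "r \<in> Z" "r' \<in> Z" "r \<noteq> r'" by (auto simp: length_Suc_conv numeral_2_eq_2)
    obtain c c' where "c \<noteq> 0" "r = scale c p" "r' = scale c' p" using other rr(1,2) unfolding Z_def by blast
    then have "r' = r" using square_zero_scale_eq sub rr by blast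
    then show False using rr by simp
  qed
  moreover obtain n :: int where n: "\<bar>n\<bar> \<le> int (card Z)" "(\<Sum>r\<in>Z. eps (cls 2 r)) = of_int n"
    using sum_eps_integer[OF fin sub] by blast
  ultimately have "n \<in> {-1, 0, 1}" by auto
  moreover have "(\<Sum>r\<in>square_zeros. eps (cls 2 r)) = (\<Sum>r\<in>Z. eps (cls 2 r))"
    unfolding Z_def using eps0 finite_square_zeros by (intro sum.mono_neutral_right) auto
  ultimately show ?thesis using n(2) by (auto simp: C_eq)
qed

text \<open>
  With \<open>A\<^sub>1 = A\<^sub>2 = A\<^sub>3 = 0\<close> and \<open>A\<^sub>0, A\<^sub>4 \<noteq> 0\<close> the equations are \<open>a\<^sup>2 A\<^sub>0 + c\<^sup>2 A\<^sub>4 = 0\<close> and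
  \<open>2 b c A\<^sub>4 + c\<^sup>2 A\<^sub>5 = 0\<close>. One solution is \<open>l m\<close>, where \<open>\<epsilon> = 1\<close>; for \<open>c = 1\<close> there is one value of \<open>b\<close>
  and there are at most two values of \<open>a\<close>. So \<open>C w\<close> is \<open>-1\<close> minus a sum of at most two values of \<open>\<epsilon>\<close>.
\<close>

lemma C_square_times_linear:
  assumes lm: "l \<in> forms 1" "l \<noteq> 0" "m \<in> forms 1" "\<not> l dvd m"
    and gen: "l\<^sup>2 * m \<in> apolar 3" and no: "l\<^sup>2 \<notin> apolar 2" "l * m \<notin> apolar 2"
  shows "C w \<in> {0, 1, -1, -2, -3}"
proof -
  define A where "A = coord l m"
  note mono = apolar_monomials[OF lm, folded A_def]
  have A13: "A 1 = 0" "A 2 = 0" "A 3 = 0" and A0: "A 0 \<noteq> 0" and A4: "A 4 \<noteq> 0"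
    using gen no mono by auto
  have mnz: "m \<noteq> 0" using lm by auto
  obtain t r0 where r0: "t \<noteq> 0" "r0 \<in> nforms 2" "l * m = scale t r0"
    using nforms_exists[OF forms_mult_1_1[OF lm(1,3)]] lm(2) mnz by auto
  have r0': "r0 = scale 0 (l\<^sup>2) + scale (1 / t) (l * m) + scale 0 (m\<^sup>2)" using r0 by simp
  have r0Z: "r0 \<in> square_zeros"
    using square_zeros_coordinates[OF lm r0(2) r0'] A13 by (simp add: A_def)
  have eps0: "eps (cls 2 r0) = 1" using eps_product[OF lm r0] .
  define \<beta> where "\<beta> = - A 5 / (2 * A 4)"
  have other: "\<exists>\<alpha> c. c \<noteq> 0 \<and> \<alpha>\<^sup>2 = - A 4 / A 0 \<and> r = scale c (scale \<alpha> (l\<^sup>2) + scale \<beta> (l * m) + m\<^sup>2)"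
    if r: "r \<in> square_zeros" "r \<noteq> r0" for r
  proof -
    have r': "r \<in> nforms 2" using r by (simp add: square_zeros_def)
    obtain a b c where abc: "r = scale a (l\<^sup>2) + scale b (l * m) + scale c (m\<^sup>2)"
      using quadratic_coordinates[OF lm nforms_forms[OF r']] .
    have E: "a\<^sup>2 * A 0 + c\<^sup>2 * A 4 = 0" "2 * b * c * A 4 + c\<^sup>2 * A 5 = 0"
      using square_zeros_coordinates[OF lm r' abc] r A13 by (simp_all add: A_def)
    have c: "c \<noteq> 0"
    proof
      assume "c = 0"
      then have "a = 0" using E(1) A0 by simp
      then have "r = scale (b * t) r0" using \<open>c = 0\<close> by (simp add: abc r0(3))
      then show False using nforms_scale_eq[OF r0(2) r'] r(2) by simp
    qed
    have "c * (b * (2 * A 4) + c * A 5) = 0" using E(2) by (simp add: power2_eq_square algebra_simps)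
    then have b2: "b * (2 * A 4) = - (c * A 5)" using c by (simp add: add_eq_0_iff2)
    have two4: "2 * A 4 \<noteq> 0" using A4 two_nonzero by simp
    have \<beta>2: "\<beta> * (2 * A 4) = - A 5" using two4 by (simp add: \<beta>_def)
    have "b * (2 * A 4) = c * (\<beta> * (2 * A 4))" unfolding \<beta>2 b2 by simp
    then have "b * (2 * A 4) = (\<beta> * c) * (2 * A 4)" by (simp only: mult.assoc mult.left_commute mult.commute)
    then have b: "b = \<beta> * c" using two4 by (metis mult_right_cancel)
    have "a\<^sup>2 * A 0 = - (c\<^sup>2 * A 4)" using E(1) by (simp add: add_eq_0_iff2)
    then have "(a / c)\<^sup>2 = - A 4 / A 0" using A0 c by (simp add: power_divide field_simps)
    moreover have "r = scale c (scale (a / c) (l\<^sup>2) + scale \<beta> (l * m) + m\<^sup>2)"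
      using c by (simp add: abc b scale_add mult.commute)
    ultimately show ?thesis using c by blast
  qed
  define Z where "Z = square_zeros - {r0}"
  have fin: "finite Z" using finite_square_zeros by (simp add: Z_def)
  have sub: "Z \<subseteq> nforms 2" by (auto simp: Z_def square_zeros_def)
  have "card Z \<le> 2"
  proof (rule ccontr)
    assume "\<not> card Z \<le> 2"
    then obtain xs where xs: "set xs \<subseteq> Z" "distinct xs" "length xs = 3"
      using distinct_elements_if_card_ge[of 3 Z] by auto
    then obtain r1 r2 r3 where rr: "r1 \<in> Z" "r2 \<in> Z" "r3 \<in> Z" "r1 \<noteq> r2" "r1 \<noteq> r3" "r2 \<noteq> r3"
      by (auto simp: length_Suc_conv numeral_3_eq_3)
    let ?p = "\<lambda>\<alpha>. scale \<alpha> (l\<^sup>2) + scale \<beta> (l * m) + m\<^sup>2"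
    obtain x1 c1 where 1: "c1 \<noteq> 0" "x1\<^sup>2 = - A 4 / A 0" "r1 = scale c1 (?p x1)" using other[of r1] rr(1) unfolding Z_def by blast
    obtain x2 c2 where 2: "c2 \<noteq> 0" "x2\<^sup>2 = - A 4 / A 0" "r2 = scale c2 (?p x2)" using other[of r2] rr(2) unfolding Z_def by blast
    obtain x3 c3 where 3: "c3 \<noteq> 0" "x3\<^sup>2 = - A 4 / A 0" "r3 = scale c3 (?p x3)" using other[of r3] rr(3) unfolding Z_def by blast
    have "x1 = x2 \<or> x1 = x3 \<or> x2 = x3" using 1(2) 2(2) 3(2) by (metis power2_eq_iff)
    moreover
    have ne: False if "r \<in> Z" "r' \<in> Z" "r \<noteq> r'" "c \<noteq> 0" "r = scale c (?p x)" "r' = scale c' (?p x')" "x = x'"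
      for r r' c c' x x'
      using square_zero_scale_eq[of r r' c "?p x" c'] that sub by blast
    have "x1 \<noteq> x2" using ne[OF rr(1,2,4) 1(1,3) 2(3)] by blast
    moreover have "x1 \<noteq> x3" using ne[OF rr(1,3,5) 1(1,3) 3(3)] by blast
    moreover have "x2 \<noteq> x3" using ne[OF rr(2,3,6) 2(1,3) 3(3)] by blast
    ultimately show False by blast
  qed
  moreover obtain n :: int where n: "\<bar>n\<bar> \<le> int (card Z)" "(\<Sum>r\<in>Z. eps (cls 2 r)) = of_int n"
    using sum_eps_integer[OF fin sub] by blast
  ultimately have "n \<in> {-2, -1, 0, 1, 2}" by auto
  moreover have "(\<Sum>r\<in>square_zeros. eps (cls 2 r)) = 1 + (\<Sum>r\<in>Z. eps (cls 2 r))"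
    unfolding Z_def using sum.remove[OF finite_square_zeros r0Z, of "\<lambda>r. eps (cls 2 r)"] eps0 by simp
  ultimately show ?thesis using n(2) by (auto simp: C_eq)
qed

end

section \<open>Cubic generators: at most four square zeros\<close>

lemma eq_scale_minus_1: "f + g = 0 \<Longrightarrow> g = scale (- 1) f"
  by (simp add: scale_minus_1 add_eq_0_iff)

lemma independent_if_not_in_span:
  assumes f: "f \<noteq> 0" and g: "\<And>x. g \<noteq> scale x f" and e: "\<And>x y. e \<noteq> scale x f + scale y g"
    and eq: "scale a f + scale b g + scale c e = 0"
  shows "a = 0 \<and> b = 0 \<and> c = 0"
proof -
  have c: "c = 0"
  proof (rule ccontr)
    assume "c \<noteq> 0"
    have "scale c e = scale (- 1) (scale a f + scale b g)" by (rule eq_scale_minus_1[OF eq])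
    then have "scale (1 / c) (scale c e) = scale (1 / c) (scale (- 1) (scale a f + scale b g))" by simp
    then have "e = scale (- a / c) f + scale (- b / c) g" using \<open>c \<noteq> 0\<close> by (simp add: scale_add)
    then show False using e by blast
  qed
  have b: "b = 0"
  proof (rule ccontr)
    assume "b \<noteq> 0"
    have "scale b g = scale (- 1) (scale a f)" using eq c by (intro eq_scale_minus_1) simp
    then have "scale (1 / b) (scale b g) = scale (1 / b) (scale (- 1) (scale a f))" by simp
    then have "g = scale (- a / b) f" using \<open>b \<noteq> 0\<close> by simp
    then show False using g by blast
  qed
  show ?thesis using eq b c f by simp
qed

lemma span_if_independent:
  fixes f g e :: "'a::{field,finite} binpoly"
  assumes f: "f \<in> forms 2" "g \<in> forms 2" "e \<in> forms 2"
    and ind: "\<And>a b c. scale a f + scale b g + scale c e = 0 \<Longrightarrow> a = 0 \<and> b = 0 \<and> c = 0"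
    and k: "k \<in> forms 2"
  obtains a b c where "k = scale a f + scale b g + scale c e"
proof -
  let ?m = "\<lambda>(a, b, c). scale a f + scale b g + scale c e"
  have diff: "scale a f + scale b g + scale c e - (scale a' f + scale b' g + scale c' e) =
      scale (a - a') f + scale (b - b') g + scale (c - c') e" for a b c a' b' c'
  proof -
    have "scale (x - y) h = scale x h - scale y h" for x y and h :: "'a binpoly"
      using smult_diff_left[of "[:x:]" "[:y:]" h] by (simp add: scale_def)
    then show ?thesis by simp
  qed
  have "inj ?m"
  proof (rule injI)
    fix x y assume eq: "?m x = ?m y"
    obtain a b c where x: "x = (a, b, c)" by (cases x)
    obtain a' b' c' where y: "y = (a', b', c')" by (cases y)
    have "scale (a - a') f + scale (b - b') g + scale (c - c') e = 0"
      unfolding diff[symmetric] using eq by (simp add: x y)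
    then have "a - a' = 0 \<and> b - b' = 0 \<and> c - c' = 0" by (rule ind)
    then show "x = y" by (simp add: x y)
  qed
  then have "card (range ?m) = CARD('a \<times> 'a \<times> 'a)" by (rule card_image)
  also have "\<dots> = card (forms 2 :: 'a binpoly set)" by (simp add: card_forms eval_nat_numeral)
  finally have card: "card (range ?m) = card (forms 2 :: 'a binpoly set)" .
  have "range ?m \<subseteq> forms 2" using f by (auto intro!: forms_add forms_scale)
  then have "range ?m = forms 2" using card by (intro card_subset_eq) simp_all
  then have "k \<in> range ?m" using k by simp
  then obtain x where "k = ?m x" by blast
  then show ?thesis using that by (cases x) auto
qed

text \<open>
  In odd characteristic there are at least four linear forms up to scalars, namely
  \<open>x, y, x + y, x - y\<close>, and a nonzero cubic form is not divisible by all of them.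
\<close>

lemma cubic_not_divisible_by_all:
  fixes \<phi> :: "'a::{field,finite} binpoly"
  assumes "CHAR('a) > 2" and \<phi>: "\<phi> \<in> forms 3" "\<phi> \<noteq> 0"
  shows "\<exists>l\<in>nforms 1. \<not> l dvd \<phi>"
proof (rule ccontr)
  assume "\<not> (\<exists>l\<in>nforms 1. \<not> l dvd \<phi>)"
  then have all: "l dvd \<phi>" if "l \<in> nforms 1" for l
    using that by blast
  have two: "(1 :: 'a) \<noteq> -1"
  proof
    assume "(1 :: 'a) = - 1"
    then have "1 + 1 = (0 :: 'a)" by (simp only: eq_neg_iff_add_eq_0)
    then have "of_nat 2 = (0 :: 'a)" by simp
    then have "CHAR('a) dvd 2" by (simp only: of_nat_eq_0_iff_char_dvd)
    then have "CHAR('a) \<le> 2" by (rule dvd_imp_le) simp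
    then show False using assms(1) by simp
  qed
  define P where "P = X + (Y :: 'a binpoly)"
  define M where "M = X - (Y :: 'a binpoly)"
  have dP: "dehom P = [:1, 1:]" and dM: "dehom M = [:-1, 1:]" by (simp_all add: P_def M_def one_pCons)
  have PM: "P \<in> nforms 1" "M \<in> nforms 1"
    using X_forms Y_forms dP dM by (auto simp: nforms_def P_def M_def)
  have ne: "X \<noteq> (Y :: 'a binpoly)" "P \<noteq> X" "P \<noteq> Y" "M \<noteq> X" "M \<noteq> Y" "P \<noteq> M"
    using two by (auto simp: dP dM X_neq_Y one_pCons dest!: arg_cong[of _ _ dehom])
  obtain g where g: "\<phi> = X * g" "g \<in> forms (3 - 1)"
    using form_dvdE[OF all[OF X_nforms] \<phi>(1) X_forms nforms_nonzero[OF X_nforms]] by auto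
  have g2: "g \<in> forms 2" using g(2) by simp
  have "\<not> Y dvd (X :: 'a binpoly)"
    unfolding nforms_1_dvd_iff[OF Y_nforms X_nforms] using ne(1)[symmetric] .
  then have "Y dvd g"
    using linear_prime[OF Y_forms nforms_nonzero[OF Y_nforms] X_forms g2] all[OF Y_nforms] g(1) by blast
  then obtain h where h: "g = Y * h" "h \<in> forms (2 - 1)"
    using form_dvdE[OF _ g2 Y_forms nforms_nonzero[OF Y_nforms]] by auto
  have h1: "h \<in> forms 1" using h(2) by simp
  have eq: "\<phi> = X * Y * h" by (simp add: g h mult.assoc)
  have "k dvd h" if k: "k \<in> nforms 1" "k \<noteq> X" "k \<noteq> Y" for k
  proof -
    have "\<not> k dvd X * Y" using nforms_1_dvd_mult_iff[OF k(1) X_nforms Y_nforms] k by simp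
    then show ?thesis
      using linear_prime[OF nforms_forms[OF k(1)] nforms_nonzero[OF k(1)] forms_mult_1_1[OF X_forms Y_forms] h1]
        all[OF k(1)] eq by simp
  qed
  then have "P dvd h" "M dvd h" using PM ne by auto
  moreover have "h \<noteq> 0" using \<phi>(2) eq by auto
  ultimately obtain c h0 where h0: "c \<noteq> 0" "h0 \<in> nforms 1" "h = scale c h0" using nforms_exists[OF h1] by blast
  then have "P dvd h0" "M dvd h0" using \<open>P dvd h\<close> \<open>M dvd h\<close> by simp_all
  then have "P = h0" "M = h0" using nforms_1_dvd_iff PM h0(2) by blast+
  then show False using ne by simp
qed

context quintic_functional
begin

lemma apolar_cubics_proportional:
  assumes rank: "hankel_rank w = 3" and p: "p \<in> apolar 3" "p \<noteq> 0" and r: "r \<in> apolar 3"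
  obtains c where "r = scale c p"
proof -
  have "CARD('a) ^ 3 * card (apolar 3) = CARD('a) ^ 3 * CARD('a)"
    using card_apolar_3 rank by (simp add: eval_nat_numeral mult_ac)
  then have card: "card (apolar 3) = CARD('a)" by simp
  have sub: "(\<lambda>c. scale c p) ` UNIV \<subseteq> apolar 3" using apolar_scale[OF p(1)] by auto
  have "(\<lambda>c. scale c p) ` UNIV = apolar 3"
    by (rule card_subset_eq[OF finite_apolar sub]) (simp only: card card_multiples[OF p(2)])
  then show ?thesis using r that by blast
qed

lemma linear_on_scale_sum3:
  assumes u: "linear_on n u" and f: "f1 \<in> forms n" "f2 \<in> forms n" "f3 \<in> forms n"
  shows "u (scale c1 f1 + scale c2 f2 + scale c3 f3) = c1 * u f1 + c2 * u f2 + c3 * u f3"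
  using f by (simp add: linear_on_add[OF u] linear_on_scale[OF u] forms_add forms_scale)

lemma pairing_expand:
  assumes "k \<in> forms 2" "f \<in> forms 2" "g \<in> forms 2" "e \<in> forms 2" "l \<in> forms 1"
  shows "w (k * (scale a f + scale b g + scale c e) * l) =
    a * w (k * f * l) + b * w (k * g * l) + c * w (k * e * l)"
proof -
  have form5: "k * x * l \<in> forms 5" if "x \<in> forms 2" for x
    using forms_mult'[OF forms_mult[OF assms(1) that] assms(5), of 5] by simp
  have "k * (scale a f + scale b g + scale c e) * l =
      scale a (k * f * l) + scale b (k * g * l) + scale c (k * e * l)"
    by (simp only: distrib_left distrib_right scale_mult_left scale_mult_right)
  then show ?thesis
    using linear_on_scale_sum3[OF lin form5[OF assms(2)] form5[OF assms(3)] form5[OF assms(4)]] by (simp only:)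
qed

lemma square_zero_pairing:
  assumes "f \<in> square_zeros" "l \<in> forms 1"
  shows "w (f * f * l) = 0"
  using square_zeros_iff[of f] assms by (auto simp: square_zeros_def power2_eq_square)

lemma square_zeros_forms: "f \<in> square_zeros \<Longrightarrow> f \<in> nforms 2 \<and> f \<in> forms 2 \<and> f \<noteq> 0"
  using nforms_forms nforms_nonzero by (auto simp: square_zeros_def)

text \<open>
  Suppose that \<open>f, g, h\<close> are square zeros on a line of the projective plane of quadratic forms. Expanding \<open>w (h\<^sup>2 l) = 0\<close>
  gives \<open>w (f g l) = 0\<close>, so for each linear \<open>l\<close> the span of \<open>f\<close> and \<open>g\<close> is isotropic for the symmetric bilinear
  form \<open>(k, k') \<mapsto> w (k k' l)\<close> on the \<open>3\<close>-dimensional space of quadratic forms. Such a form has a nonzero \<open>k\<close> of that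
  span in its radical, which means that the cubic \<open>l k\<close> is apolar. Since all apolar cubics are
  proportional, every \<open>l\<close> divides the same cubic, which is impossible.
\<close>

lemma square_zeros_not_collinear:
  assumes rank: "hankel_rank w = 3" and f: "f \<in> square_zeros" and g: "g \<in> square_zeros"
    and h: "h \<in> square_zeros" and ne: "f \<noteq> g" "f \<noteq> h" "g \<noteq> h"
  shows "h \<noteq> scale \<alpha> f + scale \<beta> g"
proof
  assume heq: "h = scale \<alpha> f + scale \<beta> g"
  have F: "f \<in> nforms 2" "f \<in> forms 2" "f \<noteq> 0" and G: "g \<in> nforms 2" "g \<in> forms 2" "g \<noteq> 0"
    and H: "h \<in> nforms 2"
    using square_zeros_forms[OF f] square_zeros_forms[OF g] square_zeros_forms[OF h] by simp_all
  have "\<alpha> \<noteq> 0"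
  proof
    assume "\<alpha> = 0"
    then have "h = scale \<beta> g" using heq by simp
    from nforms_scale_eq[OF G(1) H this] show False using ne(3) by simp
  qed
  have "\<beta> \<noteq> 0"
  proof
    assume "\<beta> = 0"
    then have "h = scale \<alpha> f" using heq by simp
    from nforms_scale_eq[OF F(1) H this] show False using ne(2) by simp
  qed
  have fg: "w (f * g * l) = 0" if l: "l \<in> forms 1" for l
  proof -
    have "w (h\<^sup>2 * l) = 0" using square_zeros_iff[OF H] h l by blast
    moreover have "h = scale \<alpha> f + scale \<beta> g + scale 0 f" using heq by simp
    ultimately have "2 * \<alpha> * \<beta> * w (f * g * l) = 0"
      using square_pairing_general[OF lin F(2) G(2) F(2) l, of \<alpha> \<beta> 0]
        square_zero_pairing[OF f l] square_zero_pairing[OF g l] by simp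
    then show ?thesis using \<open>\<alpha> \<noteq> 0\<close> \<open>\<beta> \<noteq> 0\<close> two_nonzero by simp
  qed
  have gf: "g \<noteq> scale c f" for c
  proof
    assume "g = scale c f"
    from nforms_scale_eq[OF F(1) G(1) this] show False using ne(1) by simp
  qed
  obtain e where e: "e \<in> forms 2" "e \<notin> range (\<lambda>(a, b). scale a f + scale b g)"
  proof -
    have "card (range (\<lambda>(a :: 'a, b). scale a f + scale b g)) \<le> CARD('a \<times> 'a)"
      by (rule card_image_le) simp
    also have "\<dots> < card (forms 2 :: 'a binpoly set)" using card_gt_1 by (simp add: card_forms eval_nat_numeral)
    finally have less: "card (range (\<lambda>(a :: 'a, b). scale a f + scale b g)) < card (forms 2 :: 'a binpoly set)" .
    have "\<not> forms 2 \<subseteq> range (\<lambda>(a :: 'a, b). scale a f + scale b g)"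
    proof
      assume "forms 2 \<subseteq> range (\<lambda>(a :: 'a, b). scale a f + scale b g)"
      from card_mono[OF finite_imageI[OF finite] this] show False using less by linarith
    qed
    then obtain e where "e \<in> forms 2" "e \<notin> range (\<lambda>(a :: 'a, b). scale a f + scale b g)" by blast
    then show ?thesis by (rule that)
  qed
  have "e \<noteq> scale a f + scale b g" for a b
  proof
    assume "e = scale a f + scale b g"
    then have "e = (\<lambda>(a, b). scale a f + scale b g) (a, b)" by simp
    then show False using e(2) by blast
  qed
  note ind = independent_if_not_in_span[OF F(3) gf this]
  have ex: "\<exists>p. p \<noteq> 0 \<and> p \<in> apolar 3 \<and> l dvd p" if l: "l \<in> forms 1" "l \<noteq> 0" for l
  proof -
    \<comment> \<open>The combination \<open>s f + t g\<close> that is also orthogonal to the third basis vector \<open>e\<close>.\<close>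
    obtain s t where st: "s \<noteq> 0 \<or> t \<noteq> 0" "s * w (f * e * l) + t * w (g * e * l) = 0"
    proof (cases "w (f * e * l) = 0")
      case True
      then show ?thesis using that[of 1 0] by simp
    next
      case False
      then show ?thesis using that[of "- w (g * e * l)" "w (f * e * l)"] by (simp add: mult.commute)
    qed
    define k where "k = scale s f + scale t g"
    have k: "k \<in> forms 2" "k \<noteq> 0" using F(2) G(2) ind[of s t 0] st(1) by (auto simp: k_def)
    have pair: "w (k * x * l) = s * w (f * x * l) + t * w (g * x * l)" if x: "x \<in> forms 2" for x
    proof -
      have kx: "k * x * l = x * (scale s f + scale t g + scale 0 f) * l" by (simp add: k_def mult.commute)
      show ?thesis unfolding kx pairing_expand[OF x F(2) G(2) F(2) l(1)] by (simp add: mult.commute)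
    qed
    have kf: "w (k * f * l) = 0" using pair[OF F(2)] square_zero_pairing[OF f l(1)] fg[OF l(1)]
      by (simp add: mult.commute[of g f])
    have kg: "w (k * g * l) = 0" using pair[OF G(2)] square_zero_pairing[OF g l(1)] fg[OF l(1)] by simp
    have ke: "w (k * e * l) = 0" using pair[OF e(1)] st(2) by simp
    have "w (k * x * l) = 0" if x: "x \<in> forms 2" for x
    proof -
      obtain a b c where "x = scale a f + scale b g + scale c e"
        using span_if_independent[OF F(2) G(2) e(1) ind x] .
      then show ?thesis using pairing_expand[OF k(1) F(2) G(2) e(1) l(1)] kf kg ke by simp
    qed
    moreover have lk: "l * k \<in> forms 3" using forms_mult'[OF l(1) k(1), of 3] by simp
    ultimately have "l * k \<in> apolar 3"
      using apolar_eq[of 3 2 "l * k"] by (simp add: mult_ac)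
    then show ?thesis using l(2) k(2) by (intro exI[of _ "l * k"]) simp
  qed
  obtain p where p: "p \<noteq> 0" "p \<in> apolar 3" using ex[OF X_forms nforms_nonzero[OF X_nforms]] by blast
  obtain l where ln: "l \<in> nforms 1" "\<not> l dvd p"
    using cubic_not_divisible_by_all[OF char apolarD[OF p(2)] p(1)] by blast
  have l: "l \<in> forms 1" "l \<noteq> 0" "\<not> l dvd p" using nforms_forms[OF ln(1)] nforms_nonzero[OF ln(1)] ln(2) .
  obtain p' where p': "p' \<noteq> 0" "p' \<in> apolar 3" "l dvd p'" using ex[OF l(1,2)] by blast
  obtain c where "p = scale c p'" using apolar_cubics_proportional[OF rank p'(2,1) p(2)] .
  then show False using l(3) scale_dvd[OF p'(3), of c] by simp
qed

text \<open>
  Given five square zeros, take the first three as a basis of the quadratic forms; the pairings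
  \<open>\<alpha>, \<beta>, \<gamma>\<close> of distinct basis vectors are linear in \<open>l\<close>. Choose \<open>l \<noteq> 0\<close> with \<open>\<alpha> l = 0\<close>. The other two square zeros
  give two linear equations for \<open>\<beta> l\<close> and \<open>\<gamma> l\<close>, independent because no three of the points are collinear. So
  the pairing \<open>(k, k') \<mapsto> w (k k' l)\<close> vanishes, and \<open>l f\<close> is apolar for all quadratic \<open>f\<close>; but the apolar cubics
  are proportional.
\<close>

lemma card_square_zeros_le_4:
  assumes rank: "hankel_rank w = 3"
  shows "card square_zeros \<le> 4"
proof (rule ccontr)
  assume "\<not> card square_zeros \<le> 4"
  then obtain xs where xs: "set xs \<subseteq> square_zeros" "distinct xs" "length xs = 5"
    using distinct_elements_if_card_ge[of 5 square_zeros] by auto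
  obtain f1 f2 f3 f4 f5 where xse: "xs = [f1, f2, f3, f4, f5]"
    using xs(3) by (auto simp: length_Suc_conv eval_nat_numeral)
  have f: "f1 \<in> square_zeros" "f2 \<in> square_zeros" "f3 \<in> square_zeros" "f4 \<in> square_zeros" "f5 \<in> square_zeros"
    and d: "f1 \<noteq> f2" "f1 \<noteq> f3" "f1 \<noteq> f4" "f1 \<noteq> f5" "f2 \<noteq> f3" "f2 \<noteq> f4" "f2 \<noteq> f5" "f3 \<noteq> f4" "f3 \<noteq> f5" "f4 \<noteq> f5"
    using xs(1,2) unfolding xse by auto
  note col = square_zeros_not_collinear[OF rank]
  have F: "f1 \<in> forms 2" "f2 \<in> forms 2" "f3 \<in> forms 2" and N: "f1 \<in> nforms 2" "f2 \<in> nforms 2"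
    using square_zeros_forms[OF f(1)] square_zeros_forms[OF f(2)] square_zeros_forms[OF f(3)] by simp_all
  have f21: "f2 \<noteq> scale c f1" for c
  proof
    assume "f2 = scale c f1"
    from nforms_scale_eq[OF N this] show False using d(1) by simp
  qed
  have f3: "f3 \<noteq> scale a f1 + scale b f2" for a b using col[OF f(1,2,3) d(1,2,5)] .
  have f10: "f1 \<noteq> 0" using nforms_nonzero[OF N(1)] .
  note ind = independent_if_not_in_span[OF f10 f21 f3]
  obtain x1 x2 x3 where x: "f4 = scale x1 f1 + scale x2 f2 + scale x3 f3"
    using span_if_independent[OF F ind conjunct1[OF conjunct2[OF square_zeros_forms[OF f(4)]]]] .
  obtain y1 y2 y3 where y: "f5 = scale y1 f1 + scale y2 f2 + scale y3 f3"
    using span_if_independent[OF F ind conjunct1[OF conjunct2[OF square_zeros_forms[OF f(5)]]]] .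
  have x1: "x1 \<noteq> 0" using x col[OF f(2,3,4) d(5,6,8), of x2 x3] by auto
  have x3: "x3 \<noteq> 0" using x col[OF f(1,2,4) d(1,3,6), of x1 x2] by auto
  have y3: "y3 \<noteq> 0" using y col[OF f(1,2,5) d(1,4,7), of y1 y2] by auto
  \<comment> \<open>Otherwise \<open>f3\<close>, \<open>f4\<close> and \<open>f5\<close> are collinear.\<close>
  have det: "x1 * y2 - x2 * y1 \<noteq> 0"
  proof
    assume 0: "x1 * y2 - x2 * y1 = 0"
    have "y2 = y1 / x1 * x2" using 0 x1 by (simp add: field_simps)
    moreover have "y1 = y1 / x1 * x1" using x1 by simp
    moreover have "y3 = y1 / x1 * x3 + (y3 - y1 / x1 * x3) * 1" by simp
    ultimately have "f5 = scale (y1 / x1) f4 + scale (y3 - y1 / x1 * x3) f3"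
    proof -
      have sd: "scale (u - v) h = scale u h - scale v h" for u v and h :: "'a binpoly"
        using smult_diff_left[of "[:u:]" "[:v:]" h] by (simp add: scale_def)
      have "scale (y1 / x1) f4 + scale (y3 - y1 / x1 * x3) f3 =
          scale (y1 / x1 * x1) f1 + scale (y1 / x1 * x2) f2 + scale y3 f3"
        unfolding x scale_add scale_simps sd by simp
      then show ?thesis using \<open>y2 = y1 / x1 * x2\<close> \<open>y1 = y1 / x1 * x1\<close> y by metis
    qed
    then show False using col[OF f(4,3,5) d(8)[symmetric] d(10,9)] by blast
  qed
  define \<alpha> where "\<alpha> l = w (f1 * f2 * l)" for l
  define \<beta> where "\<beta> l = w (f1 * f3 * l)" for l
  define \<gamma> where "\<gamma> l = w (f2 * f3 * l)" for l
  have rel: "a * b * \<alpha> l + a * c * \<beta> l + b * c * \<gamma> l = 0"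
    if g: "g \<in> square_zeros" "g = scale a f1 + scale b f2 + scale c f3" and l: "l \<in> forms 1" for g a b c l
  proof -
    have "w (g\<^sup>2 * l) = 0" using square_zeros_iff[of g] square_zeros_forms[OF g(1)] g(1) l by simp
    then have "2 * (a * b * \<alpha> l + a * c * \<beta> l + b * c * \<gamma> l) = 0"
      using square_pairing_general[OF lin F l, of a b c] square_zero_pairing[OF f(1) l]
        square_zero_pairing[OF f(2) l] square_zero_pairing[OF f(3) l]
      by (simp add: g(2) \<alpha>_def \<beta>_def \<gamma>_def algebra_simps)
    then show ?thesis using two_nonzero by (simp only: mult_eq_0_iff simp_thms)
  qed
  obtain l where l: "l \<in> forms 1" "l \<noteq> 0" "\<alpha> l = 0"
  proof (cases "\<alpha> X = 0")
    case True
    then show ?thesis using that[OF X_forms nforms_nonzero[OF X_nforms]] by blast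
  next
    case False
    \<comment> \<open>\<open>\<alpha>\<close> is a linear functional on the \<open>2\<close>-dimensional space of linear forms.\<close>
    let ?l = "scale (\<alpha> Y) X + scale (- \<alpha> X) Y"
    have u: "linear_on 1 \<alpha>"
      unfolding \<alpha>_def using linear_on_polar'[of 4 1 w "f1 * f2"] lin forms_mult'[OF F(1,2), of 4] by simp
    have "\<alpha> ?l = 0"
      using linear_on_add[OF u forms_scale[OF X_forms] forms_scale[OF Y_forms]]
        linear_on_scale[OF u X_forms] linear_on_scale[OF u Y_forms] by (simp add: mult.commute)
    moreover have "?l \<noteq> 0"
    proof
      assume "?l = 0"
      then have "dehom ?l = 0" by (simp only: dehom_0)
      then show False using False by (simp add: one_pCons)
    qed
    moreover have "?l \<in> forms 1" using X_forms Y_forms by blast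
    ultimately show ?thesis using that by blast
  qed
  have "x3 * (x1 * \<beta> l + x2 * \<gamma> l) = 0" "y3 * (y1 * \<beta> l + y2 * \<gamma> l) = 0"
    using rel[OF f(4) x l(1)] rel[OF f(5) y l(1)] l(3) by (simp_all add: algebra_simps)
  then have e: "x1 * \<beta> l + x2 * \<gamma> l = 0" "y1 * \<beta> l + y2 * \<gamma> l = 0" using x3 y3 by simp_all
  have "(x1 * y2 - x2 * y1) * \<beta> l = y2 * (x1 * \<beta> l + x2 * \<gamma> l) - x2 * (y1 * \<beta> l + y2 * \<gamma> l)"
    by (simp add: algebra_simps)
  then have \<beta>0: "\<beta> l = 0" using e det by simp
  have "(x1 * y2 - x2 * y1) * \<gamma> l = x1 * (y1 * \<beta> l + y2 * \<gamma> l) - y1 * (x1 * \<beta> l + x2 * \<gamma> l)"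
    by (simp add: algebra_simps)
  then have \<gamma>0: "\<gamma> l = 0" using e det by simp
  have apol: "l * g \<in> apolar 3"
    if g: "g \<in> forms 2" "w (g * f1 * l) = 0" "w (g * f2 * l) = 0" "w (g * f3 * l) = 0" for g
  proof -
    have "w (l * g * h) = 0" if h: "h \<in> forms 2" for h
    proof -
      obtain a b c where "h = scale a f1 + scale b f2 + scale c f3"
        using span_if_independent[OF F ind h] .
      moreover have "w (g * (scale a f1 + scale b f2 + scale c f3) * l) = 0" for a b c
        using pairing_expand[OF g(1) F l(1)] g(2-4) by simp
      ultimately show ?thesis by (simp add: mult_ac)
    qed
    moreover have "l * g \<in> forms 3" using forms_mult'[OF l(1) g(1), of 3] by simp
    ultimately show ?thesis using apolar_eq[of 3 2 "l * g"] by simp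
  qed
  have a1: "l * f1 \<in> apolar 3"
    using apol[OF F(1)] square_zero_pairing[OF f(1) l(1)] l(3) \<beta>0 by (simp add: \<alpha>_def \<beta>_def)
  have a2: "l * f2 \<in> apolar 3"
    using apol[OF F(2)] square_zero_pairing[OF f(2) l(1)] l(3) \<gamma>0
    by (simp add: \<alpha>_def \<gamma>_def mult.commute[of f2 f1])
  have nz: "l * f1 \<noteq> 0" using l(2) square_zeros_forms[OF f(1)] by simp
  obtain c where "l * f2 = scale c (l * f1)" using apolar_cubics_proportional[OF rank a1 nz a2] .
  then have "l * f2 = l * scale c f1" by (simp add: scale_mult_right)
  then have "f2 = scale c f1" using l(2) by simp
  from nforms_scale_eq[OF N(1,2) this] show False using d(1) by simp
qed

lemma C_generic:
  assumes "hankel_rank w = 3"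
  shows "C w \<in> {0, 1, -1, 2, -2, 3, -3, 4, -4}"
proof -
  have sub: "square_zeros \<subseteq> nforms 2" by (auto simp: square_zeros_def)
  obtain n :: int where n: "\<bar>n\<bar> \<le> int (card square_zeros)" "(\<Sum>r\<in>square_zeros. eps (cls 2 r)) = of_int n"
    using sum_eps_integer[OF finite_square_zeros sub] by blast
  then have "n \<in> {0, 1, -1, 2, -2, 3, -3, 4, -4}" using card_square_zeros_le_4[OF assms] by auto
  then show ?thesis using n(2) by (auto simp: C_eq)
qed

section \<open>Waring types\<close>

lemma waring_type_generator:
  assumes "has_waring_type w T" "T \<noteq> {#}"
  obtains \<phi> where "w \<noteq> zero_dual" "\<phi> \<in> apolar (hankel_rank w)" "\<phi> \<in> forms (hankel_rank w)" "\<phi> \<noteq> 0"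
    "has_splitting_type \<phi> T"
proof -
  have "w \<noteq> zero_dual" using assms unfolding has_waring_type_def by auto
  then obtain \<phi> where "is_least_generator w \<phi>" "has_splitting_type \<phi> T"
    using assms unfolding has_waring_type_def by auto
  then show ?thesis using that \<open>w \<noteq> zero_dual\<close> unfolding is_least_generator_def by (auto simp: apolar_def)
qed

lemma waring_type_power:
  assumes "has_waring_type w {#(d, e)#}" "d * e \<le> 5"
  obtains g where "w \<noteq> zero_dual" "irreducible g" "g \<in> forms d" "g ^ e \<in> apolar (d * e)" "hankel_rank w = d * e" "g \<noteq> 0"
proof -
  obtain \<phi> where \<phi>: "w \<noteq> zero_dual" "\<phi> \<in> apolar (hankel_rank w)" "\<phi> \<in> forms (hankel_rank w)" "\<phi> \<noteq> 0"
    "has_splitting_type \<phi> {#(d, e)#}" using waring_type_generator[OF assms(1)] by auto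
  obtain c g where g: "c \<noteq> 0" "irreducible g" "g \<in> forms d" "\<phi> = scale c (g ^ e)"
    using splitting_type_single[OF \<phi>(5)] .
  have ge: "g ^ e \<in> forms (d * e)" using g(3) by (rule forms_power) simp
  then have "\<phi> \<in> forms (d * e)" by (simp add: g(4) forms_scale)
  then have rank: "hankel_rank w = d * e" using forms_degree_unique[OF \<phi>(3) _ \<phi>(4)] by simp
  have "g ^ e \<in> apolar (d * e)"
    using apolar_scale_iff'[OF ge assms(2) g(1)] \<phi>(2) rank g(4) by simp
  moreover have "g \<noteq> 0" using g(2) by (auto simp: irreducible_def)
  ultimately show ?thesis using that \<phi>(1) g rank by blast
qed

lemma waring_type_two_linear:
  assumes "has_waring_type w {#(1, e1), (1, e2)#}" "e1 + e2 \<le> 5"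
  obtains g h where "w \<noteq> zero_dual" "g \<in> forms 1" "g \<noteq> 0" "h \<in> forms 1" "\<not> g dvd h"
    "g ^ e1 * h ^ e2 \<in> apolar (e1 + e2)" "hankel_rank w = e1 + e2"
proof -
  obtain \<phi> where \<phi>: "w \<noteq> zero_dual" "\<phi> \<in> apolar (hankel_rank w)" "\<phi> \<in> forms (hankel_rank w)" "\<phi> \<noteq> 0"
    "has_splitting_type \<phi> {#(1, e1), (1, e2)#}" using waring_type_generator[OF assms(1)] by auto
  obtain c g h where g: "c \<noteq> 0" "g \<in> forms 1" "h \<in> forms 1" "irreducible g" "irreducible h"
    "\<not> proportional g h" "\<phi> = scale c (g ^ e1 * h ^ e2)"
    using splitting_type_pair[OF \<phi>(5)] .
  have ge: "g ^ e1 * h ^ e2 \<in> forms (e1 + e2)"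
    by (rule forms_mult'[OF forms_power[OF g(2) refl] forms_power[OF g(3) refl]]) simp
  then have "\<phi> \<in> forms (e1 + e2)" by (simp add: g(7) forms_scale)
  then have rank: "hankel_rank w = e1 + e2" using forms_degree_unique[OF \<phi>(3) _ \<phi>(4)] by simp
  have "g ^ e1 * h ^ e2 \<in> apolar (e1 + e2)"
    using apolar_scale_iff'[OF ge assms(2) g(1)] \<phi>(2) rank g(7) by simp
  moreover have nz: "g \<noteq> 0" "h \<noteq> 0" using g(4,5) by (auto simp: irreducible_def)
  moreover have "\<not> g dvd h" using proportional_iff_dvd[OF g(2,3) nz] g(6) by simp
  ultimately show ?thesis using that \<phi>(1) g(2,3) rank by blast
qed

lemma waring_type_exists:
  assumes "w \<noteq> zero_dual"
  shows "\<exists>\<phi>\<in>apolar (hankel_rank w). \<phi> \<noteq> 0 \<and> hankel_rank w \<in> {1, 2, 3} \<and>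
    (\<forall>T. has_splitting_type \<phi> T \<longrightarrow> has_waring_type w T)"
proof -
  obtain \<phi> where \<phi>: "is_least_generator w \<phi>" "\<phi> \<in> apolar (hankel_rank w)" "\<phi> \<noteq> 0" "hankel_rank w \<in> {1, 2, 3}"
    using least_generator_exists[OF assms] .
  have "\<forall>T. has_splitting_type \<phi> T \<longrightarrow> has_waring_type w T"
    using \<phi>(1) assms unfolding has_waring_type_def by auto
  then show ?thesis using \<phi>(2-4) by blast
qed

text \<open>
  An apolar square \<open>l\<^sup>2\<close> of a linear form is a least generator as soon as the rank is not \<open>1\<close>.
\<close>

lemma linear_square_not_apolar:
  assumes w0: "w \<noteq> zero_dual" and no: "\<not> has_waring_type w {#(1, 1)#}" "\<not> has_waring_type w {#(1, 2)#}"
    and l: "l \<in> nforms 1"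
  shows "l\<^sup>2 \<notin> apolar_ideal 5 w" and "hankel_rank w \<in> {2, 3}"
proof -
  obtain \<phi> where \<phi>: "\<phi> \<in> apolar (hankel_rank w)" "\<phi> \<noteq> 0" "hankel_rank w \<in> {1, 2, 3}"
    "\<forall>T. has_splitting_type \<phi> T \<longrightarrow> has_waring_type w T" using waring_type_exists[OF w0] by blast
  have not1: "hankel_rank w \<noteq> 1"
  proof
    assume 1: "hankel_rank w = 1"
    then have "\<phi> \<in> forms 1" using apolarD[OF \<phi>(1)] by simp
    then have "has_splitting_type (scale 1 (\<phi> ^ 1)) {#(1, 1)#}"
      using linear_irreducible \<phi>(2) by (intro has_splitting_type_power) auto
    then show False using \<phi>(4) no(1) by simp
  qed
  then show "hankel_rank w \<in> {2, 3}" using \<phi>(3) by auto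
  show "l\<^sup>2 \<notin> apolar_ideal 5 w"
  proof
    assume "l\<^sup>2 \<in> apolar_ideal 5 w"
    then have l2: "l\<^sup>2 \<in> apolar 2" using forms_power[OF nforms_forms[OF l], of 2 2] by (simp add: apolar_def)
    have nz: "l\<^sup>2 \<noteq> 0" using nforms_nonzero[OF l] by simp
    have rank: "hankel_rank w = 2" using hankel_rank_le_2[OF l2 nz] not1 \<phi>(3) by auto
    then have "is_least_generator w (l\<^sup>2)" using least_generatorI[OF w0] l2 nz by simp
    moreover have "has_splitting_type (scale 1 (l ^ 2)) {#(1, 2)#}"
      using nforms_1_irreducible[OF l] by (intro has_splitting_type_power) auto
    ultimately show False using no(2) w0 by (auto simp: has_waring_type_def)
  qed
qed

lemma no_apolar_below_rank:
  assumes "w \<noteq> zero_dual" "g \<in> apolar m" "g \<noteq> 0"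
  shows "hankel_rank w \<le> m"
  using rank_le_degree[OF assms(1) apolarD[OF assms(2)] assms(3) apolar_ideal_if[OF assms(2)]] .

end

theorem theorem3p4:
  fixes \<psi> :: "'a::{field,finite} \<Rightarrow> complex"
    and w :: "'a binpoly \<Rightarrow> 'a"
    and q :: complex
  assumes "q = of_nat CARD('a)"
    and "CHAR('a) > 2"
    and "nontrivial_additive_character \<psi>"
    and "w \<in> dual_forms 5"
  shows
    "(w = zero_dual \<longrightarrow> Phi_hat \<psi> w = 1 / q + 1 / q ^ 2 - 1 / q ^ 3) \<and>
     (has_waring_type w {#(1, 1)#} \<or> has_waring_type w {#(1, 2)#} \<longrightarrow>
        Phi_hat \<psi> w = 1 / q ^ 2 - 1 / q ^ 3) \<and>
     (w \<noteq> zero_dual \<and> \<not> has_waring_type w {#(1, 1)#} \<and> \<not> has_waring_type w {#(1, 2)#} \<longrightarrow>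
        Phi_hat \<psi> w = C w / q ^ 4 \<and>
        (has_waring_type w {#(1, 1), (1, 1)#} \<longrightarrow> C w \<in> {-1}) \<and>
        (has_waring_type w {#(2, 1)#} \<longrightarrow> C w \<in> {1}) \<and>
        (has_waring_type w {#(1, 3)#} \<longrightarrow> C w \<in> {0, 1, -1}) \<and>
        (has_waring_type w {#(1, 2), (1, 1)#} \<longrightarrow> C w \<in> {0, 1, -1, -2, -3}) \<and>
        (\<not> has_waring_type w {#(1, 1), (1, 1)#} \<and> \<not> has_waring_type w {#(2, 1)#} \<and>
         \<not> has_waring_type w {#(1, 3)#} \<and> \<not> has_waring_type w {#(1, 2), (1, 1)#} \<longrightarrow>
           (has_waring_type w {#(1, 1), (1, 1), (1, 1)#} \<or>
            has_waring_type w {#(2, 1), (1, 1)#} \<or> has_waring_type w {#(3, 1)#}) \<and>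
           C w \<in> {0, 1, -1, 2, -2, 3, -3, 4, -4}))"
proof -
  interpret quintic_functional \<psi> w by unfold_locales (use assms in auto)
  have q: "q \<noteq> 0" using assms(1) by simp
  have zero: "Phi_hat \<psi> w = 1 / q + 1 / q ^ 2 - 1 / q ^ 3" if w0: "w = zero_dual"
  proof -
    have all: "f \<in> apolar_ideal 5 w" for f
      unfolding apolar_ideal_def polar_def w0 by (auto simp: fun_eq_iff)
    have "card {l \<in> nforms 1. (l :: 'a binpoly)\<^sup>2 \<in> apolar_ideal 5 w} = CARD('a) + 1"
      using all card_nforms_1[where 'a = 'a] by simp
    moreover have "C w = - q" using sum_eps[where 'a = 'a] all assms(1) by (simp add: C_eq square_zeros_def)
    ultimately have "Phi_hat \<psi> w = (q + 1) / q ^ 2 + - q / q ^ 4"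
      using Phi_hat_formula[OF \<psi> w] assms(1) by simp
    then show ?thesis using q by (simp add: add_divide_distrib eval_nat_numeral)
  qed
  have degenerate: "Phi_hat \<psi> w = 1 / q ^ 2 - 1 / q ^ 3"
    if "has_waring_type w {#(1, 1)#} \<or> has_waring_type w {#(1, 2)#}"
    using that
  proof
    assume "has_waring_type w {#(1, 1)#}"
    then obtain g where g: "w \<noteq> zero_dual" "g \<in> forms 1" "g ^ 1 \<in> apolar (1 * 1)" "g \<noteq> 0"
      by (rule waring_type_power) simp_all
    then show ?thesis using Phi_hat_if_linear_square_apolar[OF g(2,4)] assms(1) by simp
  next
    assume "has_waring_type w {#(1, 2)#}"
    then obtain g where g: "w \<noteq> zero_dual" "g \<in> forms 1" "g ^ 2 \<in> apolar (1 * 2)" "hankel_rank w = 1 * 2" "g \<noteq> 0"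
      by (rule waring_type_power) simp_all
    have "g \<notin> apolar 1" using no_apolar_below_rank[OF g(1) _ g(5), of 1] g(4) by auto
    then show ?thesis using Phi_hat_if_linear_square_apolar[OF g(2,5)] g(3) assms(1) by simp
  qed
  have generic: "Phi_hat \<psi> w = C w / q ^ 4 \<and>
        (has_waring_type w {#(1, 1), (1, 1)#} \<longrightarrow> C w \<in> {-1}) \<and>
        (has_waring_type w {#(2, 1)#} \<longrightarrow> C w \<in> {1}) \<and>
        (has_waring_type w {#(1, 3)#} \<longrightarrow> C w \<in> {0, 1, -1}) \<and>
        (has_waring_type w {#(1, 2), (1, 1)#} \<longrightarrow> C w \<in> {0, 1, -1, -2, -3}) \<and>
        (\<not> has_waring_type w {#(1, 1), (1, 1)#} \<and> \<not> has_waring_type w {#(2, 1)#} \<and>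
         \<not> has_waring_type w {#(1, 3)#} \<and> \<not> has_waring_type w {#(1, 2), (1, 1)#} \<longrightarrow>
           (has_waring_type w {#(1, 1), (1, 1), (1, 1)#} \<or>
            has_waring_type w {#(2, 1), (1, 1)#} \<or> has_waring_type w {#(3, 1)#}) \<and>
           C w \<in> {0, 1, -1, 2, -2, 3, -3, 4, -4})"
    if w0: "w \<noteq> zero_dual" and no: "\<not> has_waring_type w {#(1, 1)#}" "\<not> has_waring_type w {#(1, 2)#}"
  proof (intro conjI impI)
    show "Phi_hat \<psi> w = C w / q ^ 4"
      using Phi_hat_eq_C linear_square_not_apolar(1)[OF w0 no] assms(1) by simp
  next
    assume "has_waring_type w {#(1, 1), (1, 1)#}"
    then obtain g h where gh: "g \<in> forms 1" "g \<noteq> 0" "h \<in> forms 1" "\<not> g dvd h"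
      "g ^ 1 * h ^ 1 \<in> apolar (1 + 1)" "hankel_rank w = 1 + 1"
      by (rule waring_type_two_linear) simp_all
    have "h \<noteq> 0" using gh(4) by auto
    then have "g \<notin> apolar 1" "h \<notin> apolar 1"
      using no_apolar_below_rank[OF w0, of g 1] no_apolar_below_rank[OF w0, of h 1] gh(2,6) by auto
    then show "C w \<in> {-1}" using C_split_quadratic[OF gh(1-4)] gh(5) by (simp add: numeral_2_eq_2)
  next
    assume "has_waring_type w {#(2, 1)#}"
    then obtain g where g: "irreducible g" "g ^ 1 \<in> apolar (2 * 1)"
      by (rule waring_type_power) simp_all
    then show "C w \<in> {1}" using C_irreducible_quadratic[OF w0 g(1)] by simp
  next
    assume "has_waring_type w {#(1, 3)#}"
    then obtain g where g: "g \<in> forms 1" "g ^ 3 \<in> apolar (1 * 3)" "hankel_rank w = 1 * 3" "g \<noteq> 0"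
      by (rule waring_type_power) simp_all
    have "g\<^sup>2 \<notin> apolar 2" using no_apolar_below_rank[OF w0, of "g\<^sup>2" 2] g(3,4) by auto
    then show "C w \<in> {0, 1, -1}" using C_cube[OF g(1,4)] g(2) by simp
  next
    assume "has_waring_type w {#(1, 2), (1, 1)#}"
    then obtain g h where gh: "g \<in> forms 1" "g \<noteq> 0" "h \<in> forms 1" "\<not> g dvd h"
      "g ^ 2 * h ^ 1 \<in> apolar (2 + 1)" "hankel_rank w = 2 + 1"
      by (rule waring_type_two_linear) simp_all
    have "h \<noteq> 0" using gh(4) by auto
    then have "g\<^sup>2 \<notin> apolar 2" "g * h \<notin> apolar 2"
      using no_apolar_below_rank[OF w0, of "g\<^sup>2" 2] no_apolar_below_rank[OF w0, of "g * h" 2] gh(2,6) by auto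
    then show "C w \<in> {0, 1, -1, -2, -3}"
      using C_square_times_linear[OF gh(1-4)] gh(5) by simp
  next
    assume other: "\<not> has_waring_type w {#(1, 1), (1, 1)#} \<and> \<not> has_waring_type w {#(2, 1)#} \<and>
         \<not> has_waring_type w {#(1, 3)#} \<and> \<not> has_waring_type w {#(1, 2), (1, 1)#}"
    obtain \<phi> where \<phi>: "\<phi> \<in> apolar (hankel_rank w)" "\<phi> \<noteq> 0"
      "\<forall>T. has_splitting_type \<phi> T \<longrightarrow> has_waring_type w T" using waring_type_exists[OF w0] by blast
    have "hankel_rank w \<noteq> 2"
    proof
      assume "hankel_rank w = 2"
      then have "\<phi> \<in> forms 2" using apolarD[OF \<phi>(1)] by simp
      from quadratic_splitting_types[OF this \<phi>(2)] show False using \<phi>(3) other no(2) by blast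
    qed
    then have rank: "hankel_rank w = 3" using linear_square_not_apolar(2)[OF w0 no X_nforms] by simp
    then have "\<phi> \<in> forms 3" using apolarD[OF \<phi>(1)] by simp
    from cubic_splitting_types[OF this \<phi>(2)]
    show "has_waring_type w {#(1, 1), (1, 1), (1, 1)#} \<or>
            has_waring_type w {#(2, 1), (1, 1)#} \<or> has_waring_type w {#(3, 1)#}"
      using \<phi>(3) other by blast
    show "C w \<in> {0, 1, -1, 2, -2, 3, -3, 4, -4}" using C_generic[OF rank] .
  qed
  show ?thesis using zero degenerate generic by blast
qed

end
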